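(* Let $B$ be a thin Blaschke product. Let $L\subseteq\mathbb{D}$ be a curve containing $B^{-1}(\mathcal{E}_B)$ with $\mathbb{D}\setminus L$ simply connected, let $\{\rho_k\}_{k=0}^\infty$ be the local inverses of $B$ on $\mathbb{D}\setminus L$, and for $w\in\mathbb{D}\setminus L$ let $\pi_w(h)=\{h(\rho_k(w))\rho_k'(w)\}_{k\ge0}\in l^2$ for $h\in L^2_a(\mathbb{D})$ (see context). If $S$ is a unitary operator on the Bergman space $L_a^2(\mathbb{D})$ which commutes with $M_B$, then there is a unique operator $W:l^2\to l^2$ such that $$W\pi_w(h)=\pi_w(Sh),\qquad h\in L_a^2(\mathbb{D}),\ w\in\mathbb{D}\setminus L.$$ This $W$ is necessarily a unitary operator. Moreover, there is a unique vector $\{c_k\}_{k\ge 0}\in l^2$ satisfying $$Sh(z)=\sum_{k=0}^\infty c_k\,h(\rho_k(z))\,\rho_k'(z),\qquad h\in L_a^2(\mathbb{D}),\ z\in\mathbb{D}\setminus L,$$ where all the holomorphic functions $\rho_k$ satisfy $B\circ\rho_k=B$ on $\mathbb{D}\setminus L$, and the right-hand side converges uniformly on compact subsets of $\mathbb{D}\setminus L$.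
   Context: $L^2_a(\mathbb{D})$ is the Bergman space of holomorphic functions on the open unit disk $\mathbb{D}$ that are square integrable with respect to normalized area measure; $M_B$ is multiplication by $B$ on it. "Operator" means bounded linear operator. A thin Blaschke product is an infinite Blaschke product $B$ whose zero sequence $\{z_n\}$ satisfies $\lim_{k\to\infty}\prod_{j\ne k} d(z_j,z_k)=1$, where $d(z,\lambda)=\left|\frac{\lambda-z}{1-\overline{\lambda}z}\right|$. $\mathcal{E}_B=\{B(z): z\in\mathbb{D},\,B'(z)=0\}$. The set $B^{-1}(\mathcal{E}_B)$ has no accumulation point in $\mathbb{D}$, and one fixes a curve $L\subseteq\mathbb{D}$, relatively closed in $\mathbb{D}$ and consisting of at most countably many $C^1$-arcs, such that $B^{-1}(\mathcal{E}_B)\subseteq L$ and the open set $\mathbb{D}\setminus L$ is (connected and) simply connected. A local inverse of $B$ on a domain $V\subseteq\mathbb{D}$ is a holomorphic map $\rho:V\to\mathbb{D}$ with $B\circ\rho=B$ on $V$. Each local inverse of $B$ defined near a point of $\mathbb{D}\setminus L$ extends analytically to a local inverse on $\mathbb{D}\setminus L$. $\{\rho_k\}_{k=0}^\infty$ denotes the enumeration (without repetition) of all the local inverses of $B$ on $\mathbb{D}\setminus L$, with $\rho_0(z)=z$; thus for every $z\in\mathbb{D}\setminus L$ the points $\rho_k(z)$, $k\ge 0$, are distinct and $B^{-1}(B(z))=\{\rho_k(z):k\ge0\}$. For $w\in \mathbb{D}\setminus L$ and $h\in L^2_a(\mathbb{D})$ the sequence $\pi_w(h)$ belongs to $l^2$.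 *)

theory Defs
  imports "HOL-Complex_Analysis.Complex_Analysis"
begin

abbreviation unit_disc :: "complex set" where
  "unit_disc \<equiv> ball 0 1"

text \<open>
  Function spaces are complex subspaces of \<open>'a \<Rightarrow> complex\<close>, given by a carrier \<open>V\<close> and an inner
  product \<open>ip\<close> (linear in its first argument). Operators on \<open>V\<close> are extensional on \<open>V\<close>, so
  that equality of operators is HOL equality.
\<close>

definition ip_norm :: "(('a \<Rightarrow> complex) \<Rightarrow> ('a \<Rightarrow> complex) \<Rightarrow> complex) \<Rightarrow> ('a \<Rightarrow> complex) \<Rightarrow> real" where
  "ip_norm ip f = sqrt (Re (ip f f))"

definition bounded_operator ::
  "('a \<Rightarrow> complex) set \<Rightarrow> (('a \<Rightarrow> complex) \<Rightarrow> ('a \<Rightarrow> complex) \<Rightarrow> complex)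
    \<Rightarrow> (('a \<Rightarrow> complex) \<Rightarrow> ('a \<Rightarrow> complex)) \<Rightarrow> bool" where
  "bounded_operator V ip T \<longleftrightarrow>
     T \<in> V \<rightarrow>\<^sub>E V \<and>
     (\<forall>f\<in>V. \<forall>g\<in>V. T (\<lambda>x. f x + g x) = (\<lambda>x. T f x + T g x)) \<and>
     (\<forall>c. \<forall>f\<in>V. T (\<lambda>x. c * f x) = (\<lambda>x. c * T f x)) \<and>
     (\<exists>C. \<forall>f\<in>V. ip_norm ip (T f) \<le> C * ip_norm ip f)"

definition unitary_operator ::
  "('a \<Rightarrow> complex) set \<Rightarrow> (('a \<Rightarrow> complex) \<Rightarrow> ('a \<Rightarrow> complex) \<Rightarrow> complex)
    \<Rightarrow> (('a \<Rightarrow> complex) \<Rightarrow> ('a \<Rightarrow> complex)) \<Rightarrow> bool" where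
  "unitary_operator V ip T \<longleftrightarrow>
     bounded_operator V ip T \<and> T ` V = V \<and> (\<forall>f\<in>V. \<forall>g\<in>V. ip (T f) (T g) = ip f g)"

definition l2 :: "(nat \<Rightarrow> complex) set" where
  "l2 = {a. summable (\<lambda>k. (cmod (a k))\<^sup>2)}"

definition l2_inner :: "(nat \<Rightarrow> complex) \<Rightarrow> (nat \<Rightarrow> complex) \<Rightarrow> complex" where
  "l2_inner a b = (\<Sum>k. a k * cnj (b k))"

text \<open>
  An element of the Bergman space is represented by its extension by zero to the whole plane.
\<close>

definition bergman :: "(complex \<Rightarrow> complex) set" where
  "bergman = {f. f holomorphic_on unit_disc \<and>
                 set_integrable lborel unit_disc (\<lambda>z. (cmod (f z))\<^sup>2) \<and>
                 (\<forall>z. z \<notin> unit_disc \<longrightarrow> f z = 0)}"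

text \<open>The factor \<open>1 / pi\<close> normalizes the area of the disc to 1.\<close>

definition bergman_inner :: "(complex \<Rightarrow> complex) \<Rightarrow> (complex \<Rightarrow> complex) \<Rightarrow> complex" where
  "bergman_inner f g =
     complex_of_real (1 / pi) * set_lebesgue_integral lborel unit_disc (\<lambda>z. f z * cnj (g z))"

text \<open>
  \<open>B\<close> need only be meaningful on the disc, since elements of \<^const>\<open>bergman\<close> vanish off the disc.
\<close>

definition mult_op :: "(complex \<Rightarrow> complex) \<Rightarrow> (complex \<Rightarrow> complex) \<Rightarrow> (complex \<Rightarrow> complex)" where
  "mult_op B f = (\<lambda>z. B z * f z)"

definition pseudohyp_dist :: "complex \<Rightarrow> complex \<Rightarrow> real" where
  "pseudohyp_dist z w = cmod ((w - z) / (1 - cnj w * z))"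

definition blaschke_factor :: "complex \<Rightarrow> complex \<Rightarrow> complex" where
  "blaschke_factor a z =
     (if a = 0 then z else complex_of_real (cmod a) / a * ((a - z) / (1 - cnj a * z)))"

text \<open>
  \<open>a\<close> is the zero sequence, repeated according to multiplicity. Only the values of \<open>B\<close> on the
  disc are constrained.
\<close>

definition blaschke_product_with_zeros :: "(nat \<Rightarrow> complex) \<Rightarrow> (complex \<Rightarrow> complex) \<Rightarrow> bool" where
  "blaschke_product_with_zeros a B \<longleftrightarrow>
     (\<forall>n. a n \<in> unit_disc) \<and> summable (\<lambda>n. 1 - cmod (a n)) \<and>
     (\<exists>c. cmod c = 1 \<and> (\<forall>z\<in>unit_disc. B z = c * (\<Prod>n. blaschke_factor (a n) z)))"

definition thin_blaschke_product :: "(complex \<Rightarrow> complex) \<Rightarrow> bool" where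
  "thin_blaschke_product B \<longleftrightarrow>
     (\<exists>a. blaschke_product_with_zeros a B \<and>
          (\<lambda>k. \<Prod>j. if j = k then 1 else pseudohyp_dist (a j) (a k)) \<longlonglongrightarrow> 1)"

definition critical_values :: "(complex \<Rightarrow> complex) \<Rightarrow> complex set" where
  "critical_values B = {B z |z. z \<in> unit_disc \<and> deriv B z = 0}"

text \<open>
  The arcs are compact; an arc running out to the unit circle is a countable union of such arcs.
\<close>

definition countable_union_of_C1_arcs :: "complex set \<Rightarrow> bool" where
  "countable_union_of_C1_arcs L \<longleftrightarrow>
     (\<exists>\<Gamma>. countable \<Gamma> \<and> (\<forall>\<gamma>\<in>\<Gamma>. arc \<gamma> \<and> \<gamma> C1_differentiable_on {0..1}) \<and>
          L = (\<Union>\<gamma>\<in>\<Gamma>. path_image \<gamma>))"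

definition local_inverse ::
  "(complex \<Rightarrow> complex) \<Rightarrow> complex set \<Rightarrow> (complex \<Rightarrow> complex) \<Rightarrow> bool" where
  "local_inverse B V \<rho> \<longleftrightarrow>
     \<rho> holomorphic_on V \<and> \<rho> ` V \<subseteq> unit_disc \<and> (\<forall>z\<in>V. B (\<rho> z) = B z)"

text \<open>Local inverses on \<open>V\<close> are identified when they agree on \<open>V\<close>.\<close>

definition enumerates_local_inverses ::
  "(complex \<Rightarrow> complex) \<Rightarrow> complex set \<Rightarrow> (nat \<Rightarrow> complex \<Rightarrow> complex) \<Rightarrow> bool" where
  "enumerates_local_inverses B V \<rho> \<longleftrightarrow>
     (\<forall>k. local_inverse B V (\<rho> k)) \<and>
     (\<forall>\<sigma>. local_inverse B V \<sigma> \<longrightarrow> (\<exists>k. \<forall>z\<in>V. \<rho> k z = \<sigma> z)) \<and>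
     (\<forall>j k. (\<forall>z\<in>V. \<rho> j z = \<rho> k z) \<longrightarrow> j = k) \<and>
     (\<forall>z\<in>V. \<rho> 0 z = z)"

definition pi_map ::
  "(nat \<Rightarrow> complex \<Rightarrow> complex) \<Rightarrow> complex \<Rightarrow> (complex \<Rightarrow> complex) \<Rightarrow> (nat \<Rightarrow> complex)" where
  "pi_map \<rho> w h = (\<lambda>k. h (\<rho> k w) * deriv (\<rho> k) w)"

end

theory Submission
  imports Defs
begin

text \<open>
  Write \<open>G\<close> for the disc without \<open>L\<close>. Everything follows from one identity: for \<open>h\<close>, \<open>g\<close> in the
  Bergman space and \<open>w\<close>, \<open>v\<close> in \<open>G\<close>, the inner product of \<open>\<pi>\<^sub>w h\<close> and \<open>\<pi>\<^sub>v g\<close> in \<open>l\<^sup>2\<close> equals that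
  of \<open>\<pi>\<^sub>w (S h)\<close> and \<open>\<pi>\<^sub>v (S g)\<close> (\<open>inner_pi_map_eq_of_commuting_unitary\<close>).

  For \<open>w = v\<close> the reason is measure theoretic. As \<open>S\<close> is isometric and commutes with multiplication
  by \<open>B\<close>, the function \<open>f = h g\<^sup>* - S h (S g)\<^sup>*\<close> (a star denotes conjugation) is
  annihilated by all \<open>B\<^sup>m (B\<^sup>*)\<^sup>n\<close>; by the Stone-Weierstrass theorem the image under \<open>B\<close> of the
  measure \<open>f dA\<close> is zero (\<open>vanishing_moments_imp_zero\<close>). A change of variables on each sheet \<open>\<rho>\<^sub>k\<close>
  shows that, up to the factor \<open>\<bar>B'(w)\<bar>\<^sup>-\<^sup>2\<close>, its density at \<open>B w\<close> is the sum of
  \<open>f(\<rho>\<^sub>k w) \<bar>\<rho>\<^sub>k'(w)\<bar>\<^sup>2\<close> over \<open>k\<close>, which is the difference of the two sides (\<open>gram_eq_of_moments\<close>).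
  Both sides are holomorphic in \<open>w\<close> and antiholomorphic in \<open>v\<close>, so equality on the diagonal
  propagates to all \<open>w\<close> and \<open>v\<close> (\<open>sesquiholomorphic_zero_on_diagonal\<close>).

  The computation of the density needs the points \<open>\<rho>\<^sub>k w\<close> to exhaust the fibre of \<open>B\<close> through \<open>w\<close>, and
  this is where thinness enters. By the Schwarz lemma \<open>B\<close> is almost a rotation in a large hyperbolic
  disc around all but finitely many of its zeros, and for a suitable hyperbolic radius, depending on
  \<open>r < 1\<close>, these discs cover the set \<open>\<bar>B\<bar> \<le> r\<close> near the circle. Hence \<open>(1 - \<bar>z\<bar>\<^sup>2) \<bar>B'(z)\<bar>\<close> is bounded below on the preimage of a small
  disc around any value that is not critical, the inverse branches there live on discs of a uniform
  size, and \<open>B\<close> is a covering (\<open>thin_blaschke_covering_space\<close>). Lifting along the simply connected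
  \<open>G\<close> produces a local inverse through every point of the fibre (\<open>rho_surj_fibre\<close>).

  The rest is geometry in \<open>l\<^sup>2\<close>. The functions \<open>(B(z) - B(w)) / (z - \<rho>\<^sub>k w)\<close> show that every unit vector
  is some \<open>\<pi>\<^sub>w h\<close> (\<open>pi_map_eq_l2_unit\<close>), and two families with the same Gram matrix that both contain
  the unit vectors are exchanged by exactly one bounded operator, which is unitary
  (\<open>equal_gram_unitary\<close>). As \<open>\<rho>\<^sub>0\<close> is the identity, \<open>S h z\<close> is the coordinate of index 0 of
  \<open>W (\<pi>\<^sub>z h)\<close>, and the row of index 0 of the matrix of \<open>W\<close> is the sequence \<open>c\<close>. Square summability and
  uniform convergence on compact sets come from the mean value property: the integrals of
  \<open>\<bar>h \<circ> \<rho>\<^sub>k\<bar>\<^sup>2 \<bar>\<rho>\<^sub>k'\<bar>\<^sup>2\<close> over a small disc are those of \<open>\<bar>h\<bar>\<^sup>2\<close> over disjoint sheets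
  (\<open>pi_map_locally_dominated\<close>).
\<close>

section \<open>Change of variables for injective holomorphic maps\<close>

definition vec_of_complex :: "complex \<Rightarrow> real ^ 2" where
  "vec_of_complex z = (\<chi> i. if i = 1 then Re z else Im z)"

definition complex_of_vec :: "real ^ 2 \<Rightarrow> complex" where
  "complex_of_vec v = Complex (v $ 1) (v $ 2)"

lemma complex_of_vec_inverse [simp]:
  "complex_of_vec (vec_of_complex z) = z" "vec_of_complex (complex_of_vec v) = v"
  by (auto simp: complex_of_vec_def vec_of_complex_def vec_eq_iff forall_2)

lemma vec_of_complex_nth [simp]: "vec_of_complex z $ 1 = Re z" "vec_of_complex z $ 2 = Im z"
  by (auto simp: vec_of_complex_def)

lemma bounded_linear_vec_of_complex: "bounded_linear vec_of_complex"
proof -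
  have "linear vec_of_complex"
    by (rule linearI) (auto simp: vec_of_complex_def vec_eq_iff)
  thus ?thesis
    using linear_conv_bounded_linear by blast
qed

lemma bounded_linear_complex_of_vec: "bounded_linear complex_of_vec"
proof -
  have "linear complex_of_vec"
    by (rule linearI) (auto simp: complex_of_vec_def complex_eq_iff)
  thus ?thesis
    using linear_conv_bounded_linear by blast
qed

lemma borel_measurable_vec_of_complex [measurable]: "vec_of_complex \<in> borel_measurable borel"
  by (intro borel_measurable_continuous_onI linear_continuous_on bounded_linear_vec_of_complex)

lemma borel_measurable_complex_of_vec [measurable]: "complex_of_vec \<in> borel_measurable borel"
  by (intro borel_measurable_continuous_onI linear_continuous_on bounded_linear_complex_of_vec)

text \<open>
  The identification of the plane with \<open>real ^ 2\<close> preserves Lebesgue measure because boxes go to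
  boxes with the same sides; this carries the substitution rule over from \<open>real ^ 2\<close>.
\<close>

lemma distr_lborel_vec_of_complex: "distr lborel borel vec_of_complex = lborel"
proof (rule lborel_eqI[symmetric])
  fix l u :: "real ^ 2"
  assume le: "\<And>b. b \<in> Basis \<Longrightarrow> l \<bullet> b \<le> u \<bullet> b"
  have le': "l $ i \<le> u $ i" for i
    using le[of "axis i 1"] by (simp add: inner_axis axis_in_Basis_iff)
  have vimage: "vec_of_complex -` box l u = box (complex_of_vec l) (complex_of_vec u)"
    by (auto simp: box_def Basis_complex_def complex_of_vec_def mem_box_cart
        Basis_vec_def inner_axis forall_2)
  have "emeasure (distr lborel borel vec_of_complex) (box l u) =
          emeasure lborel (box (complex_of_vec l) (complex_of_vec u))"
    by (subst emeasure_distr) (auto simp: vimage)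
  also have "\<dots> = (\<Prod>b\<in>Basis. (complex_of_vec u - complex_of_vec l) \<bullet> b)"
    by (subst emeasure_lborel_box) (use le' in \<open>auto simp: Basis_complex_def complex_of_vec_def\<close>)
  also have "(\<Prod>b\<in>Basis. (complex_of_vec u - complex_of_vec l) \<bullet> b) = (\<Prod>i\<in>UNIV. (u - l) $ i)"
    by (simp add: Basis_complex_def complex_of_vec_def UNIV_2)
  also have "\<dots> = (\<Prod>b\<in>Basis. (u - l) \<bullet> b)"
  proof -
    have B: "(Basis :: (real ^ 2) set) = (\<lambda>i. axis i 1) ` UNIV"
      by (auto simp: Basis_vec_def)
    show ?thesis
      unfolding B by (subst prod.reindex) (auto simp: inj_on_def axis_eq_axis inner_axis)
  qed
  finally show "emeasure (distr lborel borel vec_of_complex) (box l u) = (\<Prod>b\<in>Basis. (u - l) \<bullet> b)" .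
qed auto

text \<open>
  The Jacobian of a holomorphic map is the square of the modulus of its derivative.
\<close>

lemma det_matrix_complex_mult:
  "det (matrix (\<lambda>v. vec_of_complex (c * complex_of_vec v))) = (cmod c)\<^sup>2"
  by (simp add: det_2 matrix_def complex_of_vec_def axis_def cmod_power2) (simp add: power2_eq_square)

lemma set_integral_vec_of_complex:
  fixes f :: "complex \<Rightarrow> 'b :: {banach, second_countable_topology}"
  assumes "T \<in> sets borel" and f: "set_borel_measurable borel T f"
  shows "set_integrable lborel T f \<longleftrightarrow>
           set_integrable lborel (vec_of_complex ` T) (\<lambda>v. f (complex_of_vec v))"
    and "set_lebesgue_integral lborel T f =
           set_lebesgue_integral lborel (vec_of_complex ` T) (\<lambda>v. f (complex_of_vec v))"
proof -
  let ?F = "\<lambda>z. indicat_real T z *\<^sub>R f z"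
  have ind: "indicat_real (vec_of_complex ` T) v = indicat_real T (complex_of_vec v)" for v
    by (auto simp: indicator_def image_iff) (metis complex_of_vec_inverse)+
  have [measurable]: "?F \<in> borel_measurable borel"
    using f unfolding set_borel_measurable_def by simp
  show "set_integrable lborel T f \<longleftrightarrow>
           set_integrable lborel (vec_of_complex ` T) (\<lambda>v. f (complex_of_vec v))"
    unfolding set_integrable_def ind
    by (subst distr_lborel_vec_of_complex[symmetric], subst integrable_distr_eq) auto
  show "set_lebesgue_integral lborel T f =
           set_lebesgue_integral lborel (vec_of_complex ` T) (\<lambda>v. f (complex_of_vec v))"
    unfolding set_lebesgue_integral_def ind
    by (subst distr_lborel_vec_of_complex[symmetric], subst integral_distr) auto
qed

lemma set_integral_lborel_eq_integral:
  fixes f :: "'a :: euclidean_space \<Rightarrow> 'b :: euclidean_space"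
  assumes "set_borel_measurable borel T f"
  shows "set_integrable lborel T f \<longleftrightarrow> f absolutely_integrable_on T"
    and "set_lebesgue_integral lborel T f = set_lebesgue_integral lebesgue T f"
  using assms unfolding set_integrable_def set_lebesgue_integral_def set_borel_measurable_def
  by (auto simp: integrable_completion integral_completion)

text \<open>
  The substitution rule as an equality that also holds when neither side is integrable, both
  integrals then being 0 by convention.
\<close>

lemma absolutely_integrable_change_of_variables_real2:
  fixes f :: "real ^ 2 \<Rightarrow> real ^ 2" and g :: "real ^ 2 \<Rightarrow> real ^ 2"
  assumes S: "S \<in> sets lebesgue"
    and der_g: "\<And>x. x \<in> S \<Longrightarrow> (g has_derivative g' x) (at x within S)"
    and inj: "inj_on g S"
  shows "(\<lambda>x. \<bar>det (matrix (g' x))\<bar> *\<^sub>R f(g x)) absolutely_integrable_on S \<longleftrightarrow> f absolutely_integrable_on (g ` S)"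
    and "set_lebesgue_integral lebesgue S (\<lambda>x. \<bar>det (matrix (g' x))\<bar> *\<^sub>R f(g x)) = set_lebesgue_integral lebesgue (g ` S) f"
proof -
  note cov = has_absolute_integral_change_of_variables[OF assms, of f]
  show iff: "(\<lambda>x. \<bar>det (matrix (g' x))\<bar> *\<^sub>R f(g x)) absolutely_integrable_on S \<longleftrightarrow> f absolutely_integrable_on (g ` S)"
    using cov by blast
  show "set_lebesgue_integral lebesgue S (\<lambda>x. \<bar>det (matrix (g' x))\<bar> *\<^sub>R f(g x)) = set_lebesgue_integral lebesgue (g ` S) f"
  proof (cases "f absolutely_integrable_on (g ` S)")
    case True
    thus ?thesis
      using cov iff by (simp add: set_lebesgue_integral_eq_integral)
  next
    case False
    thus ?thesis
      using iff by (simp add: set_lebesgue_integral_def set_integrable_def not_integrable_integral_eq)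
  qed
qed

text \<open>
  The plane is transported to \<open>real ^ 2\<close> on both sides of \<open>g\<close>; values of \<open>f\<close> are transported as
  well, since the rule over \<open>real ^ 2\<close> concerns functions into a real coordinate space.
\<close>

theorem holomorphic_change_of_variables:
  fixes f :: "complex \<Rightarrow> complex" and g :: "complex \<Rightarrow> complex"
  assumes S: "open S" and g: "g holomorphic_on S" and inj: "inj_on g S"
    and f: "set_borel_measurable borel (g ` S) f"
  shows "set_integrable lborel (g ` S) f \<longleftrightarrow>
           set_integrable lborel S (\<lambda>z. of_real ((cmod (deriv g z))\<^sup>2) * f (g z))"
    and "set_lebesgue_integral lborel (g ` S) f =
           set_lebesgue_integral lborel S (\<lambda>z. of_real ((cmod (deriv g z))\<^sup>2) * f (g z))"
proof -
  define S' where "S' = vec_of_complex ` S"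
  define g' where "g' = (\<lambda>v. vec_of_complex (g (complex_of_vec v)))"
  define f' where "f' = (\<lambda>v. vec_of_complex (f (complex_of_vec v)))"
  define h where "h = (\<lambda>z. of_real ((cmod (deriv g z))\<^sup>2) * f (g z))"
  have S'_vimage: "S' = complex_of_vec -` S"
    by (auto simp: S'_def image_iff) (metis complex_of_vec_inverse(2))
  have "open S'"
    unfolding S'_vimage by (intro open_vimage S linear_continuous_on bounded_linear_complex_of_vec)
  have img: "g' ` S' = vec_of_complex ` (g ` S)"
    by (auto simp: S'_def g'_def image_image)
  have inj': "inj_on g' S'"
    using inj by (auto simp: inj_on_def S'_def g'_def) (metis complex_of_vec_inverse(1))
  have der: "(g' has_derivative (\<lambda>v. vec_of_complex (deriv g (complex_of_vec x) * complex_of_vec v))) (at x within S')"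
    if "x \<in> S'" for x
  proof -
    have "(g has_derivative (\<lambda>v. deriv g (complex_of_vec x) * v)) (at (complex_of_vec x))"
      using that g S unfolding S'_vimage
      by (auto intro!: holomorphic_derivI simp flip: has_field_derivative_def)
    hence "((\<lambda>v. g (complex_of_vec v)) has_derivative (\<lambda>v. deriv g (complex_of_vec x) * complex_of_vec v)) (at x)"
      by (rule has_derivative_compose[rotated])
         (rule bounded_linear.has_derivative[OF bounded_linear_complex_of_vec], rule has_derivative_ident)
    hence "(g' has_derivative (\<lambda>v. vec_of_complex (deriv g (complex_of_vec x) * complex_of_vec v))) (at x)"
      unfolding g'_def by (rule bounded_linear.has_derivative[OF bounded_linear_vec_of_complex])
    thus ?thesis
      by (rule has_derivative_at_withinI)
  qed
  have opT: "open (g ` S)"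
    using open_mapping_thm3[OF g S inj] by blast
  have hm: "set_borel_measurable borel S h"
  proof -
    have 1: "set_borel_measurable borel S (\<lambda>z. of_real ((cmod (deriv g z))\<^sup>2) :: complex)"
      using S g by (intro borel_measurable_continuous_on_indicator[folded set_borel_measurable_def] continuous_intros
         holomorphic_on_imp_continuous_on holomorphic_deriv) auto
    have 2: "set_borel_measurable borel S (\<lambda>z. f (g z))"
    proof -
      have gm: "(\<lambda>z. if z \<in> S then g z else 0) \<in> borel_measurable borel"
        using S g by (intro borel_measurable_continuous_on_if holomorphic_on_imp_continuous_on) auto
      have "(\<lambda>w. indicat_real (g ` S) w *\<^sub>R f w) \<in> borel_measurable borel"
        using f unfolding set_borel_measurable_def .
      note gm' = measurable_compose[OF gm this]
      have "(\<lambda>z. indicat_real S z *\<^sub>R (indicat_real (g ` S) (if z \<in> S then g z else 0) *\<^sub>R f (if z \<in> S then g z else 0))) \<in> borel_measurable borel"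
        using S by (intro borel_measurable_scaleR[OF borel_measurable_indicator gm']) auto
      also have "(\<lambda>z. indicat_real S z *\<^sub>R (indicat_real (g ` S) (if z \<in> S then g z else 0) *\<^sub>R f (if z \<in> S then g z else 0))) = (\<lambda>z. indicat_real S z *\<^sub>R f (g z))"
        by (auto simp: indicator_def fun_eq_iff)
      finally show ?thesis unfolding set_borel_measurable_def .
    qed
    have "(\<lambda>z. (indicat_real S z *\<^sub>R of_real ((cmod (deriv g z))\<^sup>2)) * (indicat_real S z *\<^sub>R f (g z))) \<in> borel_measurable borel"
      using 1 2 unfolding set_borel_measurable_def by (intro borel_measurable_times)
    also have "(\<lambda>z. (indicat_real S z *\<^sub>R of_real ((cmod (deriv g z))\<^sup>2)) * (indicat_real S z *\<^sub>R f (g z))) = (\<lambda>z. indicat_real S z *\<^sub>R h z)"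
      by (auto simp: indicator_def h_def fun_eq_iff)
    finally show ?thesis unfolding set_borel_measurable_def .
  qed
  have push: "set_borel_measurable borel (vec_of_complex ` T) (\<lambda>v. k (complex_of_vec v))"
    if k: "set_borel_measurable borel T k" for T and k :: "complex \<Rightarrow> complex"
  proof -
    have "(\<lambda>v. indicat_real T (complex_of_vec v) *\<^sub>R k (complex_of_vec v)) \<in> borel_measurable borel"
      using measurable_compose[OF borel_measurable_complex_of_vec k[unfolded set_borel_measurable_def]] .
    also have "(\<lambda>v. indicat_real T (complex_of_vec v)) = indicat_real (vec_of_complex ` T)"
      by (auto simp: indicator_def image_iff fun_eq_iff)
    finally show ?thesis unfolding set_borel_measurable_def
      by (simp add: fun_eq_iff)
  qed
  have vec_iff: "set_integrable M T (\<lambda>v. vec_of_complex (k v)) \<longleftrightarrow> set_integrable M T k"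
    "set_lebesgue_integral M T (\<lambda>v. vec_of_complex (k v)) = vec_of_complex (set_lebesgue_integral M T k)"
    for M :: "(real^2) measure" and T and k :: "real ^ 2 \<Rightarrow> complex"
  proof -
    show *: "set_integrable M T (\<lambda>v. vec_of_complex (k v)) \<longleftrightarrow> set_integrable M T k"
      using integrable_bounded_linear[OF bounded_linear_vec_of_complex, of M "\<lambda>v. indicat_real T v *\<^sub>R k v"]
        integrable_bounded_linear[OF bounded_linear_complex_of_vec, of M "\<lambda>v. indicat_real T v *\<^sub>R vec_of_complex (k v)"]
      by (auto simp: set_integrable_def linear_simps[OF bounded_linear_vec_of_complex]
         linear_simps[OF bounded_linear_complex_of_vec])
    show "set_lebesgue_integral M T (\<lambda>v. vec_of_complex (k v)) = vec_of_complex (set_lebesgue_integral M T k)"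
    proof (cases "set_integrable M T k")
      case True
      thus ?thesis
        using integral_bounded_linear[OF bounded_linear_vec_of_complex, of M "\<lambda>v. indicat_real T v *\<^sub>R k v"]
        by (simp add: set_integrable_def set_lebesgue_integral_def linear_simps[OF bounded_linear_vec_of_complex])
    next
      case False
      with * show ?thesis
        by (simp add: set_integrable_def set_lebesgue_integral_def not_integrable_integral_eq
            linear_simps[OF bounded_linear_vec_of_complex])
    qed
  qed
  have S'm: "S' \<in> sets lebesgue"
    using \<open>open S'\<close> by (simp add: lborelD)
  note cov = absolutely_integrable_change_of_variables_real2[OF S'm der inj', of f']
  have integrand: "(\<lambda>x. \<bar>det (matrix (\<lambda>v. vec_of_complex (deriv g (complex_of_vec x) * complex_of_vec v)))\<bar> *\<^sub>R f' (g' x))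
       = (\<lambda>x. vec_of_complex (h (complex_of_vec x)))"
    by (simp add: det_matrix_complex_mult f'_def g'_def h_def fun_eq_iff vec_eq_iff forall_2)
  have Tm: "g ` S \<in> sets borel" "S \<in> sets borel"
    using opT S by auto
  note iff = set_integral_vec_of_complex[OF Tm(1) f] set_integral_vec_of_complex[OF Tm(2) hm]
    set_integral_lborel_eq_integral[OF push[OF f]] set_integral_lborel_eq_integral[OF push[OF hm]]
  show "set_integrable lborel (g ` S) f \<longleftrightarrow>
           set_integrable lborel S (\<lambda>z. of_real ((cmod (deriv g z))\<^sup>2) * f (g z))"
    using cov(1)[unfolded integrand img, unfolded f'_def vec_iff, unfolded S'_def]
    unfolding h_def[symmetric] iff by simp
  have "vec_of_complex (set_lebesgue_integral lborel (g ` S) f) = vec_of_complex (set_lebesgue_integral lborel S h)"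
    using cov(2)[unfolded integrand img, unfolded f'_def vec_iff, unfolded S'_def]
    unfolding h_def[symmetric] iff by simp
  thus "set_lebesgue_integral lborel (g ` S) f =
           set_lebesgue_integral lborel S (\<lambda>z. of_real ((cmod (deriv g z))\<^sup>2) * f (g z))"
    unfolding h_def by (metis complex_of_vec_inverse(1))
qed

section \<open>The mean value property on discs\<close>

lemma set_integral_ball_rotate:
  fixes f :: "complex \<Rightarrow> complex"
  assumes "cmod c = 1" and f: "continuous_on (ball 0 r) f"
  shows "(LINT z:ball 0 r|lborel. f (c * z)) = (LINT z:ball 0 r|lborel. f z)"
proof -
  have c: "c \<noteq> 0" using assms by auto
  have img: "(\<lambda>z. c * z) ` ball 0 r = ball (0::complex) r"
  proof (intro equalityI subsetI)
    fix z :: complex assume "z \<in> ball 0 r"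
    hence "z = c * (z / c)" "z / c \<in> ball 0 r"
      using c assms by (auto simp: norm_divide)
    thus "z \<in> (\<lambda>z. c * z) ` ball 0 r" by blast
  qed (use assms in \<open>auto simp: norm_mult\<close>)
  have "set_borel_measurable borel ((\<lambda>z. c * z) ` ball 0 r) f"
    unfolding img set_borel_measurable_def
    by (intro borel_measurable_continuous_on_indicator f) auto
  from holomorphic_change_of_variables(2)[OF open_ball _ _ this] show ?thesis
    using c assms(1) by (simp add: img inj_on_def holomorphic_intros deriv_linear)
qed

text \<open>
  Rotation by an angle \<open>\<pi> / n\<close> preserves the disc and changes the sign of \<open>z ^ n\<close>.
\<close>

lemma set_integral_ball_power_eq_0:
  assumes "n > 0"
  shows "(LINT z:ball 0 r|lborel. (z::complex) ^ n) = 0"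
proof -
  define c where "c = cis (pi / n)"
  have cn: "c ^ n = -1"
    using assms by (simp add: c_def Complex.DeMoivre mult.commute flip: cis_pi)
  have "(LINT z:ball 0 r|lborel. (z::complex) ^ n) = (LINT z:ball 0 r|lborel. (c * z) ^ n)"
    by (rule set_integral_ball_rotate[symmetric]) (auto simp: c_def intro!: continuous_intros)
  also have "\<dots> = (LINT z:ball 0 r|lborel. - (z ^ n))"
    by (simp add: power_mult_distrib cn)
  also have "\<dots> = - (LINT z:ball 0 r|lborel. z ^ n)"
    by (simp add: set_lebesgue_integral_def)
  finally show ?thesis
    by simp
qed

lemma set_integral_ball_translate:
  fixes f :: "complex \<Rightarrow> complex"
  assumes f: "continuous_on (ball w r) f"
  shows "(LINT z:ball w r|lborel. f z) = (LINT z:ball 0 r|lborel. f (w + z))"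
proof -
  have img: "(\<lambda>z. w + z) ` ball 0 r = ball w r"
    by (simp add: image_add_ball)
  have "set_borel_measurable borel ((\<lambda>z. w + z) ` ball 0 r) f"
    unfolding img set_borel_measurable_def
    by (intro borel_measurable_continuous_on_indicator f) auto
  from holomorphic_change_of_variables(2)[OF open_ball _ _ this] show ?thesis
    by (simp add: img inj_on_def holomorphic_intros)
qed

text \<open>
  Integrate the power series term by term: only the constant term survives.
\<close>

theorem mean_value_disc:
  fixes f :: "complex \<Rightarrow> complex"
  assumes f: "f holomorphic_on ball w R" and r: "0 < r" "r < R"
  shows "(LINT z:ball w r|lborel. f z) = measure lborel (ball 0 r :: complex set) * f w"
proof -
  define a where "a = (\<lambda>n. (deriv ^^ n) f w / fact n)"
  have sums: "(\<lambda>n. a n * z ^ n) sums f (w + z)" if "z \<in> ball 0 R" for z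
    using holomorphic_power_series[OF f, of "w + z"] that by (simp add: a_def dist_norm)
  obtain s where s: "r < s" "s < R"
    using r dense by blast
  have summ: "summable (\<lambda>n. norm (a n * of_real r ^ n))"
    by (rule powser_insidea[of _ "of_real s"]) (use sums[of "of_real s"] s r in \<open>auto simp: sums_iff\<close>)
  define F where "F = (\<lambda>n z. indicat_real (ball 0 r) z *\<^sub>R (a n * z ^ n))"
  have F_le: "norm (F n z) \<le> indicat_real (ball 0 r) z * norm (a n * of_real r ^ n)" for n z
    using r by (auto simp: F_def indicator_def norm_mult norm_power intro!: mult_left_mono power_mono)
  have int_ball: "integrable lborel (\<lambda>z::complex. indicat_real (ball 0 r) z * c)" for c
    by (intro integrable_mult_left) (auto intro!: integrable_real_indicator emeasure_lborel_ball_finite)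
  have F_int: "integrable lborel (F n)" for n
  proof (rule Bochner_Integration.integrable_bound[OF int_ball])
    show "F n \<in> borel_measurable lborel"
      unfolding F_def by (auto intro!: borel_measurable_continuous_on_indicator continuous_intros)
    show "AE z in lborel. norm (F n z) \<le> norm (indicat_real (ball 0 r) z * norm (a n * of_real r ^ n))"
      using F_le by (auto simp: abs_mult)
  qed
  have "(\<lambda>n. integral\<^sup>L lborel (F n)) sums (\<integral>z. (\<Sum>n. F n z) \<partial>lborel)"
  proof (rule sums_integral[OF F_int])
    show "AE z in lborel. summable (\<lambda>n. norm (F n z))"
    proof (rule AE_I2)
      fix z
      show "summable (\<lambda>n. norm (F n z))"
        by (rule summable_comparison_test'[OF summable_mult[OF summ]]) (use F_le[of _ z] in auto)
    qed
    have le: "(\<integral>z. norm (F n z) \<partial>lborel) \<le> measure lborel (ball 0 r :: complex set) * norm (a n * of_real r ^ n)" for n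
    proof -
      have "(\<integral>z. norm (F n z) \<partial>lborel) \<le> (\<integral>z. indicat_real (ball 0 r :: complex set) z * norm (a n * of_real r ^ n) \<partial>lborel)"
        by (intro integral_mono F_le integrable_norm F_int int_ball)
      thus ?thesis by simp
    qed
    show "summable (\<lambda>n. \<integral>z. norm (F n z) \<partial>lborel)"
      by (rule summable_comparison_test'[OF summable_mult[OF summ]]) (use le in auto)
  qed
  also have "(\<integral>z. (\<Sum>n. F n z) \<partial>lborel) = (LINT z:ball 0 r|lborel. f (w + z))"
    unfolding set_lebesgue_integral_def
  proof (rule Bochner_Integration.integral_cong[OF refl])
    fix z
    show "(\<Sum>n. F n z) = indicat_real (ball 0 r) z *\<^sub>R f (w + z)"
      using sums[of z] r by (auto simp: F_def indicator_def sums_iff)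
  qed
  also have "\<dots> = (LINT z:ball w r|lborel. f z)"
    by (rule set_integral_ball_translate[symmetric])
       (use f r in \<open>auto intro!: holomorphic_on_imp_continuous_on elim: holomorphic_on_subset\<close>)
  finally have lim: "(\<lambda>n. integral\<^sup>L lborel (F n)) sums (LINT z:ball w r|lborel. f z)" .
  have "integral\<^sup>L lborel (F n) = a n * (LINT z:ball 0 r|lborel. z ^ n)" for n
    unfolding F_def set_lebesgue_integral_def
    by (subst integral_mult_right_zero[symmetric]) (simp add: mult_ac)
  hence "integral\<^sup>L lborel (F n) = (if n = 0 then a 0 * measure lborel (ball 0 r :: complex set) else 0)" for n
    using set_integral_ball_power_eq_0[of n r]
    by (cases "n = 0") (auto simp: set_lebesgue_integral_def scaleR_conv_of_real)
  with sums_unique2[OF lim, of "a 0 * measure lborel (ball 0 r :: complex set)"]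
       sums_single[of 0 "\<lambda>_. a 0 * measure lborel (ball 0 r :: complex set)"]
  show ?thesis
    by (simp add: a_def mult.commute)
qed

text \<open>
  The mean value property applied to \<open>f\<^sup>2\<close>.
\<close>

theorem norm_square_le_set_integral:
  fixes f :: "complex \<Rightarrow> complex"
  assumes f: "f holomorphic_on ball w R" and r: "0 < r" "r < R"
  shows "measure lborel (ball 0 r :: complex set) * (cmod (f w))\<^sup>2 \<le> (LINT z:ball w r|lborel. (cmod (f z))\<^sup>2)"
proof -
  have "(LINT z:ball w r|lborel. (f z)\<^sup>2) = measure lborel (ball 0 r :: complex set) * (f w)\<^sup>2"
    using f r by (intro mean_value_disc[of _ w R]) (auto intro!: holomorphic_intros)
  hence "measure lborel (ball 0 r :: complex set) * (cmod (f w))\<^sup>2 = cmod (LINT z:ball w r|lborel. (f z)\<^sup>2)"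
    by (simp add: norm_mult norm_power)
  also have "\<dots> \<le> (LINT z:ball w r|lborel. (cmod (f z))\<^sup>2)"
    unfolding set_lebesgue_integral_def
    by (rule order.trans[OF integral_norm_bound]) (simp add: norm_power)
  finally show ?thesis .
qed

section \<open>Automorphisms of the disc and Blaschke factors\<close>

text \<open>
  The holomorphic involution of the disc that exchanges \<open>0\<close> and \<open>a\<close>.
\<close>

definition disc_aut :: "complex \<Rightarrow> complex \<Rightarrow> complex" where
  "disc_aut a z = (a - z) / (1 - cnj a * z)"

lemma one_minus_cnj_mult_nonzero:
  assumes "cmod a < 1" "cmod z \<le> 1"
  shows "1 - cnj a * z \<noteq> 0"
proof
  assume "1 - cnj a * z = 0"
  hence "cmod (cnj a * z) = 1" by simp
  moreover have "cmod (cnj a * z) \<le> cmod a * 1"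
    unfolding norm_mult complex_mod_cnj using assms by (intro mult_left_mono) auto
  ultimately show False using assms by simp
qed

lemma one_minus_norm_disc_aut_square:
  assumes "cmod a < 1" "cmod z \<le> 1"
  shows "1 - (cmod (disc_aut a z))\<^sup>2 = (1 - (cmod a)\<^sup>2) * (1 - (cmod z)\<^sup>2) / (cmod (1 - cnj a * z))\<^sup>2"
proof -
  have nz: "cmod (1 - cnj a * z) \<noteq> 0"
    using one_minus_cnj_mult_nonzero[OF assms] by simp
  have "(cmod (1 - cnj a * z))\<^sup>2 - (cmod (a - z))\<^sup>2 = (1 - (cmod a)\<^sup>2) * (1 - (cmod z)\<^sup>2)"
    by (simp add: cmod_power2) (simp add: power2_eq_square algebra_simps)
  thus ?thesis
    using nz by (simp add: disc_aut_def norm_divide power_divide field_simps)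
qed

lemma norm_disc_aut_less_1:
  assumes "cmod a < 1" "cmod z < 1"
  shows "cmod (disc_aut a z) < 1"
proof -
  have "1 - (cmod (disc_aut a z))\<^sup>2 > 0"
    using assms one_minus_cnj_mult_nonzero[of a z]
    by (subst one_minus_norm_disc_aut_square)
       (auto intro!: divide_pos_pos mult_pos_pos simp: power_less_one_iff abs_square_less_1)
  thus ?thesis
    by (simp add: abs_square_less_1)
qed

lemma disc_aut_involution:
  assumes "cmod a < 1" "cmod z < 1"
  shows "disc_aut a (disc_aut a z) = z"
proof -
  have 1: "1 - cnj a * z \<noteq> 0" "1 - cnj a * a \<noteq> 0"
    using one_minus_cnj_mult_nonzero[of a z] one_minus_cnj_mult_nonzero[of a a] assms by auto
  have "a - disc_aut a z = z * (1 - cnj a * a) / (1 - cnj a * z)"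
    using 1 by (simp add: disc_aut_def field_simps)
  moreover have "1 - cnj a * disc_aut a z = (1 - cnj a * a) / (1 - cnj a * z)"
    using 1 by (simp add: disc_aut_def field_simps)
  ultimately have "disc_aut a (disc_aut a z) = (z * (1 - cnj a * a) / (1 - cnj a * z)) / ((1 - cnj a * a) / (1 - cnj a * z))"
    by (simp add: disc_aut_def[of a "disc_aut a z"])
  thus ?thesis using 1 by simp
qed

lemma disc_aut_0 [simp]: "disc_aut a 0 = a" "disc_aut a a = 0" "disc_aut 0 z = -z"
  by (simp_all add: disc_aut_def)

lemma disc_aut_holomorphic: "cmod a < 1 \<Longrightarrow> disc_aut a holomorphic_on ball 0 1"
  unfolding disc_aut_def using one_minus_cnj_mult_nonzero
  by (intro holomorphic_intros) (auto simp: less_imp_le)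

lemma disc_aut_inj: "cmod a < 1 \<Longrightarrow> inj_on (disc_aut a) (ball 0 1)"
  by (metis disc_aut_involution inj_onI mem_ball_0)

lemma disc_aut_has_field_derivative:
  assumes "cmod a < 1" "cmod z < 1"
  shows "(disc_aut a has_field_derivative -(1 - of_real ((cmod a)\<^sup>2)) / (1 - cnj a * z)\<^sup>2) (at z)"
proof -
  have nz: "1 - cnj a * z \<noteq> 0"
    using one_minus_cnj_mult_nonzero[of a z] assms by auto
  have "(disc_aut a has_field_derivative ((0 - 1) * (1 - cnj a * z) - (a - z) * (0 - cnj a * 1)) / ((1 - cnj a * z) * (1 - cnj a * z))) (at z)"
    unfolding disc_aut_def[abs_def] using nz by (auto intro!: derivative_eq_intros)
  also have "((0 - 1) * (1 - cnj a * z) - (a - z) * (0 - cnj a * 1)) = -(1 - of_real ((cmod a)\<^sup>2))"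
    using complex_norm_square[of a] by (simp add: algebra_simps)
  finally show ?thesis
    by (simp add: power2_eq_square)
qed

text \<open>
  Automorphisms are isometries of the hyperbolic metric; this is how derivatives of \<open>B\<close> are
  compared with those of \<open>B\<close> read in a chart centred at an arbitrary point.
\<close>

lemma norm_deriv_disc_aut:
  assumes "cmod a < 1" "cmod z < 1"
  shows "cmod (deriv (disc_aut a) z) * (1 - (cmod z)\<^sup>2) = 1 - (cmod (disc_aut a z))\<^sup>2"
proof -
  have "cmod (1 - of_real ((cmod a)\<^sup>2)) = 1 - (cmod a)\<^sup>2"
    using assms(1) by (metis abs_of_nonneg abs_square_le_1 diff_ge_0_iff_ge less_imp_le abs_norm_cancel norm_of_real of_real_1 of_real_diff)
  hence "cmod (deriv (disc_aut a) z) = (1 - (cmod a)\<^sup>2) / (cmod (1 - cnj a * z))\<^sup>2"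
    unfolding DERIV_imp_deriv[OF disc_aut_has_field_derivative[OF assms]]
    by (simp only: norm_divide norm_minus_cancel norm_power)
  thus ?thesis
    using assms by (simp add: one_minus_norm_disc_aut_square)
qed

lemma norm_blaschke_factor: "cmod (blaschke_factor a z) = cmod (disc_aut a z)"
  by (simp add: blaschke_factor_def disc_aut_def norm_mult norm_divide)

lemma pseudohyp_dist_eq: "pseudohyp_dist a z = cmod (blaschke_factor a z)"
proof -
  have "cmod (1 - cnj z * a) = cmod (cnj (1 - cnj z * a))"
    by (simp only: complex_mod_cnj)
  also have "cnj (1 - cnj z * a) = 1 - cnj a * z"
    by (simp add: mult.commute)
  finally show ?thesis
    by (simp add: pseudohyp_dist_def norm_blaschke_factor disc_aut_def norm_divide norm_minus_commute)
qed

lemma blaschke_factor_holomorphic: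
  assumes "cmod a < 1"
  shows "blaschke_factor a holomorphic_on ball 0 1"
proof (cases "a = 0")
  case False
  have "blaschke_factor a = (\<lambda>z. complex_of_real (cmod a) / a * disc_aut a z)"
    using False by (auto simp: blaschke_factor_def disc_aut_def)
  thus ?thesis
    using disc_aut_holomorphic[OF assms] by (auto intro!: holomorphic_intros)
qed (simp add: blaschke_factor_def[abs_def] holomorphic_intros)

lemma norm_blaschke_factor_less_1: "cmod a < 1 \<Longrightarrow> cmod z < 1 \<Longrightarrow> cmod (blaschke_factor a z) < 1"
  by (simp add: norm_blaschke_factor norm_disc_aut_less_1)

text \<open>
  The bound is summable along a Blaschke sequence, locally uniformly in \<open>z\<close>; it also covers the
  convention \<open>blaschke_factor 0 z = z\<close>.
\<close>

lemma blaschke_factor_near_1: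
  assumes a: "cmod a < 1" and z: "cmod z \<le> R" and R: "R < 1"
  shows "cmod (blaschke_factor a z - 1) \<le> (1 - cmod a) * (2 / (1 - R))"
proof (cases "a = 0")
  case True
  have "cmod (z - 1) \<le> cmod z + 1" using norm_triangle_ineq4[of z 1] by simp
  also have "\<dots> \<le> 2" using z R by simp
  also have "\<dots> \<le> 2 / (1 - R)"
    using R z order.trans[OF norm_ge_zero z] by (simp add: field_simps)
  finally show ?thesis using True by (simp add: blaschke_factor_def)
next
  case False
  have nz: "1 - cnj a * z \<noteq> 0"
    using one_minus_cnj_mult_nonzero[of a z] a z R by auto
  have "blaschke_factor a z - 1 = - ((1 - of_real (cmod a)) * (a + of_real (cmod a) * z) / (a * (1 - cnj a * z)))"
  proof -
    have "a * cnj a = of_real (cmod a) * of_real (cmod a)"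
      using complex_norm_square[of a] by (simp add: power2_eq_square)
    hence "of_real (cmod a) * (a - z) - a * (1 - cnj a * z) = - ((1 - of_real (cmod a)) * (a + of_real (cmod a) * z))"
      by (simp add: algebra_simps)
    moreover have "blaschke_factor a z - 1 = (of_real (cmod a) * (a - z) - a * (1 - cnj a * z)) / (a * (1 - cnj a * z))"
      using False nz by (simp add: blaschke_factor_def field_simps)
    ultimately show ?thesis by simp
  qed
  hence "cmod (blaschke_factor a z - 1) = cmod (1 - of_real (cmod a)) * cmod (a + of_real (cmod a) * z) / (cmod a * cmod (1 - cnj a * z))"
    by (simp add: norm_mult norm_divide)
  also have "cmod (1 - of_real (cmod a)) = 1 - cmod a"
    using a by (metis abs_of_nonneg diff_ge_0_iff_ge less_imp_le norm_of_real of_real_1 of_real_diff)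
  also have "(1 - cmod a) * cmod (a + of_real (cmod a) * z) / (cmod a * cmod (1 - cnj a * z)) \<le> (1 - cmod a) * (cmod a * 2) / (cmod a * (1 - R))"
  proof (intro frac_le mult_left_mono mult_nonneg_nonneg mult_pos_pos)
    have "cmod (a + of_real (cmod a) * z) \<le> cmod a + cmod a * cmod z"
      using norm_triangle_ineq[of a "of_real (cmod a) * z"] by (simp add: norm_mult)
    also have "\<dots> \<le> cmod a * 2"
      using z R mult_left_mono[of "cmod z" 1 "cmod a"] by simp
    finally show "cmod (a + of_real (cmod a) * z) \<le> cmod a * 2" .
    have "1 - cmod (cnj a * z) \<le> cmod (1 - cnj a * z)"
      using norm_triangle_ineq2[of 1 "cnj a * z"] by simp
    moreover have "cmod (cnj a * z) \<le> 1 * R"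
      unfolding norm_mult complex_mod_cnj using a z by (intro mult_mono) auto
    ultimately show "1 - R \<le> cmod (1 - cnj a * z)" by simp
  qed (use a False R in auto)
  also have "\<dots> = (1 - cmod a) * (2 / (1 - R))"
    using False by simp
  finally show ?thesis .
qed

text \<open>
  The partial products converge locally uniformly by the usual comparison of a product of
  factors \<open>1 + t\<^sub>n\<close> with the sum of the \<open>\<bar>t\<^sub>n\<bar>\<close>.
\<close>

lemma bounded_factors_product:
  fixes u :: "nat \<Rightarrow> complex \<Rightarrow> complex"
  assumes hol: "\<And>n. u n holomorphic_on ball 0 1"
    and le1: "\<And>n z. z \<in> ball 0 1 \<Longrightarrow> cmod (u n z) \<le> 1"
    and M: "\<And>R. 0 < R \<Longrightarrow> R < 1 \<Longrightarrow> \<exists>M. summable M \<and> (\<forall>n. \<forall>z\<in>cball 0 R. cmod (u n z - 1) \<le> M n)"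
  shows "(\<lambda>z. \<Prod>n. u n z) holomorphic_on ball 0 1"
    and "z \<in> ball 0 1 \<Longrightarrow> (\<lambda>N. \<Prod>n<N. u n z) \<longlonglongrightarrow> (\<Prod>n. u n z)"
    and "z \<in> ball 0 1 \<Longrightarrow> cmod (\<Prod>n. u n z) \<le> 1"
    and "z \<in> ball 0 1 \<Longrightarrow> convergent_prod (\<lambda>n. u n z)"
proof -
  show conv: "convergent_prod (\<lambda>n. u n z)" if "z \<in> ball 0 1" for z
  proof -
    define R where "R = (1 + cmod z) / 2"
    have R: "0 < R" "R < 1" "z \<in> cball 0 R"
      using that by (auto simp: R_def add_pos_nonneg)
    obtain M where "summable M" "\<And>n. cmod (u n z - 1) \<le> M n"
      using M[OF R(1,2)] R(3) by blast
    hence "summable (\<lambda>n. norm (u n z - 1))"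
      by (auto intro: summable_comparison_test'[of M 0])
    thus ?thesis
      by (rule abs_convergent_prod_imp_convergent_prod[OF summable_imp_abs_convergent_prod])
  qed
  show lim: "(\<lambda>N. \<Prod>n<N. u n z) \<longlonglongrightarrow> (\<Prod>n. u n z)" if "z \<in> ball 0 1" for z
    using convergent_prod_LIMSEQ[OF conv[OF that]]
    by (subst filterlim_sequentially_Suc[symmetric]) (simp add: lessThan_Suc_atMost)
  have norm_le: "cmod (\<Prod>n<N. u n z) \<le> 1" if "z \<in> ball 0 1" for N z
    unfolding prod_norm[symmetric] by (intro prod_le_1) (use le1[OF that] in auto)
  show "cmod (\<Prod>n. u n z) \<le> 1" if "z \<in> ball 0 1" for z
    by (rule tendsto_le[OF _ tendsto_const tendsto_norm[OF lim[OF that]]]) (use norm_le[OF that] in auto)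
  show "(\<lambda>z. \<Prod>n. u n z) holomorphic_on ball 0 1"
  proof (rule holomorphic_uniform_sequence[of _ "\<lambda>N z. \<Prod>n<N. u n z"])
    show "(\<lambda>z. \<Prod>n<N. u n z) holomorphic_on ball 0 1" for N
      by (intro holomorphic_on_prod hol)
    fix x :: complex assume x: "x \<in> ball 0 1"
    define R where "R = (1 + cmod x) / 2"
    have R: "0 < R" "R < 1" "cmod x < R"
      using x by (auto simp: R_def add_pos_nonneg)
    have sub: "cball x (R - cmod x) \<subseteq> cball 0 R"
    proof
      fix y assume "y \<in> cball x (R - cmod x)"
      thus "y \<in> cball 0 R"
        using norm_triangle_sub[of y x] by (simp add: dist_norm norm_minus_commute)
    qed
    obtain M' where M': "summable M'" "\<And>n z. z \<in> cball 0 R \<Longrightarrow> cmod (u n z - 1) \<le> M' n"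
      using M[OF R(1,2)] by blast
    have sub1: "cball 0 R \<subseteq> ball (0::complex) 1"
      using R by auto
    have unif: "uniformly_convergent_on (cball 0 R) (\<lambda>N z. \<Prod>n<N. 1 + (u n z - 1))"
    proof (rule uniformly_convergent_on_prod)
      show "continuous_on (cball 0 R) (\<lambda>z. u n z - 1)" for n
        by (intro continuous_intros holomorphic_on_imp_continuous_on holomorphic_on_subset[OF hol sub1])
      show "uniformly_convergent_on (cball 0 R) (\<lambda>N z. \<Sum>n<N. cmod (u n z - 1))"
        by (rule Weierstrass_m_test'[OF _ M'(1)]) (use M'(2) in auto)
    qed auto
    then obtain l where l: "uniform_limit (cball 0 R) (\<lambda>N z. \<Prod>n<N. 1 + (u n z - 1)) l sequentially"
      by (auto simp: uniformly_convergent_on_def)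
    have "l z = (\<Prod>n. u n z)" if "z \<in> cball 0 R" for z
    proof -
      have "z \<in> ball 0 1" using that sub1 by blast
      from LIMSEQ_unique[OF _ lim[OF this]] show ?thesis
        using tendsto_uniform_limitI[OF l that] by simp
    qed
    hence "uniform_limit (cball 0 R) (\<lambda>N z. \<Prod>n<N. u n z) (\<lambda>z. \<Prod>n. u n z) sequentially"
      using l by (subst uniform_limit_cong'[where g = "\<lambda>N z. \<Prod>n<N. 1 + (u n z - 1)" and i = l]) auto
    hence "uniform_limit (cball x (R - cmod x)) (\<lambda>N z. \<Prod>n<N. u n z) (\<lambda>z. \<Prod>n. u n z) sequentially"
      using sub by (rule uniform_limit_on_subset)
    moreover have "cball x (R - cmod x) \<subseteq> ball 0 1"
      using sub sub1 by blast
    ultimately show "\<exists>d>0. cball x d \<subseteq> ball 0 1 \<and> uniform_limit (cball x d) (\<lambda>N z. \<Prod>n<N. u n z) (\<lambda>z. \<Prod>n. u n z) sequentially"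
      using R(3) by (intro exI[of _ "R - cmod x"]) auto
  qed auto
qed

section \<open>Blaschke products and the rigidity of the Schwarz lemma\<close>

text \<open>
  The product over the zeros with index in \<open>J\<close>. Keeping a factor 1 for the other indices leaves
  all products indexed by \<open>nat\<close>.
\<close>

lemma blaschke_subproduct:
  fixes a :: "nat \<Rightarrow> complex" and J :: "nat set"
  assumes a: "\<And>n. a n \<in> ball 0 1" and summ: "summable (\<lambda>n. 1 - cmod (a n))"
  defines "u \<equiv> (\<lambda>n z. if n \<in> J then blaschke_factor (a n) z else 1)"
  shows "(\<lambda>z. \<Prod>n. u n z) holomorphic_on ball 0 1"
    and "z \<in> ball 0 1 \<Longrightarrow> (\<lambda>N. \<Prod>n<N. u n z) \<longlonglongrightarrow> (\<Prod>n. u n z)"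
    and "z \<in> ball 0 1 \<Longrightarrow> cmod (\<Prod>n. u n z) \<le> 1"
    and "z \<in> ball 0 1 \<Longrightarrow> convergent_prod (\<lambda>n. u n z)"
proof -
  have a': "cmod (a n) < 1" for n
    using a by simp
  have 1: "u n holomorphic_on ball 0 1" for n
    using blaschke_factor_holomorphic[OF a'[of n]] by (cases "n \<in> J") (auto simp: u_def)
  have 2: "cmod (u n z) \<le> 1" if "z \<in> ball 0 1" for n z
    using norm_blaschke_factor_less_1[OF a'[of n], of z] that by (auto simp: u_def)
  have 3: "\<exists>M. summable M \<and> (\<forall>n. \<forall>z\<in>cball 0 R. cmod (u n z - 1) \<le> M n)" if "0 < R" "R < 1" for R
  proof (intro exI conjI allI ballI)
    show "summable (\<lambda>n. (1 - cmod (a n)) * (2 / (1 - R)))"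
      by (intro summable_mult2 summ)
    show "cmod (u n z - 1) \<le> (1 - cmod (a n)) * (2 / (1 - R))" if "z \<in> cball 0 R" for n z
      using blaschke_factor_near_1[OF a'[of n], of z R] that \<open>R < 1\<close> a'[of n] by (auto simp: u_def)
  qed
  note facts = bounded_factors_product[of u, OF 1 2 3]
  show "(\<lambda>z. \<Prod>n. u n z) holomorphic_on ball 0 1"
    "z \<in> ball 0 1 \<Longrightarrow> (\<lambda>N. \<Prod>n<N. u n z) \<longlonglongrightarrow> (\<Prod>n. u n z)"
    "z \<in> ball 0 1 \<Longrightarrow> cmod (\<Prod>n. u n z) \<le> 1"
    "z \<in> ball 0 1 \<Longrightarrow> convergent_prod (\<lambda>n. u n z)"
    using facts by blast+
qed

definition blaschke_cofactor :: "(nat \<Rightarrow> complex) \<Rightarrow> nat \<Rightarrow> complex \<Rightarrow> complex" where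
  "blaschke_cofactor a k z = (\<Prod>n. if n \<in> - {k} then blaschke_factor (a n) z else 1)"

lemma blaschke_cofactor_bounded_holomorphic:
  assumes "\<And>n. a n \<in> ball 0 1" "summable (\<lambda>n. 1 - cmod (a n))"
  shows "blaschke_cofactor a k holomorphic_on ball 0 1"
    and "z \<in> ball 0 1 \<Longrightarrow> cmod (blaschke_cofactor a k z) \<le> 1"
  using blaschke_subproduct(1,3)[OF assms, where J = "- {k}"] by (simp_all add: blaschke_cofactor_def[abs_def])

lemma blaschke_product_split_factor:
  assumes "\<And>n. a n \<in> ball 0 1" "summable (\<lambda>n. 1 - cmod (a n))" "z \<in> ball 0 1"
  shows "(\<Prod>n. blaschke_factor (a n) z) = blaschke_factor (a k) z * blaschke_cofactor a k z"
proof (rule LIMSEQ_unique)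
  show "(\<lambda>N. \<Prod>n<N. blaschke_factor (a n) z) \<longlonglongrightarrow> (\<Prod>n. blaschke_factor (a n) z)"
    using blaschke_subproduct(2)[OF assms(1,2), where J = UNIV, OF assms(3)] by simp
  have "(\<lambda>N. blaschke_factor (a k) z * (\<Prod>n<N. if n \<in> - {k} then blaschke_factor (a n) z else 1))
          \<longlonglongrightarrow> blaschke_factor (a k) z * blaschke_cofactor a k z"
    unfolding blaschke_cofactor_def
    by (intro tendsto_intros blaschke_subproduct(2)[OF assms(1,2), OF assms(3)])
  moreover have "eventually (\<lambda>N. blaschke_factor (a k) z * (\<Prod>n<N. if n \<in> - {k} then blaschke_factor (a n) z else 1)
                   = (\<Prod>n<N. blaschke_factor (a n) z)) sequentially"
    using eventually_gt_at_top[of k]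
  proof eventually_elim
    case (elim N)
    have "(\<Prod>n\<in>{..<N} - {k}. if n \<in> - {k} then blaschke_factor (a n) z else 1) = (\<Prod>n\<in>{..<N} - {k}. blaschke_factor (a n) z)"
      by (intro prod.cong) auto
    thus ?case
      using elim by (simp add: prod.remove[of "{..<N}" k])
  qed
  ultimately show "(\<lambda>N. \<Prod>n<N. blaschke_factor (a n) z) \<longlonglongrightarrow> blaschke_factor (a k) z * blaschke_cofactor a k z"
    by (rule Lim_transform_eventually)
qed

text \<open>
  The quantity whose convergence to 1 defines thinness.
\<close>

lemma norm_blaschke_cofactor:
  assumes "\<And>n. a n \<in> ball 0 1" "summable (\<lambda>n. 1 - cmod (a n))"
  shows "cmod (blaschke_cofactor a k (a k)) = (\<Prod>j. if j = k then 1 else pseudohyp_dist (a j) (a k))"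
proof -
  have "(\<lambda>n. if n \<in> - {k} then blaschke_factor (a n) (a k) else 1) has_prod blaschke_cofactor a k (a k)"
    unfolding blaschke_cofactor_def
    by (intro convergent_prod_has_prod blaschke_subproduct(4) assms)
  hence "(\<lambda>n. cmod (if n \<in> - {k} then blaschke_factor (a n) (a k) else 1)) has_prod cmod (blaschke_cofactor a k (a k))"
    by (rule has_prod_norm)
  also have "(\<lambda>n. cmod (if n \<in> - {k} then blaschke_factor (a n) (a k) else 1)) = (\<lambda>j. if j = k then 1 else pseudohyp_dist (a j) (a k))"
    by (auto simp: pseudohyp_dist_eq)
  finally show ?thesis
    by (rule has_prod_unique)
qed

text \<open>
  Dropping factors of modulus at most 1 increases a product, so the thinness constants bound
  those of all finite subproducts.
\<close>

lemma norm_blaschke_cofactor_le_prod: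
  assumes a: "\<And>n. a n \<in> ball 0 1" and summ: "summable (\<lambda>n. 1 - cmod (a n))"
    and J: "finite J" "k \<notin> J" and z: "z \<in> ball 0 1"
  shows "cmod (blaschke_cofactor a k z) \<le> (\<Prod>j\<in>J. cmod (blaschke_factor (a j) z))"
proof -
  have lim: "(\<lambda>N. \<Prod>n<N. cmod (if n \<in> - {k} then blaschke_factor (a n) z else 1)) \<longlonglongrightarrow> cmod (blaschke_cofactor a k z)"
    unfolding blaschke_cofactor_def prod_norm
    by (intro tendsto_norm blaschke_subproduct(2) assms)
  have le1: "cmod (blaschke_factor (a n) z) \<le> 1" for n
    using norm_blaschke_factor_less_1[of "a n" z] a[of n] z by simp
  obtain N0 where N0: "J \<subseteq> {..<N0}"
    using finite_nat_bounded[OF J(1)] by blast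
  have "eventually (\<lambda>N. (\<Prod>n<N. cmod (if n \<in> - {k} then blaschke_factor (a n) z else 1)) \<le> (\<Prod>j\<in>J. cmod (blaschke_factor (a j) z))) sequentially"
    using eventually_ge_at_top[of N0]
  proof eventually_elim
    case (elim N)
    have sub: "J \<subseteq> {..<N}" using N0 elim by auto
    have "(\<Prod>n<N. cmod (if n \<in> - {k} then blaschke_factor (a n) z else 1)) =
        (\<Prod>n\<in>{..<N} - J. cmod (if n \<in> - {k} then blaschke_factor (a n) z else 1)) *
        (\<Prod>n\<in>J. cmod (if n \<in> - {k} then blaschke_factor (a n) z else 1))"
      by (rule prod.subset_diff[OF sub]) simp
    also have "\<dots> \<le> 1 * (\<Prod>n\<in>J. cmod (if n \<in> - {k} then blaschke_factor (a n) z else 1))"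
      by (intro mult_right_mono prod_le_1 prod_nonneg) (use le1 in auto)
    also have "\<dots> = (\<Prod>j\<in>J. cmod (blaschke_factor (a j) z))"
      using J by (auto intro!: prod.cong)
    finally show ?case .
  qed
  thus ?thesis
    by (rule tendsto_upperbound[OF lim]) simp
qed

text \<open>
  The Schwarz lemma for the composition of \<open>g\<close> with the automorphism that moves \<open>g 0\<close> to \<open>0\<close>: a
  function bounded by 1 with \<open>\<bar>g 0\<bar>\<close> close to 1 is nearly constant on compact sets.
\<close>

lemma schwarz_deviation:
  assumes g: "g holomorphic_on ball 0 1" and le1: "\<And>z. z \<in> ball 0 1 \<Longrightarrow> cmod (g z) \<le> 1"
    and z: "cmod z < 1"
  shows "cmod (g z - g 0) \<le> (1 - (cmod (g 0))\<^sup>2) * cmod z / (1 - cmod z)"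
proof (cases "\<forall>w\<in>ball 0 1. cmod (g w) < 1")
  case False
  then obtain w where w: "w \<in> ball 0 1" "cmod (g w) = 1"
    using le1 by force
  have "g constant_on ball 0 1"
    by (rule maximum_modulus_principle[OF g _ _ _ _ w(1)]) (use le1 w in auto)
  hence "g z = g 0"
    using z by (auto simp: constant_on_def)
  moreover have "(cmod (g 0))\<^sup>2 \<le> 1"
    using le1[of 0] by (simp add: power_le_one)
  ultimately show ?thesis
    using z by simp
next
  case True
  have g0: "cmod (g 0) < 1" using True by simp
  have gim: "g ` ball 0 1 \<subseteq> ball 0 1" using True by auto
  define \<psi> where "\<psi> = (\<lambda>w. disc_aut (g 0) (g w))"
  have "\<psi> = disc_aut (g 0) \<circ> g" by (simp add: \<psi>_def fun_eq_iff)
  hence "\<psi> holomorphic_on ball 0 1"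
    using holomorphic_on_compose_gen[OF g disc_aut_holomorphic[OF g0]] gim by simp
  hence \<psi>: "cmod (\<psi> z) \<le> cmod z"
    by (rule Schwarz_Lemma(1)) (use True g0 z norm_disc_aut_less_1 in \<open>auto simp: \<psi>_def\<close>)
  have nz: "1 - cnj (g 0) * g z \<noteq> 0"
    using one_minus_cnj_mult_nonzero[OF g0, of "g z"] True z by (simp add: less_imp_le)
  define x where "x = cmod (g z - g 0)"
  have "1 - cnj (g 0) * g z = of_real (1 - (cmod (g 0))\<^sup>2) + cnj (g 0) * (g 0 - g z)"
    using complex_norm_square[of "g 0"] by (simp add: algebra_simps)
  hence "cmod (1 - cnj (g 0) * g z) \<le> cmod (of_real (1 - (cmod (g 0))\<^sup>2)) + cmod (cnj (g 0) * (g 0 - g z))"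
    using norm_triangle_ineq by metis
  also have "cmod (of_real (1 - (cmod (g 0))\<^sup>2)) = 1 - (cmod (g 0))\<^sup>2"
    unfolding norm_of_real using g0 by (simp add: abs_square_le_1)
  also have "cmod (cnj (g 0) * (g 0 - g z)) \<le> x"
    using g0 mult_right_mono[of "cmod (g 0)" 1 x] by (simp add: norm_mult x_def norm_minus_commute)
  finally have le: "cmod (1 - cnj (g 0) * g z) \<le> (1 - (cmod (g 0))\<^sup>2) + x" by simp
  have "x = cmod (\<psi> z) * cmod (1 - cnj (g 0) * g z)"
    using nz by (simp add: \<psi>_def disc_aut_def norm_divide x_def norm_minus_commute)
  also have "\<dots> \<le> cmod z * ((1 - (cmod (g 0))\<^sup>2) + x)"
    using \<psi> le by (intro mult_mono) auto
  finally have "x * (1 - cmod z) \<le> (1 - (cmod (g 0))\<^sup>2) * cmod z"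
    by (simp add: algebra_simps)
  thus ?thesis
    using z by (simp add: x_def field_simps)
qed

text \<open>
  If \<open>\<bar>g 0\<bar>\<close> is close to 1 then \<open>z * g z\<close> is close to the rotation \<open>g 0 * z\<close>; by the Cauchy
  estimate on a disc of radius \<open>t - s\<close> their derivatives are close too. The function \<open>z * g z\<close>
  stands for a Blaschke product read in a chart centred at a zero, up to a unimodular constant,
  with \<open>g\<close> the product of the other factors.
\<close>

lemma nearly_rotation_lower_bounds:
  assumes g: "g holomorphic_on ball 0 1" and le1: "\<And>z. z \<in> ball 0 1 \<Longrightarrow> cmod (g z) \<le> 1"
    and \<delta>: "0 \<le> \<delta>" "\<delta> \<le> cmod (g 0)" and s: "0 < s" "s < t" "t < 1" and z: "cmod z \<le> s"
  defines "\<eta> \<equiv> (1 - \<delta>\<^sup>2) * (t / (1 - t))"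
  shows "\<delta> - \<eta> \<le> cmod (g z)"
    and "\<delta> - \<eta> / (t - s) \<le> cmod (deriv (\<lambda>z. z * g z) z)"
proof -
  have dev: "cmod (g w - g 0) \<le> \<eta>" if w: "cmod w \<le> t" for w
  proof -
    have "cmod (g w - g 0) \<le> (1 - (cmod (g 0))\<^sup>2) * cmod w / (1 - cmod w)"
      using w s by (intro schwarz_deviation g le1) auto
    also have "\<dots> = (1 - (cmod (g 0))\<^sup>2) * (cmod w / (1 - cmod w))" by simp
    also have "\<dots> \<le> \<eta>"
      unfolding \<eta>_def
    proof (intro mult_mono frac_le)
      show "1 - (cmod (g 0))\<^sup>2 \<le> 1 - \<delta>\<^sup>2" using \<delta> by (simp add: power_mono)
      have "\<delta>\<^sup>2 \<le> 1" using \<delta> le1[of 0] by (intro power_le_one) auto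
      thus "0 \<le> 1 - \<delta>\<^sup>2" by simp
    qed (use w s in auto)
    finally show ?thesis .
  qed
  have "cmod (g 0) \<le> cmod (g z) + \<eta>"
    using norm_triangle_ineq4[of "g z" "g z - g 0"] dev[of z] z s by simp
  thus "\<delta> - \<eta> \<le> cmod (g z)" using \<delta> by simp
  \<comment> \<open>The deviation from the rotation.\<close>
  define F where "F = (\<lambda>w. w * g w - g 0 * w)"
  have F: "F holomorphic_on ball 0 1"
    unfolding F_def by (intro holomorphic_intros g)
  have sub: "cball z (t - s) \<subseteq> cball 0 t"
  proof
    fix y assume "y \<in> cball z (t - s)"
    thus "y \<in> cball 0 t"
      using norm_triangle_sub[of y z] z by (simp add: dist_norm norm_minus_commute)
  qed
  have sub1: "cball z (t - s) \<subseteq> ball 0 1"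
    using sub s by (auto simp: subset_iff)
  have "cmod ((deriv ^^ 1) F z) \<le> fact 1 * \<eta> / (t - s) ^ 1"
  proof (rule Cauchy_inequality)
    show "F holomorphic_on ball z (t - s)"
      using sub1 by (intro holomorphic_on_subset[OF F]) auto
    show "continuous_on (cball z (t - s)) F"
      using sub1 by (intro holomorphic_on_imp_continuous_on holomorphic_on_subset[OF F]) auto
    fix w assume "cmod (z - w) = t - s"
    hence "w \<in> cball z (t - s)" by (simp add: dist_norm)
    hence w: "cmod w \<le> t" using sub by auto
    have "cmod (F w) = cmod w * cmod (g w - g 0)"
      by (simp add: F_def norm_mult[symmetric] algebra_simps)
    also have "\<dots> \<le> 1 * \<eta>"
      using w s dev[OF w] by (intro mult_mono) auto
    finally show "cmod (F w) \<le> \<eta>" by simp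
  qed (use s in auto)
  moreover have "deriv F z = deriv (\<lambda>z. z * g z) z - g 0"
  proof -
    have gd: "g field_differentiable at z"
      using g z s by (intro holomorphic_on_imp_differentiable_at[OF g]) auto
    have "((\<lambda>z. z * g z) has_field_derivative deriv (\<lambda>z. z * g z) z) (at z)"
      using gd by (intro DERIV_deriv_iff_field_differentiable[THEN iffD2] derivative_intros) 
    hence "(F has_field_derivative (deriv (\<lambda>z. z * g z) z - g 0 * 1)) (at z)"
      unfolding F_def by (intro DERIV_diff DERIV_cmult DERIV_ident)
    thus ?thesis by (simp add: DERIV_imp_deriv)
  qed
  ultimately have "cmod (deriv (\<lambda>z. z * g z) z - g 0) \<le> \<eta> / (t - s)" by simp
  moreover have "cmod (g 0) \<le> cmod (deriv (\<lambda>z. z * g z) z) + cmod (deriv (\<lambda>z. z * g z) z - g 0)"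
    using norm_triangle_ineq4[of "deriv (\<lambda>z. z * g z) z" "deriv (\<lambda>z. z * g z) z - g 0"] by simp
  ultimately show "\<delta> - \<eta> / (t - s) \<le> cmod (deriv (\<lambda>z. z * g z) z)"
    using \<delta> by linarith
qed

section \<open>The derivative of a thin Blaschke product near the circle\<close>

lemma norm_disc_aut_ge:
  assumes "cmod a < 1" "cmod z < 1"
  shows "1 - 2 * (1 - cmod z) / (1 - cmod a)\<^sup>2 \<le> cmod (disc_aut a z)"
proof -
  have "cmod (cnj a * z) \<le> cmod a * 1"
    unfolding norm_mult complex_mod_cnj using assms by (intro mult_left_mono) auto
  hence den: "1 - cmod a \<le> cmod (1 - cnj a * z)"
    using norm_triangle_ineq2[of 1 "cnj a * z"] by simp
  have "1 - (cmod (disc_aut a z))\<^sup>2 = (1 - (cmod a)\<^sup>2) * (1 - (cmod z)\<^sup>2) / (cmod (1 - cnj a * z))\<^sup>2"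
    by (rule one_minus_norm_disc_aut_square) (use assms in auto)
  also have "\<dots> \<le> (1 * (2 * (1 - cmod z))) / (1 - cmod a)\<^sup>2"
  proof (intro frac_le mult_mono power_mono)
    have "1 - (cmod z)\<^sup>2 = (1 + cmod z) * (1 - cmod z)"
      by (simp add: power2_eq_square algebra_simps)
    also have "\<dots> \<le> 2 * (1 - cmod z)"
      using assms by (intro mult_right_mono) auto
    finally show "1 - (cmod z)\<^sup>2 \<le> 2 * (1 - cmod z)" .
  qed (use assms den in \<open>auto simp: abs_square_le_1 power_le_one\<close>)
  finally have "1 - 2 * (1 - cmod z) / (1 - cmod a)\<^sup>2 \<le> (cmod (disc_aut a z))\<^sup>2" by simp
  also have "\<dots> \<le> cmod (disc_aut a z)"
    using norm_disc_aut_less_1[OF assms] mult_right_mono[of "cmod (disc_aut a z)" 1 "cmod (disc_aut a z)"]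
    by (simp add: power2_eq_square)
  finally show ?thesis .
qed

text \<open>
  A finite Blaschke product has modulus close to 1 near the circle, with a bound that is
  explicit for one factor.
\<close>

lemma finite_blaschke_product_near_circle:
  fixes a :: "nat \<Rightarrow> complex"
  assumes "finite J" "\<And>j. j \<in> J \<Longrightarrow> cmod (a j) < 1" "r < 1"
  shows "\<exists>R. 0 < R \<and> R < 1 \<and> (\<forall>z. R \<le> cmod z \<and> cmod z < 1 \<longrightarrow> r \<le> (\<Prod>j\<in>J. cmod (blaschke_factor (a j) z)))"
  using assms
proof (induction J arbitrary: r rule: finite_induct)
  case empty
  thus ?case by (intro exI[of _ "1/2"]) auto
next
  case (insert j J)
  \<comment> \<open>The modulus of each of the two parts must exceed a number whose square is at least \<open>r\<close>; half the sum of 1 and \<open>r\<close> works by the inequality of the means.\<close>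
  define s where "s = (1 + max 0 r) / 2"
  have s: "0 < s" "s < 1" using insert.prems by (auto simp: s_def)
  have "4 * (s * s) - 4 * max 0 r = (1 - max 0 r)\<^sup>2"
    by (simp add: s_def power2_eq_square algebra_simps)
  hence ss: "r \<le> s * s" using zero_le_power2[of "1 - max 0 r"] by linarith
  obtain R where R: "0 < R" "R < 1" "\<And>z. R \<le> cmod z \<Longrightarrow> cmod z < 1 \<Longrightarrow> s \<le> (\<Prod>j\<in>J. cmod (blaschke_factor (a j) z))"
    using insert.IH[of s] insert.prems s by auto
  have aj: "cmod (a j) < 1" using insert.prems by auto
  define R' where "R' = max R (1 - (1 - s) * (1 - cmod (a j))\<^sup>2 / 2)"
  have "0 < (1 - s) * (1 - cmod (a j))\<^sup>2" using s aj by simp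
  hence R': "0 < R'" "R' < 1" using R(1,2) by (auto simp: R'_def)
  have "r \<le> (\<Prod>i\<in>insert j J. cmod (blaschke_factor (a i) z))" if z: "R' \<le> cmod z" "cmod z < 1" for z
  proof -
    have "2 * (1 - cmod z) \<le> (1 - s) * (1 - cmod (a j))\<^sup>2"
      using z by (simp add: R'_def)
    hence "2 * (1 - cmod z) / (1 - cmod (a j))\<^sup>2 \<le> 1 - s"
      using aj by (simp add: field_simps)
    hence "s \<le> cmod (blaschke_factor (a j) z)"
      using norm_disc_aut_ge[OF aj z(2)] by (simp add: norm_blaschke_factor)
    moreover have "s \<le> (\<Prod>i\<in>J. cmod (blaschke_factor (a i) z))"
      using R(3) z by (simp add: R'_def)
    ultimately have "s * s \<le> cmod (blaschke_factor (a j) z) * (\<Prod>i\<in>J. cmod (blaschke_factor (a i) z))"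
      using s by (intro mult_mono) auto
    thus ?thesis using ss insert.hyps by simp
  qed
  thus ?case using R' by blast
qed

text \<open>
  Maximum principle for the reciprocal of the product on the region where the product is small
  and every zero is far away: the reciprocal has no pole there and, by the hypothesis on the
  hyperbolic circles around the zeros, is at most \<open>1 / r\<close> on the boundary, so the region is
  empty. Finiteness of the product keeps the region away from the unit circle.
\<close>

lemma finite_blaschke_small_near_zero:
  fixes a :: "nat \<Rightarrow> complex"
  assumes J: "finite J" and a: "\<And>j. j \<in> J \<Longrightarrow> cmod (a j) < 1" and r: "0 < r" "r < 1" and s: "0 < s"
    and circ: "\<And>j z. j \<in> J \<Longrightarrow> cmod z < 1 \<Longrightarrow> cmod (disc_aut (a j) z) = s \<Longrightarrow> r \<le> (\<Prod>i\<in>J. cmod (blaschke_factor (a i) z))"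
    and w: "cmod w < 1" "(\<Prod>i\<in>J. cmod (blaschke_factor (a i) w)) < r"
  shows "\<exists>j\<in>J. cmod (disc_aut (a j) w) \<le> s"
proof (rule ccontr)
  assume contr: "\<not> ?thesis"
  define b where "b = (\<lambda>z. \<Prod>i\<in>J. blaschke_factor (a i) z)"
  have nb: "cmod (b z) = (\<Prod>i\<in>J. cmod (blaschke_factor (a i) z))" for z
    by (simp add: b_def prod_norm)
  have b: "b holomorphic_on ball 0 1"
    unfolding b_def using a by (intro holomorphic_on_prod blaschke_factor_holomorphic)
  obtain R where R: "0 < R" "R < 1" "\<And>z. R \<le> cmod z \<Longrightarrow> cmod z < 1 \<Longrightarrow> r \<le> cmod (b z)"
    using finite_blaschke_product_near_circle[where a = a, OF J a r(2)] unfolding nb by blast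
  have sub: "cball 0 R \<subseteq> ball (0::complex) 1" using R by auto
  have cb: "continuous_on (cball 0 R) b"
    using sub by (intro holomorphic_on_imp_continuous_on holomorphic_on_subset[OF b])
  have cd: "continuous_on (cball 0 R) (disc_aut (a j))" if "j \<in> J" for j
    using sub by (intro holomorphic_on_imp_continuous_on holomorphic_on_subset[OF disc_aut_holomorphic[OF a[OF that]]])
  define \<Omega> where "\<Omega> = {z\<in>ball 0 R. cmod (b z) < r \<and> (\<forall>j\<in>J. s < cmod (disc_aut (a j) z))}"
  define C where "C = {z\<in>cball 0 R. cmod (b z) \<le> r \<and> (\<forall>j\<in>J. s \<le> cmod (disc_aut (a j) z))}"
  have wR: "cmod w < R" using R(3)[of w] w by (auto simp: nb not_le[symmetric])
  have wO: "w \<in> \<Omega>" using contr w wR by (auto simp: \<Omega>_def nb)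
  have \<Omega>_int: "\<Omega> = (ball 0 R \<inter> {z\<in>ball 0 R. cmod (b z) < r}) \<inter> (\<Inter>j\<in>J. {z\<in>ball 0 R. s < cmod (disc_aut (a j) z)})"
    using J by (auto simp: \<Omega>_def)
  have "open \<Omega>"
  proof -
    have cb': "continuous_on (ball 0 R) b" using cb by (rule continuous_on_subset) auto
    have cd': "continuous_on (ball 0 R) (disc_aut (a j))" if "j \<in> J" for j
      using cd[OF that] by (rule continuous_on_subset) auto
    have 1: "open {z\<in>ball 0 R. cmod (b z) < r}"
      using continuous_open_preimage[OF continuous_on_norm[OF cb'], of "{..<r}"]
      by (simp add: vimage_def Int_def)
    have 2: "open {z\<in>ball 0 R. s < cmod (disc_aut (a j) z)}" if "j \<in> J" for j
      using continuous_open_preimage[OF continuous_on_norm[OF cd'[OF that]], of "{s<..}"]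
      by (simp add: vimage_def Int_def)
    show ?thesis unfolding \<Omega>_int
      by (intro open_Int open_INT 1 ballI 2 J) auto
  qed
  have "closed C"
  proof -
    have 1: "closed {z\<in>cball 0 R. cmod (b z) \<le> r}"
      using continuous_closed_preimage[OF continuous_on_norm[OF cb], of "{..r}"]
      by (simp add: vimage_def Int_def)
    have 2: "closed {z\<in>cball 0 R. s \<le> cmod (disc_aut (a j) z)}" if "j \<in> J" for j
      using continuous_closed_preimage[OF continuous_on_norm[OF cd[OF that]], of "{s..}"]
      by (simp add: vimage_def Int_def)
    have "C = {z\<in>cball 0 R. cmod (b z) \<le> r} \<inter> (\<Inter>j\<in>J. {z\<in>cball 0 R. s \<le> cmod (disc_aut (a j) z)})"
      by (auto simp: C_def)
    thus ?thesis using 1 2 by auto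
  qed
  hence cl: "closure \<Omega> \<subseteq> C"
    by (rule closure_minimal[rotated]) (auto simp: \<Omega>_def C_def)
  have CD: "C \<subseteq> ball 0 1" using sub by (auto simp: C_def)
  have bnz: "b z \<noteq> 0" if "z \<in> C" for z
  proof -
    have "blaschke_factor (a i) z \<noteq> 0" if "i \<in> J" for i
    proof -
      have "0 < cmod (disc_aut (a i) z)" using \<open>z \<in> C\<close> that s by (force simp: C_def)
      thus ?thesis by (metis norm_blaschke_factor norm_zero less_irrefl)
    qed
    thus ?thesis using J by (simp add: b_def)
  qed
  have "cmod (1 / b w) \<le> 1 / r"
  proof (rule maximum_modulus_frontier[of "\<lambda>z. 1 / b z" \<Omega>])
    have "\<Omega> \<subseteq> C" using cl closure_subset by blast
    thus "(\<lambda>z. 1 / b z) holomorphic_on interior \<Omega>"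
      using bnz CD \<open>open \<Omega>\<close> by (intro holomorphic_intros holomorphic_on_subset[OF b]) (auto simp: interior_open)
    show "continuous_on (closure \<Omega>) (\<lambda>z. 1 / b z)"
      using cl bnz by (intro continuous_intros continuous_on_subset[OF cb]) (auto simp: C_def)
    show "bounded \<Omega>" by (rule bounded_subset[OF bounded_ball[of 0 R]]) (auto simp: \<Omega>_def)
    show "w \<in> \<Omega>" by (rule wO)
    fix z assume "z \<in> frontier \<Omega>"
    hence z: "z \<in> C" "z \<notin> \<Omega>" using cl \<open>open \<Omega>\<close> by (auto simp: frontier_def interior_open)
    have "r \<le> cmod (b z)"
    proof (rule ccontr)
      assume lt: "\<not> ?thesis"
      have zD: "cmod z < 1" using z CD by auto
      hence "cmod z < R" using R(3)[of z] lt by (auto simp: not_le[symmetric])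
      then obtain j where "j \<in> J" "cmod (disc_aut (a j) z) = s"
        using z lt by (force simp: C_def \<Omega>_def)
      thus False using circ[OF _ zD] lt by (auto simp: nb)
    qed
    thus "cmod (1 / b z) \<le> 1 / r" using r by (simp add: norm_divide frac_le)
  qed
  moreover have "0 < cmod (b w)" using bnz[of w] wO cl closure_subset by force
  ultimately show False using w r by (simp add: norm_divide nb[symmetric] field_simps)
qed

lemma blaschke_factor_eq_disc_aut: "\<exists>c. cmod c = 1 \<and> blaschke_factor a = (\<lambda>z. c * disc_aut a z)"
proof (cases "a = 0")
  case True
  thus ?thesis by (intro exI[of _ "-1"]) (auto simp: blaschke_factor_def disc_aut_def fun_eq_iff)
next
  case False
  thus ?thesis by (intro exI[of _ "of_real (cmod a) / a"]) (auto simp: blaschke_factor_def disc_aut_def norm_divide fun_eq_iff)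
qed

lemma thin_blaschke_holomorphic:
  assumes "thin_blaschke_product B"
  shows "B holomorphic_on ball 0 1" and "z \<in> ball 0 1 \<Longrightarrow> cmod (B z) < 1"
proof -
  obtain a where aB: "blaschke_product_with_zeros a B"
    using assms by (auto simp: thin_blaschke_product_def)
  then obtain c where c: "cmod c = 1" "\<And>z. z \<in> ball 0 1 \<Longrightarrow> B z = c * (\<Prod>n. blaschke_factor (a n) z)"
    by (auto simp: blaschke_product_with_zeros_def)
  have a: "\<And>n. a n \<in> ball 0 1" and summ: "summable (\<lambda>n. 1 - cmod (a n))"
    using aB by (auto simp: blaschke_product_with_zeros_def)
  have "(\<lambda>z. c * (\<Prod>n. blaschke_factor (a n) z)) holomorphic_on ball 0 1"
    using blaschke_subproduct(1)[OF a summ, where J = UNIV] by (auto intro!: holomorphic_intros)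
  thus "B holomorphic_on ball 0 1" by (rule holomorphic_transform) (use c(2) in auto)
  assume z: "z \<in> ball 0 1"
  have "cmod (B z) = cmod (blaschke_factor (a 0) z) * cmod (blaschke_cofactor a 0 z)"
    using c z by (simp add: norm_mult blaschke_product_split_factor[OF a summ z, where k = 0])
  also have "\<dots> \<le> cmod (blaschke_factor (a 0) z) * 1"
    using z by (intro mult_left_mono blaschke_cofactor_bounded_holomorphic(2)[OF a summ]) auto
  also have "\<dots> < 1" using norm_blaschke_factor_less_1[of "a 0" z] a[of 0] z by simp
  finally show "cmod (B z) < 1" .
qed

text \<open>
  For large indices \<open>B\<close> is nearly a rotation in the hyperbolic disc of radius \<open>s\<close> around its
  zero. If \<open>\<bar>B z\<bar> \<le> r\<close> and \<open>z\<close> is near the circle, then the finitely many zeros of small index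
  contribute almost nothing, a finite partial product over the large indices is still small at
  \<open>z\<close>, and so \<open>z\<close> lies in one of these discs; there the derivative is bounded below.
\<close>

lemma thin_blaschke_deriv_near_circle:
  assumes thin: "thin_blaschke_product B" and r: "0 < r" "r < 1"
  shows "\<exists>R c. 0 < R \<and> R < 1 \<and> 0 < c \<and>
           (\<forall>z. R \<le> cmod z \<and> cmod z < 1 \<and> cmod (B z) \<le> r \<longrightarrow> c \<le> cmod (deriv B z) * (1 - (cmod z)\<^sup>2))"
proof -
  obtain a where aB: "blaschke_product_with_zeros a B"
    and lim: "(\<lambda>k. \<Prod>j. if j = k then 1 else pseudohyp_dist (a j) (a k)) \<longlonglongrightarrow> 1"
    using thin by (auto simp: thin_blaschke_product_def)
  obtain c0 where c0: "cmod c0 = 1" "\<And>z. z \<in> ball 0 1 \<Longrightarrow> B z = c0 * (\<Prod>n. blaschke_factor (a n) z)"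
    and a: "\<And>n. a n \<in> ball 0 1" and summ: "summable (\<lambda>n. 1 - cmod (a n))"
    using aB by (auto simp: blaschke_product_with_zeros_def)
  have a': "cmod (a n) < 1" for n using a[of n] by simp
  define \<delta> where "\<delta> = (\<lambda>k. cmod (blaschke_cofactor a k (a k)))"
  have lim\<delta>: "\<delta> \<longlonglongrightarrow> 1"
    using lim by (simp add: \<delta>_def norm_blaschke_cofactor[OF a summ])
  \<comment> \<open>Partial products approximate \<open>B\<close> up to \<open>r1\<close>, the small zeros cost the factor \<open>r1 / r2\<close>, and \<open>s > r2\<close> leaves room for the deviation from a rotation.\<close>
  obtain r1 where r1: "r < r1" "r1 < 1" using dense r by blast
  obtain r2 where r2: "r1 < r2" "r2 < 1" using dense r1 by blast
  obtain s where s: "r2 < s" "s < 1" using dense r2 by blast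
  obtain t where t: "s < t" "t < 1" using dense s by blast
  have pos: "0 < r1" "0 < r2" "0 < s" "0 < t" using r r1 r2 s t by auto
  define \<eta> where "\<eta> = (\<lambda>k. (1 - (\<delta> k)\<^sup>2) * (t / (1 - t)))"
  have lim\<eta>: "\<eta> \<longlonglongrightarrow> (1 - 1\<^sup>2) * (t / (1 - t))"
    unfolding \<eta>_def by (intro tendsto_intros lim\<delta>)
  have ev1: "eventually (\<lambda>k. r2 / s < \<delta> k - \<eta> k) sequentially"
    using tendsto_diff[OF lim\<delta> lim\<eta>] s pos by (intro order_tendstoD(1)) auto
  have "(\<lambda>k. \<delta> k - \<eta> k / (t - s)) \<longlonglongrightarrow> 1 - (1 - 1\<^sup>2) * (t / (1 - t)) / (t - s)"
    using t by (intro tendsto_intros lim\<delta> lim\<eta>) auto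
  hence ev2: "eventually (\<lambda>k. 1 / 2 < \<delta> k - \<eta> k / (t - s)) sequentially"
    by (rule order_tendstoD(1)) simp
  obtain N where N: "\<And>k. N \<le> k \<Longrightarrow> r2 / s < \<delta> k - \<eta> k" "\<And>k. N \<le> k \<Longrightarrow> 1 / 2 < \<delta> k - \<eta> k / (t - s)"
    using ev1 ev2 unfolding eventually_sequentially by (meson nat_le_linear order.trans)
  obtain R where R: "0 < R" "R < 1"
    "\<And>z. R \<le> cmod z \<Longrightarrow> cmod z < 1 \<Longrightarrow> r1 / r2 \<le> (\<Prod>n<N. cmod (blaschke_factor (a n) z))"
    using finite_blaschke_product_near_circle[of "{..<N}" a "r1 / r2"] a' r2 pos by auto
  have rot: "\<delta> k - \<eta> k \<le> cmod (g w)" "\<delta> k - \<eta> k / (t - s) \<le> cmod (deriv (\<lambda>z. z * g z) w)"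
    if "g holomorphic_on ball 0 1" "\<And>z. z \<in> ball 0 1 \<Longrightarrow> cmod (g z) \<le> 1" "\<delta> k \<le> cmod (g 0)" "cmod w \<le> s" for g k w
    using nearly_rotation_lower_bounds[OF that(1,2) _ that(3) pos(3) t that(4)] by (auto simp: \<eta>_def \<delta>_def)
  show ?thesis
  proof (intro exI conjI allI impI)
    show "0 < R" "R < 1" by fact+
    show "0 < (1 - s\<^sup>2) / 2" using s pos by (simp add: power_less_one_iff)
    fix z assume z: "R \<le> cmod z \<and> cmod z < 1 \<and> cmod (B z) \<le> r"
    have "(\<lambda>m. \<Prod>n<m. cmod (blaschke_factor (a n) z)) \<longlonglongrightarrow> cmod (\<Prod>n. blaschke_factor (a n) z)"
      using tendsto_norm[OF blaschke_subproduct(2)[OF a summ, where J = UNIV and z = z]] z by (simp add: prod_norm)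
    also have "cmod (\<Prod>n. blaschke_factor (a n) z) = cmod (B z)"
      using c0 z by (simp add: norm_mult)
    finally have "eventually (\<lambda>m. (\<Prod>n<m. cmod (blaschke_factor (a n) z)) < r1) sequentially"
      by (rule order_tendstoD(2)) (use z r1 in auto)
    then obtain m where m: "N \<le> m" "(\<Prod>n<m. cmod (blaschke_factor (a n) z)) < r1"
      unfolding eventually_sequentially by (meson nat_le_linear order.trans)
    define J where "J = {N..<m}"
    have "(\<Prod>n<m. cmod (blaschke_factor (a n) z)) = (\<Prod>n\<in>J. cmod (blaschke_factor (a n) z)) * (\<Prod>n<N. cmod (blaschke_factor (a n) z))"
    proof -
      have "{..<m} - {..<N} = J" using m by (auto simp: J_def)
      thus ?thesis using prod.subset_diff[of "{..<N}" "{..<m}" "\<lambda>n. cmod (blaschke_factor (a n) z)"] m by simp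
    qed
    moreover have "(\<Prod>n\<in>J. cmod (blaschke_factor (a n) z)) * (r1 / r2) \<le> (\<Prod>n\<in>J. cmod (blaschke_factor (a n) z)) * (\<Prod>n<N. cmod (blaschke_factor (a n) z))"
      using R(3)[of z] z by (intro mult_left_mono prod_nonneg) auto
    ultimately have "(\<Prod>n\<in>J. cmod (blaschke_factor (a n) z)) * (r1 / r2) < r1"
      using m by linarith
    hence small: "(\<Prod>n\<in>J. cmod (blaschke_factor (a n) z)) < r2"
      using pos by (simp add: field_simps)
    have "\<exists>j\<in>J. cmod (disc_aut (a j) z) \<le> s"
    proof (rule finite_blaschke_small_near_zero[of J a r2 s z])
      fix j w assume j: "j \<in> J" and w: "cmod w < 1" "cmod (disc_aut (a j) w) = s"
      define \<zeta> where "\<zeta> = disc_aut (a j) w"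
      have w_eq: "w = disc_aut (a j) \<zeta>"
        using disc_aut_involution[OF a' w(1)] by (simp add: \<zeta>_def)
      define g where "g = (\<lambda>\<zeta>. \<Prod>i\<in>J-{j}. blaschke_factor (a i) (disc_aut (a j) \<zeta>))"
      have "\<delta> j - \<eta> j \<le> cmod (g \<zeta>)"
      proof (rule rot(1)[of g j \<zeta>])
        have im: "disc_aut (a j) ` ball 0 1 \<subseteq> ball 0 1"
          using norm_disc_aut_less_1[OF a'] by auto
        show "g holomorphic_on ball 0 1"
          unfolding g_def
          by (intro holomorphic_on_prod
               holomorphic_on_compose_gen[OF disc_aut_holomorphic[OF a'] blaschke_factor_holomorphic[OF a'] im, unfolded o_def])
        show "cmod (g x) \<le> 1" if "x \<in> ball 0 1" for x
          unfolding g_def prod_norm[symmetric]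
          using norm_blaschke_factor_less_1[OF a' norm_disc_aut_less_1[OF a']] that
          by (intro prod_le_1) (auto intro: less_imp_le)
        show "\<delta> j \<le> cmod (g 0)"
          unfolding \<delta>_def g_def prod_norm[symmetric]
          using norm_blaschke_cofactor_le_prod[OF a summ, of "J - {j}" j "a j"] a[of j] by (simp add: J_def)
        show "cmod \<zeta> \<le> s" using w by (simp add: \<zeta>_def)
      qed
      hence "r2 / s \<le> cmod (g \<zeta>)" using N(1)[of j] j by (simp add: J_def)
      hence "r2 \<le> s * cmod (g \<zeta>)" using pos by (simp add: field_simps)
      also have "s * cmod (g \<zeta>) = (\<Prod>i\<in>J. cmod (blaschke_factor (a i) w))"
        using prod.remove[of J j "\<lambda>i. cmod (blaschke_factor (a i) w)"] j w
        by (simp add: g_def prod_norm[symmetric] w_eq[symmetric] J_def norm_blaschke_factor)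
      finally show "r2 \<le> (\<Prod>i\<in>J. cmod (blaschke_factor (a i) w))" .
    qed (use a' pos r2 z small in \<open>auto simp: J_def\<close>)
    then obtain j where j: "j \<in> J" "cmod (disc_aut (a j) z) \<le> s" by blast
    \<comment> \<open>Read in the chart centred at \<open>a j\<close>, \<open>B\<close> becomes \<open>x * g x\<close>, and \<open>z\<close> becomes \<open>\<zeta>\<close>.\<close>
    define \<zeta> where "\<zeta> = disc_aut (a j) z"
    have z_eq: "z = disc_aut (a j) \<zeta>"
      using disc_aut_involution[OF a'] z by (simp add: \<zeta>_def)
    have \<zeta>: "cmod \<zeta> \<le> s" "cmod \<zeta> < 1" using j s by (auto simp: \<zeta>_def)
    obtain \<kappa> where \<kappa>: "cmod \<kappa> = 1" "blaschke_factor (a j) = (\<lambda>z. \<kappa> * disc_aut (a j) z)"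
      using blaschke_factor_eq_disc_aut by blast
    have im: "disc_aut (a j) ` ball 0 1 \<subseteq> ball 0 1"
      using norm_disc_aut_less_1[OF a'] by auto
    define g where "g = (\<lambda>\<zeta>. c0 * \<kappa> * blaschke_cofactor a j (disc_aut (a j) \<zeta>))"
    have f_eq: "B (disc_aut (a j) x) = x * g x" if "x \<in> ball 0 1" for x
      using that norm_disc_aut_less_1[OF a', of x j] disc_aut_involution[OF a', of x j]
      by (simp add: c0 g_def blaschke_product_split_factor[OF a summ, where k = j] \<kappa>(2) mult_ac)
    have "\<delta> j - \<eta> j / (t - s) \<le> cmod (deriv (\<lambda>z. z * g z) \<zeta>)"
    proof (rule rot(2)[of g j \<zeta>])
      show "g holomorphic_on ball 0 1"
        unfolding g_def
        by (intro holomorphic_intros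
             holomorphic_on_compose_gen[OF disc_aut_holomorphic[OF a'] blaschke_cofactor_bounded_holomorphic(1)[OF a summ] im, unfolded o_def])
      show "cmod (g x) \<le> 1" if "x \<in> ball 0 1" for x
        using blaschke_cofactor_bounded_holomorphic(2)[OF a summ, of "disc_aut (a j) x"]
          norm_disc_aut_less_1[OF a', of x j] that c0(1) \<kappa>(1) by (simp add: g_def norm_mult)
      show "\<delta> j \<le> cmod (g 0)" using c0 \<kappa> by (simp add: \<delta>_def g_def norm_mult)
    qed (use \<zeta> in auto)
    moreover have "1 / 2 < \<delta> j - \<eta> j / (t - s)" by (rule N(2)) (use j in \<open>simp add: J_def\<close>)
    ultimately have "1 / 2 \<le> cmod (deriv (\<lambda>z. z * g z) \<zeta>)" by linarith
    also have "deriv (\<lambda>z. z * g z) \<zeta> = deriv (\<lambda>x. B (disc_aut (a j) x)) \<zeta>"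
    proof (rule deriv_cong_ev[OF _ refl])
      have "eventually (\<lambda>x. x \<in> ball 0 1) (nhds \<zeta>)" using \<zeta> by (intro eventually_nhds_in_open) auto
      thus "eventually (\<lambda>x. x * g x = B (disc_aut (a j) x)) (nhds \<zeta>)"
        by eventually_elim (use f_eq in auto)
    qed
    also have "\<dots> = deriv B z * deriv (disc_aut (a j)) \<zeta>"
    proof -
      have "B holomorphic_on ball 0 1" by (rule thin_blaschke_holomorphic(1)[OF thin])
      hence "B field_differentiable at z" "disc_aut (a j) field_differentiable at \<zeta>"
        using z \<zeta> disc_aut_holomorphic[OF a'[of j]] by (auto intro!: holomorphic_on_imp_differentiable_at)
      thus ?thesis
        using deriv_chain[of "disc_aut (a j)" \<zeta> B] by (simp add: o_def z_eq[symmetric])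
    qed
    finally have half: "1 / 2 \<le> cmod (deriv B z) * cmod (deriv (disc_aut (a j)) \<zeta>)"
      by (simp add: norm_mult)
    have "(1 - s\<^sup>2) / 2 = 1 / 2 * (1 - s\<^sup>2)" by simp
    also have "\<dots> \<le> 1 / 2 * (1 - (cmod \<zeta>)\<^sup>2)" using \<zeta> by (simp add: power_mono)
    also have "\<dots> \<le> cmod (deriv B z) * cmod (deriv (disc_aut (a j)) \<zeta>) * (1 - (cmod \<zeta>)\<^sup>2)"
      using half \<zeta> by (intro mult_right_mono) (auto simp: abs_square_le_1)
    also have "\<dots> = cmod (deriv B z) * (1 - (cmod z)\<^sup>2)"
      using norm_deriv_disc_aut[OF a' \<zeta>(2), of j] by (simp add: z_eq[symmetric] mult.assoc)
    finally show "(1 - s\<^sup>2) / 2 \<le> cmod (deriv B z) * (1 - (cmod z)\<^sup>2)" .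
  qed
qed

section \<open>A thin Blaschke product is a covering away from its critical values\<close>

text \<open>
  Near the circle the bound comes from thinness. On a compact disc there are no critical points
  close to the fibre over \<open>u\<close>, and the bound comes from compactness.
\<close>

lemma thin_blaschke_deriv_near_noncritical_value:
  assumes thin: "thin_blaschke_product B" and u: "cmod u < 1" "u \<notin> critical_values B"
  shows "\<exists>\<epsilon> c. 0 < \<epsilon> \<and> 0 < c \<and> (\<forall>z. cmod z < 1 \<and> cmod (B z - u) < \<epsilon> \<longrightarrow> c \<le> cmod (deriv B z) * (1 - (cmod z)\<^sup>2))"
proof -
  note B = thin_blaschke_holomorphic[OF thin]
  define r where "r = (1 + cmod u) / 2"
  have r: "0 < r" "r < 1" using u by (auto simp: r_def add_pos_nonneg)
  obtain R c1 where R: "0 < R" "R < 1" and c1: "0 < c1"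
    "\<And>z. R \<le> cmod z \<Longrightarrow> cmod z < 1 \<Longrightarrow> cmod (B z) \<le> r \<Longrightarrow> c1 \<le> cmod (deriv B z) * (1 - (cmod z)\<^sup>2)"
    using thin_blaschke_deriv_near_circle[OF thin r] by blast
  have sub: "cball 0 R \<subseteq> ball (0::complex) 1" using R by auto
  have cB: "continuous_on (cball 0 R) B"
    using sub by (intro holomorphic_on_imp_continuous_on holomorphic_on_subset[OF B(1)])
  have cB': "continuous_on (cball 0 R) (deriv B)"
    using sub by (intro holomorphic_on_imp_continuous_on holomorphic_on_subset[OF holomorphic_deriv[OF B(1)]]) auto
  define X where "X = cball 0 R \<inter> deriv B -` {0}"
  have "compact X"
    unfolding X_def
    using continuous_closed_preimage[OF cB', of "{0}"] by (auto simp: compact_eq_bounded_closed)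
  hence "compact (B ` X)"
    by (intro compact_continuous_image continuous_on_subset[OF cB]) (auto simp: X_def)
  moreover have "u \<notin> B ` X"
    using u(2) sub by (auto simp: critical_values_def X_def)
  ultimately obtain e where e: "0 < e" "\<And>x. x \<in> X \<Longrightarrow> e \<le> dist u (B x)"
    using separate_point_closed[of "B ` X" u] compact_imp_closed by blast
  define \<epsilon> where "\<epsilon> = min (e / 2) ((1 - cmod u) / 2)"
  have \<epsilon>: "0 < \<epsilon>" "\<epsilon> < e" "\<epsilon> \<le> (1 - cmod u) / 2"
    using e(1) u(1) by (simp_all add: \<epsilon>_def min_less_iff_disj del: le_divide_eq_numeral1 divide_le_eq_numeral1)
  define Y where "Y = {z\<in>cball 0 R. cmod (B z - u) \<le> \<epsilon>}"
  have "compact Y"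
  proof -
    have "closed Y"
      unfolding Y_def
      using continuous_closed_preimage[OF continuous_on_norm[OF continuous_on_diff[OF cB continuous_on_const]], of "{..\<epsilon>}"]
      by (simp add: vimage_def Int_def)
    thus ?thesis by (auto simp: compact_eq_bounded_closed Y_def intro: bounded_subset[OF bounded_cball[of 0 R]])
  qed
  have "\<exists>c2>0. \<forall>z\<in>Y. c2 \<le> cmod (deriv B z) * (1 - (cmod z)\<^sup>2)"
  proof (cases "Y = {}")
    case False
    have "continuous_on Y (\<lambda>z. cmod (deriv B z) * (1 - (cmod z)\<^sup>2))"
      by (intro continuous_intros continuous_on_subset[OF cB']) (auto simp: Y_def)
    then obtain y where y: "y \<in> Y" "\<And>z. z \<in> Y \<Longrightarrow> cmod (deriv B y) * (1 - (cmod y)\<^sup>2) \<le> cmod (deriv B z) * (1 - (cmod z)\<^sup>2)"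
      using continuous_attains_inf[OF \<open>compact Y\<close> False] by blast
    have "y \<notin> X"
      using e(2)[of y] \<epsilon> y(1) by (auto simp: Y_def dist_norm norm_minus_commute)
    hence "deriv B y \<noteq> 0" using y(1) by (auto simp: X_def Y_def)
    moreover have "cmod y < 1" using y(1) sub by (auto simp: Y_def)
    ultimately have "0 < cmod (deriv B y) * (1 - (cmod y)\<^sup>2)" by (simp add: abs_square_less_1)
    thus ?thesis using y(2) by blast
  qed (auto intro: exI[of _ 1])
  then obtain c2 where c2: "0 < c2" "\<And>z. z \<in> Y \<Longrightarrow> c2 \<le> cmod (deriv B z) * (1 - (cmod z)\<^sup>2)" by blast
  show ?thesis
  proof (intro exI conjI allI impI)
    show "0 < \<epsilon>" "0 < min c1 c2" using \<epsilon> c1 c2 by auto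
    fix z assume z: "cmod z < 1 \<and> cmod (B z - u) < \<epsilon>"
    show "min c1 c2 \<le> cmod (deriv B z) * (1 - (cmod z)\<^sup>2)"
    proof (cases "cmod z \<le> R")
      case True
      thus ?thesis using c2(2)[of z] z by (force simp: Y_def)
    next
      case False
      have "cmod (B z) \<le> cmod u + cmod (B z - u)" by (rule norm_triangle_sub)
      also have "\<dots> \<le> r" using z \<epsilon>(3) by (simp add: r_def field_simps)
      finally show ?thesis using c1(2)[of z] False z by force
    qed
  qed
qed

text \<open>
  A quantitative inverse function theorem. The Cauchy estimates bound the second derivative by
  32 on the disc of radius 1/2, so on the disc of radius \<open>t\<close> the derivative stays within \<open>c / 4\<close>
  of its value at 0; this gives injectivity, and Bloch's lemma gives the size of the image.
\<close>

lemma uniform_inverse_function_disc: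
  assumes "0 < c"
  shows "\<exists>t s. 0 < t \<and> t < 1 \<and> 0 < s \<and>
    (\<forall>f. f holomorphic_on ball 0 1 \<and> (\<forall>z\<in>ball 0 1. cmod (f z) \<le> 1) \<and> c \<le> cmod (deriv f 0) \<longrightarrow>
       inj_on f (ball 0 t) \<and> ball (f 0) s \<subseteq> f ` ball 0 t)"
proof -
  define t where "t = min (1/2) (c / 128)"
  have t: "0 < t" "t \<le> 1/2" "32 * t \<le> c / 4" using assms by (auto simp: t_def min_def)
  have "sqrt 2 < 3 / 2" by (rule real_less_lsqrt) (auto simp: power2_eq_square)
  hence k: "0 < 3 - 2 * sqrt 2" by simp
  define s where "s = (3 - 2 * sqrt 2) * t * c"
  have "inj_on f (ball 0 t) \<and> ball (f 0) s \<subseteq> f ` ball 0 t"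
    if f: "f holomorphic_on ball 0 1" "\<forall>z\<in>ball 0 1. cmod (f z) \<le> 1" "c \<le> cmod (deriv f 0)" for f
  proof -
    have f2: "cmod ((deriv ^^ 2) f x) \<le> 32" if x: "cmod x \<le> 1/2" for x
    proof -
      have sub: "cball x (1/4) \<subseteq> ball 0 1"
      proof
        fix y assume "y \<in> cball x (1/4)"
        thus "y \<in> ball 0 1" using norm_triangle_sub[of y x] x by (simp add: dist_norm norm_minus_commute)
      qed
      have "cmod ((deriv ^^ 2) f x) \<le> fact 2 * 1 / (1/4) ^ 2"
      proof (rule Cauchy_inequality)
        show "f holomorphic_on ball x (1/4)" using sub by (intro holomorphic_on_subset[OF f(1)]) auto
        show "continuous_on (cball x (1/4)) f"
          using sub by (intro holomorphic_on_imp_continuous_on holomorphic_on_subset[OF f(1)])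
        fix w assume "cmod (x - w) = 1/4"
        hence "w \<in> cball x (1/4)" by (simp add: dist_norm)
        thus "cmod (f w) \<le> 1" using f(2) sub by blast
      qed auto
      thus ?thesis by (simp add: power2_eq_square)
    qed
    have dev: "cmod (deriv f x - deriv f 0) \<le> c / 4" if x: "cmod x \<le> t" for x
    proof -
      have "cmod (deriv f x - deriv f 0) \<le> 32 * cmod (x - 0)"
      proof (rule field_differentiable_bound[of "cball 0 (1/2)" "deriv f" "(deriv ^^ 2) f" 32])
        fix z :: complex assume "z \<in> cball 0 (1/2)"
        hence z: "cmod z \<le> 1/2" by simp
        show "cmod ((deriv ^^ 2) f z) \<le> 32" using f2[OF z] .
        have "deriv f holomorphic_on ball 0 1" using f(1) by (intro holomorphic_deriv) auto
        hence "(deriv f has_field_derivative deriv (deriv f) z) (at z)"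
          using z by (intro holomorphic_derivI[of _ "ball 0 1"]) auto
        thus "(deriv f has_field_derivative (deriv ^^ 2) f z) (at z within cball 0 (1/2))"
          by (simp add: numeral_2_eq_2 has_field_derivative_at_within)
      qed (use x t in auto)
      also have "\<dots> \<le> 32 * t" using x by simp
      finally show ?thesis using t(3) by simp
    qed
    have "inj_on f (ball 0 t)"
    proof (rule inj_onI)
      fix x y assume xy: "x \<in> ball 0 t" "y \<in> ball 0 t" "f x = f y"
      have "cmod ((f x - deriv f 0 * x) - (f y - deriv f 0 * y)) \<le> c / 4 * cmod (x - y)"
      proof (rule field_differentiable_bound[of "ball 0 t" "\<lambda>x. f x - deriv f 0 * x" "\<lambda>x. deriv f x - deriv f 0" "c / 4"])
        fix z :: complex assume z: "z \<in> ball 0 t"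
        show "cmod (deriv f z - deriv f 0) \<le> c / 4" using dev[of z] z by simp
        have "(f has_field_derivative deriv f z) (at z)"
          using z t by (intro holomorphic_derivI[OF f(1)]) auto
        hence "((\<lambda>x. f x - deriv f 0 * x) has_field_derivative (deriv f z - deriv f 0 * 1)) (at z)"
          by (intro DERIV_diff DERIV_cmult DERIV_ident)
        thus "((\<lambda>x. f x - deriv f 0 * x) has_field_derivative (deriv f z - deriv f 0)) (at z within ball 0 t)"
          by (simp add: has_field_derivative_at_within)
      qed (use xy in auto)
      also have "(f x - deriv f 0 * x) - (f y - deriv f 0 * y) = deriv f 0 * (y - x)"
        using xy(3) by (simp add: algebra_simps)
      finally have "cmod (deriv f 0) * cmod (x - y) \<le> c / 4 * cmod (x - y)"
        by (simp add: norm_mult norm_minus_commute)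
      moreover have "c / 4 < cmod (deriv f 0)" using f(3) assms by linarith
      ultimately show "x = y" by (metis linorder_not_less mult_less_cancel_right_pos right_minus_eq zero_less_norm_iff)
    qed
    moreover have "ball (f 0) ((3 - 2 * sqrt 2) * t * cmod (deriv f 0)) \<subseteq> f ` ball 0 t"
    proof (rule Bloch_lemma)
      show "f holomorphic_on cball 0 t" using t by (intro holomorphic_on_subset[OF f(1)]) auto
      fix z :: complex assume "z \<in> ball 0 t"
      hence "cmod (deriv f z - deriv f 0) \<le> cmod (deriv f 0)" using dev[of z] f(3) assms by simp
      thus "cmod (deriv f z) \<le> 2 * cmod (deriv f 0)"
        using norm_triangle_sub[of "deriv f z" "deriv f 0"] by simp
    qed (use t in auto)
    moreover have "s \<le> (3 - 2 * sqrt 2) * t * cmod (deriv f 0)"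
      unfolding s_def using k t f(3) by (intro mult_left_mono) auto
    ultimately show ?thesis by (meson order.trans subset_ball)
  qed
  moreover have "0 < s" using k t assms by (simp add: s_def)
  ultimately show ?thesis using t by (intro exI[of _ t] exI[of _ s]) auto
qed

text \<open>
  The inverse function theorem is applied to \<open>B\<close> read in a disc chart centred at \<open>z\<close>, whose
  derivative at 0 has modulus \<open>(1 - \<bar>z\<bar>\<^sup>2) \<bar>B'(z)\<bar>\<close>. The radius does not depend on \<open>z\<close>, which is
  what makes the covering even over infinitely many sheets.
\<close>

lemma thin_blaschke_uniform_sections:
  assumes thin: "thin_blaschke_product B" and u: "cmod u < 1" "u \<notin> critical_values B"
  shows "\<exists>\<epsilon>>0. ball u \<epsilon> \<inter> critical_values B = {} \<and>
    (\<forall>z\<in>ball 0 1. B z \<in> ball u \<epsilon> \<longrightarrow>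
       (\<exists>V. open V \<and> z \<in> V \<and> V \<subseteq> ball 0 1 \<and> inj_on B V \<and> B ` V = ball u \<epsilon>))"
proof -
  note B = thin_blaschke_holomorphic[OF thin]
  obtain e c where e: "0 < e" and c: "0 < c"
    "\<And>z. cmod z < 1 \<Longrightarrow> cmod (B z - u) < e \<Longrightarrow> c \<le> cmod (deriv B z) * (1 - (cmod z)\<^sup>2)"
    using thin_blaschke_deriv_near_noncritical_value[OF thin u] by blast
  obtain t s where ts: "0 < t" "t < 1" "0 < s"
    "\<And>f. f holomorphic_on ball 0 1 \<Longrightarrow> (\<And>z. z \<in> ball 0 1 \<Longrightarrow> cmod (f z) \<le> 1) \<Longrightarrow> c \<le> cmod (deriv f 0)
       \<Longrightarrow> inj_on f (ball 0 t) \<and> ball (f 0) s \<subseteq> f ` ball 0 t"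
    using uniform_inverse_function_disc[OF c(1)] by blast
  define \<epsilon> where "\<epsilon> = min e (s / 2)"
  have \<epsilon>: "0 < \<epsilon>" "\<epsilon> \<le> e" "2 * \<epsilon> \<le> s" using e ts by (auto simp: \<epsilon>_def)
  show ?thesis
  proof (intro exI[of _ \<epsilon>] conjI ballI impI)
    show "\<epsilon> > 0" by fact
    show "ball u \<epsilon> \<inter> critical_values B = {}"
    proof (rule ccontr)
      assume "\<not> ?thesis"
      then obtain z where "z \<in> ball 0 1" "deriv B z = 0" "B z \<in> ball u \<epsilon>"
        by (auto simp: critical_values_def)
      thus False using c(2)[of z] c(1) \<epsilon> by (auto simp: dist_norm norm_minus_commute)
    qed
    fix z :: complex assume z: "z \<in> ball 0 1" and Bz: "B z \<in> ball u \<epsilon>"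
    have z1: "cmod z < 1" using z by simp
    define f where "f = B \<circ> disc_aut z"
    have im: "disc_aut z ` ball 0 1 \<subseteq> ball 0 1" using norm_disc_aut_less_1[OF z1] by auto
    have fhol: "f holomorphic_on ball 0 1"
      unfolding f_def by (rule holomorphic_on_compose_gen[OF disc_aut_holomorphic[OF z1] B(1) im])
    have f1: "cmod (f x) \<le> 1" if "x \<in> ball 0 1" for x
      using B(2)[of "disc_aut z x"] norm_disc_aut_less_1[OF z1, of x] that by (simp add: f_def)
    have "disc_aut z field_differentiable at 0" "B field_differentiable at z"
      using z B(1) disc_aut_holomorphic[OF z1] by (auto intro!: holomorphic_on_imp_differentiable_at)
    hence "deriv f 0 = deriv B z * deriv (disc_aut z) 0"
      unfolding f_def using deriv_chain[of "disc_aut z" 0 B] by simp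
    hence "cmod (deriv f 0) = cmod (deriv B z) * (1 - (cmod z)\<^sup>2)"
      using norm_deriv_disc_aut[OF z1, of 0] by (simp add: norm_mult)
    hence "c \<le> cmod (deriv f 0)"
      using c(2)[of z] z Bz \<epsilon> by (auto simp: dist_norm norm_minus_commute)
    from ts(4)[OF fhol f1 this] have inj: "inj_on f (ball 0 t)" and cov: "ball (B z) s \<subseteq> f ` ball 0 t"
      by (auto simp: f_def)
    define T where "T = disc_aut z ` ball 0 t"
    have sub: "ball 0 t \<subseteq> ball (0::complex) 1" using ts by auto
    have "open T"
      unfolding T_def
      by (rule open_mapping_thm3) (use sub in \<open>auto intro: holomorphic_on_subset[OF disc_aut_holomorphic[OF z1]] inj_on_subset[OF disc_aut_inj[OF z1]]\<close>)
    have TD: "T \<subseteq> ball 0 1" using im sub by (auto simp: T_def)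
    have "z \<in> T" unfolding T_def using ts by (intro image_eqI[of _ _ 0]) auto
    have Tinj: "inj_on B T"
      using inj unfolding T_def f_def by (auto simp: inj_on_def)
    have BT: "B ` T = f ` ball 0 t" by (simp add: T_def f_def image_comp)
    have near: "ball u \<epsilon> \<subseteq> ball (B z) s"
    proof
      fix y assume "y \<in> ball u \<epsilon>"
      thus "y \<in> ball (B z) s"
        using Bz \<epsilon> dist_triangle[of "B z" y u] by (simp add: dist_commute)
    qed
    define V where "V = T \<inter> B -` ball u \<epsilon>"
    have "open V"
      unfolding V_def using \<open>open T\<close> TD B(1)
      by (intro continuous_open_preimage holomorphic_on_imp_continuous_on[OF holomorphic_on_subset[OF B(1) TD]]) auto
    moreover have "B ` V = ball u \<epsilon>"
    proof -
      have "ball u \<epsilon> \<subseteq> B ` T" using near cov BT by blast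
      thus ?thesis unfolding V_def by blast
    qed
    moreover have "inj_on B V" using Tinj by (rule inj_on_subset) (auto simp: V_def)
    ultimately show "\<exists>V. open V \<and> z \<in> V \<and> V \<subseteq> ball 0 1 \<and> inj_on B V \<and> B ` V = ball u \<epsilon>"
      using \<open>z \<in> T\<close> TD Bz by (intro exI[of _ V]) (auto simp: V_def)
  qed
qed

text \<open>
  Two lifts that meet at a point where \<open>B\<close> is injective agree nearby, hence everywhere by the
  identity theorem.
\<close>

lemma holomorphic_sections_agree:
  assumes "B holomorphic_on D" "open V" "V \<subseteq> D" "inj_on B V"
    and U: "open U" "connected U"
    and s: "\<sigma> holomorphic_on U" "\<tau> holomorphic_on U" "\<sigma> ` U \<subseteq> D" "\<tau> ` U \<subseteq> D"
    and B: "\<And>u. u \<in> U \<Longrightarrow> B (\<sigma> u) = B (\<tau> u)"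
    and p: "p \<in> U" "\<sigma> p = \<tau> p" "\<sigma> p \<in> V" and u: "u \<in> U"
  shows "\<sigma> u = \<tau> u"
proof -
  define U' where "U' = (U \<inter> \<sigma> -` V) \<inter> (U \<inter> \<tau> -` V)"
  have "open U'"
    unfolding U'_def using assms
    by (intro open_Int continuous_open_preimage holomorphic_on_imp_continuous_on)
  moreover have "p \<in> U'" using p by (auto simp: U'_def)
  ultimately have "p islimpt U'" by (simp add: interior_limit_point interior_open)
  have "\<sigma> u - \<tau> u = 0"
  proof (rule analytic_continuation[of "\<lambda>u. \<sigma> u - \<tau> u" U U' p])
    show "(\<lambda>u. \<sigma> u - \<tau> u) holomorphic_on U" by (intro holomorphic_intros s)
    fix x assume "x \<in> U'"
    thus "\<sigma> x - \<tau> x = 0" using B[of x] assms(4) by (auto simp: U'_def inj_on_def)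
  qed (use U p u \<open>p islimpt U'\<close> in \<open>auto simp: U'_def\<close>)
  thus ?thesis by simp
qed

text \<open>
  Over a small disc the sheets are all open sets that \<open>B\<close> maps bijectively onto it; uniform
  sections provide one through every point above the disc, and two of them that meet coincide.
\<close>

theorem thin_blaschke_covering_space:
  assumes thin: "thin_blaschke_product B"
  defines "C \<equiv> {z \<in> ball 0 1. B z \<notin> critical_values B}"
  shows "covering_space C B (B ` C)"
  unfolding covering_space_def
proof (intro conjI ballI)
  note B = thin_blaschke_holomorphic[OF thin]
  have CD: "C \<subseteq> ball 0 1" by (auto simp: C_def)
  show "continuous_on C B"
    by (intro holomorphic_on_imp_continuous_on holomorphic_on_subset[OF B(1) CD])
  show "B ` C = B ` C" ..
  fix u assume "u \<in> B ` C"
  then obtain z0 where z0: "z0 \<in> C" "u = B z0" by blast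
  hence u: "cmod u < 1" "u \<notin> critical_values B" using B(2)[of z0] by (auto simp: C_def)
  obtain \<epsilon> where \<epsilon>: "0 < \<epsilon>" "ball u \<epsilon> \<inter> critical_values B = {}"
    and sec: "\<And>z. z \<in> ball 0 1 \<Longrightarrow> B z \<in> ball u \<epsilon> \<Longrightarrow>
       \<exists>V. open V \<and> z \<in> V \<and> V \<subseteq> ball 0 1 \<and> inj_on B V \<and> B ` V = ball u \<epsilon>"
    using thin_blaschke_uniform_sections[OF thin u] by blast
  define \<V> where "\<V> = {V. open V \<and> V \<subseteq> ball 0 1 \<and> inj_on B V \<and> B ` V = ball u \<epsilon>}"
  have VC: "V \<subseteq> C" if "V \<in> \<V>" for V using that \<epsilon> by (auto simp: \<V>_def C_def)
  have sub: "ball u \<epsilon> \<subseteq> B ` C"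
  proof -
    have "z0 \<in> ball 0 1" "B z0 \<in> ball u \<epsilon>" using z0 \<epsilon> CD by auto
    then obtain V where "V \<in> \<V>" using sec[of z0] by (auto simp: \<V>_def)
    hence "V \<subseteq> C" "B ` V = ball u \<epsilon>" using VC by (auto simp: \<V>_def)
    thus ?thesis by (metis image_mono)
  qed
  have inverse_on: "\<exists>\<sigma>. \<sigma> holomorphic_on ball u \<epsilon> \<and> (\<forall>z\<in>V. \<sigma> (B z) = z) \<and> (\<forall>w\<in>ball u \<epsilon>. \<sigma> w \<in> V \<and> B (\<sigma> w) = w)"
    if "V \<in> \<V>" for V
  proof -
    have V: "open V" "V \<subseteq> ball 0 1" "inj_on B V" "B ` V = ball u \<epsilon>" using that by (auto simp: \<V>_def)
    obtain \<sigma> where \<sigma>: "\<sigma> holomorphic_on ball u \<epsilon>" "\<And>z. z \<in> V \<Longrightarrow> \<sigma> (B z) = z"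
      using holomorphic_has_inverse[OF holomorphic_on_subset[OF B(1) V(2)] V(1,3)] V(4) by metis
    moreover have "\<sigma> w \<in> V \<and> B (\<sigma> w) = w" if "w \<in> ball u \<epsilon>" for w
      using that \<sigma>(2) V(4) by (metis imageE)
    ultimately show ?thesis by blast
  qed
  have same: "V \<subseteq> V'" if V: "V \<in> \<V>" "V' \<in> \<V>" and p: "p \<in> V" "p \<in> V'" for V V' p
  proof -
    obtain \<sigma> \<tau> where \<sigma>: "\<sigma> holomorphic_on ball u \<epsilon>" "\<And>z. z \<in> V \<Longrightarrow> \<sigma> (B z) = z"
        "\<And>w. w \<in> ball u \<epsilon> \<Longrightarrow> \<sigma> w \<in> V \<and> B (\<sigma> w) = w"
      and \<tau>: "\<tau> holomorphic_on ball u \<epsilon>" "\<And>z. z \<in> V' \<Longrightarrow> \<tau> (B z) = z"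
        "\<And>w. w \<in> ball u \<epsilon> \<Longrightarrow> \<tau> w \<in> V' \<and> B (\<tau> w) = w"
      using inverse_on[OF V(1)] inverse_on[OF V(2)] by metis
    note \<sigma>V = \<sigma>(3) and \<tau>V = \<tau>(3)
    have BV: "B ` V = ball u \<epsilon>" "B ` V' = ball u \<epsilon>" using V by (auto simp: \<V>_def)
    have Bp: "B p \<in> ball u \<epsilon>" using BV p by blast
    have eq: "\<sigma> w = \<tau> w" if "w \<in> ball u \<epsilon>" for w
    proof (rule holomorphic_sections_agree[OF B(1), of V "ball u \<epsilon>" \<sigma> \<tau> "B p"])
      show "\<sigma> ` ball u \<epsilon> \<subseteq> ball 0 1" "\<tau> ` ball u \<epsilon> \<subseteq> ball 0 1"
        using \<sigma>V \<tau>V V by (auto simp: \<V>_def)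
    qed (use V \<sigma> \<tau> \<sigma>V \<tau>V p Bp that in \<open>auto simp: \<V>_def\<close>)
    show "V \<subseteq> V'"
    proof
      fix x assume "x \<in> V"
      hence "\<tau> (B x) = x" using eq[of "B x"] \<sigma>(2)[of x] BV(1) by force
      thus "x \<in> V'" using \<tau>V[of "B x"] BV(1) \<open>x \<in> V\<close> by force
    qed
  qed
  show "\<exists>T. u \<in> T \<and> openin (top_of_set (B ` C)) T \<and>
          (\<exists>v. \<Union>v = C \<inter> B -` T \<and> (\<forall>u\<in>v. openin (top_of_set C) u) \<and> pairwise disjnt v \<and>
               (\<forall>u\<in>v. \<exists>q. homeomorphism u T B q))"
  proof (intro exI[of _ "ball u \<epsilon>"] exI[of _ "\<V>"] conjI ballI)
    show "u \<in> ball u \<epsilon>" using \<epsilon> by simp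
    show "openin (top_of_set (B ` C)) (ball u \<epsilon>)" using sub by (intro open_subset) auto
    show "\<Union>\<V> = C \<inter> B -` ball u \<epsilon>"
    proof
      show "\<Union>\<V> \<subseteq> C \<inter> B -` ball u \<epsilon>" using VC by (auto simp: \<V>_def)
      show "C \<inter> B -` ball u \<epsilon> \<subseteq> \<Union>\<V>"
      proof
        fix z assume "z \<in> C \<inter> B -` ball u \<epsilon>"
        then obtain V where "open V \<and> z \<in> V \<and> V \<subseteq> ball 0 1 \<and> inj_on B V \<and> B ` V = ball u \<epsilon>"
          using sec[of z] CD by blast
        thus "z \<in> \<Union>\<V>" by (auto simp: \<V>_def)
      qed
    qed
    show "openin (top_of_set C) V" if "V \<in> \<V>" for V
      using that VC by (intro open_subset) (auto simp: \<V>_def)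
    show "pairwise disjnt \<V>"
      using same by (auto simp: pairwise_def disjnt_iff)
    show "\<exists>q. homeomorphism V (ball u \<epsilon>) B q" if V: "V \<in> \<V>" for V
    proof -
      obtain \<sigma> where \<sigma>: "\<sigma> holomorphic_on ball u \<epsilon>" "\<And>z. z \<in> V \<Longrightarrow> \<sigma> (B z) = z"
        "\<And>w. w \<in> ball u \<epsilon> \<Longrightarrow> \<sigma> w \<in> V \<and> B (\<sigma> w) = w"
        using inverse_on[OF V] by metis
      have "homeomorphism V (ball u \<epsilon>) B \<sigma>"
      proof (rule homeomorphismI)
        show "continuous_on V B" "continuous_on (ball u \<epsilon>) \<sigma>"
          using \<sigma>(1) VC[OF V] CD by (auto intro!: holomorphic_on_imp_continuous_on holomorphic_on_subset[OF B(1)])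
      qed (use \<sigma> V in \<open>auto simp: \<V>_def\<close>)
      thus ?thesis by blast
    qed
  qed
qed

section \<open>The fibres of a thin Blaschke product\<close>

lemma deriv_nonzero_of_noncritical_value:
  assumes "z \<in> ball 0 1" "B z \<notin> critical_values B"
  shows "deriv B z \<noteq> 0"
  using assms unfolding critical_values_def by blast

lemma continuous_lift_holomorphic:
  assumes B: "B holomorphic_on D" "open D" and G: "open G" and f: "f holomorphic_on G"
    and \<sigma>: "continuous_on G \<sigma>" "\<sigma> ` G \<subseteq> D" and lift: "\<And>w. w \<in> G \<Longrightarrow> B (\<sigma> w) = f w"
    and nc: "\<And>w. w \<in> G \<Longrightarrow> deriv B (\<sigma> w) \<noteq> 0"
  shows "\<sigma> holomorphic_on G"
  unfolding holomorphic_on_def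
proof (rule ballI, rule field_differentiable_at_within)
  fix w assume w: "w \<in> G"
  then obtain r where r: "0 < r" "ball (\<sigma> w) r \<subseteq> D" "inj_on B (ball (\<sigma> w) r)"
    using has_complex_derivative_locally_injective[OF B(1) _ B(2) nc[OF w]] \<sigma>(2) w by blast
  have Bhol: "B holomorphic_on ball (\<sigma> w) r" using B(1) r(2) by (rule holomorphic_on_subset)
  obtain \<tau> where \<tau>: "\<tau> holomorphic_on B ` ball (\<sigma> w) r" "\<And>z. z \<in> ball (\<sigma> w) r \<Longrightarrow> \<tau> (B z) = z"
    using holomorphic_has_inverse[OF Bhol open_ball r(3)] by metis
  have opB: "open (B ` ball (\<sigma> w) r)"
    using open_mapping_thm3[OF Bhol open_ball r(3)] by blast
  define N where "N = G \<inter> \<sigma> -` ball (\<sigma> w) r"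
  have N: "open N" "w \<in> N" using \<sigma>(1) G w r by (auto simp: N_def intro!: continuous_open_preimage)
  have fN: "f ` N \<subseteq> B ` ball (\<sigma> w) r" using lift by (force simp: N_def)
  have "(\<tau> \<circ> f) holomorphic_on N"
    by (rule holomorphic_on_compose_gen[OF holomorphic_on_subset[OF f] \<tau>(1) fN]) (auto simp: N_def)
  moreover have "(\<tau> \<circ> f) x = \<sigma> x" if "x \<in> N" for x
    using that \<tau>(2)[of "\<sigma> x"] lift[of x] by (auto simp: N_def)
  ultimately have "\<sigma> holomorphic_on N" by (rule holomorphic_transform)
  thus "\<sigma> field_differentiable at w" using N holomorphic_on_imp_differentiable_at by blast
qed

locale thin_blaschke_local_inverses =
  fixes B :: "complex \<Rightarrow> complex" and L :: "complex set" and \<rho> :: "nat \<Rightarrow> complex \<Rightarrow> complex"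
  assumes thin: "thin_blaschke_product B"
    and L_closed: "closedin (top_of_set unit_disc) L"
    and L_crit: "{z \<in> unit_disc. B z \<in> critical_values B} \<subseteq> L"
    and L_conn: "connected (unit_disc - L)"
    and L_simply: "simply_connected (unit_disc - L)"
    and rho: "enumerates_local_inverses B (unit_disc - L) \<rho>"
begin

definition G :: "complex set" where "G = unit_disc - L"

lemma open_G: "open G"
proof -
  have "openin (top_of_set unit_disc) (unit_disc - L)"
    using L_closed by (rule openin_diff[OF openin_subtopology_self])
  thus ?thesis unfolding G_def by (simp add: openin_open_eq)
qed

lemma connected_G: "connected G" and G_subset: "G \<subseteq> ball 0 1"
  using L_conn by (auto simp: G_def)

lemma B_holomorphic: "B holomorphic_on ball 0 1" and norm_B_less_1: "z \<in> ball 0 1 \<Longrightarrow> cmod (B z) < 1"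
  using thin_blaschke_holomorphic[OF thin] by auto

lemma noncritical: "w \<in> G \<Longrightarrow> z \<in> ball 0 1 \<Longrightarrow> B z = B w \<Longrightarrow> deriv B z \<noteq> 0"
  using L_crit deriv_nonzero_of_noncritical_value[of z B] by (auto simp: G_def)

text \<open>
  On an empty set all local inverses agree, which contradicts an enumeration by all natural
  numbers without repetition.
\<close>

lemma G_nonempty: "\<exists>w. w \<in> G"
proof (rule ccontr)
  assume "\<not> ?thesis"
  hence "\<forall>z\<in>unit_disc - L. \<rho> 0 z = \<rho> 1 z" by (auto simp: G_def)
  hence "(0::nat) = 1" using rho unfolding enumerates_local_inverses_def by blast
  thus False by simp
qed

lemma rho_holomorphic: "\<rho> k holomorphic_on G"
  and rho_in_disc: "w \<in> G \<Longrightarrow> \<rho> k w \<in> ball 0 1"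
  and B_rho: "w \<in> G \<Longrightarrow> B (\<rho> k w) = B w"
  and rho_0: "w \<in> G \<Longrightarrow> \<rho> 0 w = w"
proof -
  have "local_inverse B G (\<rho> k)"
    using rho by (simp add: enumerates_local_inverses_def G_def)
  thus "\<rho> k holomorphic_on G" "w \<in> G \<Longrightarrow> \<rho> k w \<in> ball 0 1" "w \<in> G \<Longrightarrow> B (\<rho> k w) = B w"
    by (auto simp: local_inverse_def)
  show "w \<in> G \<Longrightarrow> \<rho> 0 w = w"
    using rho by (simp add: enumerates_local_inverses_def G_def)
qed

lemma rho_distinct:
  assumes w: "w \<in> G" and eq: "\<rho> j w = \<rho> k w"
  shows "j = k"
proof -
  have "deriv B (\<rho> j w) \<noteq> 0" using noncritical[OF w rho_in_disc[OF w] B_rho[OF w]] .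
  then obtain r where r: "0 < r" "ball (\<rho> j w) r \<subseteq> ball 0 1" "inj_on B (ball (\<rho> j w) r)"
    using has_complex_derivative_locally_injective[OF B_holomorphic rho_in_disc[OF w] open_ball] by blast
  have "\<rho> j z = \<rho> k z" if z: "z \<in> G" for z
    by (rule holomorphic_sections_agree[OF B_holomorphic open_ball r(2,3) open_G connected_G
              rho_holomorphic rho_holomorphic _ _ _ w eq _ z])
       (use rho_in_disc B_rho r in auto)
  thus ?thesis using rho by (auto simp: enumerates_local_inverses_def G_def)
qed

text \<open>
  Every point of the fibre is reached by lifting the restriction of \<open>B\<close> to the simply connected
  \<open>G\<close> through the covering, and such a lift is a local inverse.
\<close>

lemma rho_surj_fibre:
  assumes w: "w \<in> G" and z: "z \<in> ball 0 1" "B z = B w"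
  shows "\<exists>k. \<rho> k w = z"
proof -
  define C where "C = {z \<in> ball 0 1. B z \<notin> critical_values B}"
  have cov: "covering_space C B (B ` C)"
    unfolding C_def by (rule thin_blaschke_covering_space[OF thin])
  have GC: "G \<subseteq> C" using L_crit by (auto simp: G_def C_def)
  have zC: "z \<in> C" using z w GC by (auto simp: C_def)
  obtain \<sigma> where \<sigma>: "continuous_on G \<sigma>" "\<sigma> \<in> G \<rightarrow> C" "\<sigma> w = z" "\<And>y. y \<in> G \<Longrightarrow> B (\<sigma> y) = B y"
  proof (rule covering_space_lift_strong[OF cov zC w])
    show "simply_connected G" using L_simply by (simp add: G_def)
    show "locally path_connected G" using open_G by (rule open_imp_locally_path_connected)
    show "continuous_on G B"
      using G_subset by (intro holomorphic_on_imp_continuous_on holomorphic_on_subset[OF B_holomorphic])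
    show "B \<in> G \<rightarrow> B ` C" using GC by auto
  qed (use z in auto)
  have \<sigma>D: "\<sigma> ` G \<subseteq> ball 0 1" using \<sigma>(2) by (auto simp: C_def Pi_iff)
  have "\<sigma> holomorphic_on G"
    by (rule continuous_lift_holomorphic[OF B_holomorphic open_ball open_G
              holomorphic_on_subset[OF B_holomorphic G_subset] \<sigma>(1) \<sigma>D \<sigma>(4)])
       (use noncritical \<sigma>(4) \<sigma>D in auto)
  hence "local_inverse B G \<sigma>" using \<sigma>D \<sigma>(4) by (simp add: local_inverse_def)
  then obtain k where "\<forall>z\<in>G. \<rho> k z = \<sigma> z"
    using rho unfolding enumerates_local_inverses_def G_def by blast
  thus ?thesis using w \<sigma>(3) by auto
qed

lemma deriv_rho_nonzero:
  assumes w: "w \<in> G"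
  shows "deriv (\<rho> k) w \<noteq> 0"
proof
  assume 0: "deriv (\<rho> k) w = 0"
  have "deriv (B \<circ> \<rho> k) w = deriv B (\<rho> k w) * deriv (\<rho> k) w"
    using w rho_holomorphic[of k] open_G rho_in_disc[OF w] B_holomorphic
    by (intro deriv_chain holomorphic_on_imp_differentiable_at[of "\<rho> k" G]
          holomorphic_on_imp_differentiable_at[of B "ball 0 1"]) auto
  moreover have "deriv (B \<circ> \<rho> k) w = deriv B w"
  proof (rule deriv_cong_ev[OF _ refl])
    have "eventually (\<lambda>x. x \<in> G) (nhds w)" using open_G w by (intro eventually_nhds_in_open)
    thus "eventually (\<lambda>x. (B \<circ> \<rho> k) x = B x) (nhds w)" by eventually_elim (simp add: B_rho)
  qed
  ultimately have "deriv B w = 0" using 0 by simp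
  thus False using noncritical[OF w, of w] w G_subset by auto
qed

lemma good_disc:
  assumes w: "w \<in> G"
  obtains R where "0 < R" "ball w R \<subseteq> G" "inj_on B (ball w R)"
proof -
  have "deriv B w \<noteq> 0" using noncritical[OF w, of w] w G_subset by auto
  from has_complex_derivative_locally_injective[OF holomorphic_on_subset[OF B_holomorphic G_subset] w open_G this]
  show ?thesis using that by blast
qed

lemma deriv_rho_0: "w \<in> G \<Longrightarrow> deriv (\<rho> 0) w = 1"
proof -
  assume w: "w \<in> G"
  have "deriv (\<rho> 0) w = deriv (\<lambda>x. x) w"
  proof (rule deriv_cong_ev[OF _ refl])
    have "eventually (\<lambda>x. x \<in> G) (nhds w)" using open_G w by (intro eventually_nhds_in_open)
    thus "eventually (\<lambda>x. \<rho> 0 x = x) (nhds w)" by eventually_elim (simp add: rho_0)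
  qed
  thus ?thesis by simp
qed

text \<open>
  Distinct \<open>\<rho> k\<close> take distinct values at every point, points with different values of \<open>B\<close> lie in
  different fibres, and the \<open>\<rho> k\<close> exhaust each fibre.
\<close>

lemma sheets:
  assumes V: "V \<subseteq> G" "inj_on B V"
  shows "inj_on (\<rho> k) V"
    and "j \<noteq> k \<Longrightarrow> \<rho> j ` V \<inter> \<rho> k ` V = {}"
    and "(\<Union>k. \<rho> k ` V) = {z \<in> ball 0 1. B z \<in> B ` V}"
proof -
  have eq: "x = y \<and> j = k" if "x \<in> V" "y \<in> V" "\<rho> j x = \<rho> k y" for x y j k
  proof -
    have "B x = B y" using that V B_rho by (metis subsetD)
    hence "x = y" using that V by (auto dest: inj_onD)
    thus ?thesis using that V rho_distinct by auto
  qed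
  show "inj_on (\<rho> k) V" using eq by (auto intro: inj_onI)
  show "\<rho> j ` V \<inter> \<rho> k ` V = {}" if "j \<noteq> k" using eq that by blast
  show "(\<Union>k. \<rho> k ` V) = {z \<in> ball 0 1. B z \<in> B ` V}"
  proof
    show "(\<Union>k. \<rho> k ` V) \<subseteq> {z \<in> ball 0 1. B z \<in> B ` V}"
      using V rho_in_disc B_rho by (fastforce simp: image_iff)
    show "{z \<in> ball 0 1. B z \<in> B ` V} \<subseteq> (\<Union>k. \<rho> k ` V)"
    proof
      fix z assume "z \<in> {z \<in> ball 0 1. B z \<in> B ` V}"
      then obtain v where v: "v \<in> V" "B z = B v" "z \<in> ball 0 1" by auto
      then obtain k where "\<rho> k v = z" using rho_surj_fibre[of v z] V by auto
      thus "z \<in> (\<Union>k. \<rho> k ` V)" using v by auto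
    qed
  qed
qed

end

section \<open>Integrals over the disc\<close>

lemma set_integral_countable_sums:
  fixes f :: "'a \<Rightarrow> 'b :: {banach, second_countable_topology}"
  assumes A: "\<And>i::nat. A i \<in> sets M" and disj: "\<And>i j. i \<noteq> j \<Longrightarrow> A i \<inter> A j = {}"
    and int: "set_integrable M (\<Union>i. A i) f"
  shows "(\<lambda>i. LINT x:A i|M. f x) sums (LINT x:(\<Union>i. A i)|M. f x)"
proof -
  define F where "F = (\<lambda>i x. indicator (A i) x *\<^sub>R f x)"
  have F: "integrable M (F i)" for i
    unfolding F_def set_integrable_def[symmetric] using A by (intro set_integrable_subset[OF int]) auto
  have fin: "finite {i. x \<in> A i}" for x
  proof (cases "\<exists>i. x \<in> A i")
    case True
    then obtain i where "x \<in> A i" by blast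
    hence "{i. x \<in> A i} \<subseteq> {i}" using disj by blast
    thus ?thesis by (rule finite_subset) simp
  qed auto
  have nsum: "(\<Sum>i<n. norm (F i x)) \<le> norm (indicator (\<Union>i. A i) x *\<^sub>R f x)" for n x
  proof (cases "\<exists>i. x \<in> A i")
    case True
    then obtain i where i: "x \<in> A i" by blast
    have "F j x = 0" if "j \<noteq> i" for j using disj[OF that] i by (auto simp: F_def indicator_def)
    hence "(\<Sum>j<n. norm (F j x)) = (\<Sum>j<n. if j = i then norm (F i x) else 0)"
      by (intro sum.cong) auto
    also have "\<dots> \<le> norm (F i x)" by simp
    also have "\<dots> \<le> norm (indicator (\<Union>i. A i) x *\<^sub>R f x)"
      using i by (auto simp: F_def indicator_def)
    finally show ?thesis .
  next
    case False
    thus ?thesis by (simp add: F_def)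
  qed
  have "(\<lambda>i. integral\<^sup>L M (F i)) sums (\<integral>x. (\<Sum>i. F i x) \<partial>M)"
  proof (rule sums_integral[OF F])
    show "AE x in M. summable (\<lambda>i. norm (F i x))"
    proof (rule AE_I2)
      fix x
      show "summable (\<lambda>i. norm (F i x))"
        by (rule summable_finite[OF fin[of x]]) (simp add: F_def)
    qed
    show "summable (\<lambda>i. \<integral>x. norm (F i x) \<partial>M)"
    proof (rule summableI_nonneg_bounded)
      fix n
      have "(\<Sum>i<n. \<integral>x. norm (F i x) \<partial>M) = (\<integral>x. (\<Sum>i<n. norm (F i x)) \<partial>M)"
        using F by (intro Bochner_Integration.integral_sum[symmetric] integrable_norm)
      also have "\<dots> \<le> (\<integral>x. norm (indicator (\<Union>i. A i) x *\<^sub>R f x) \<partial>M)"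
        using int F nsum unfolding set_integrable_def
        by (intro integral_mono Bochner_Integration.integrable_sum integrable_norm) auto
      finally show "(\<Sum>i<n. \<integral>x. norm (F i x) \<partial>M) \<le> (\<integral>x. norm (indicator (\<Union>i. A i) x *\<^sub>R f x) \<partial>M)" .
    qed auto
  qed
  also have "(\<integral>x. (\<Sum>i. F i x) \<partial>M) = (LINT x:(\<Union>i. A i)|M. f x)"
    unfolding set_lebesgue_integral_def
  proof (rule Bochner_Integration.integral_cong[OF refl])
    fix x
    show "(\<Sum>i. F i x) = indicator (\<Union>i. A i) x *\<^sub>R f x"
    proof (cases "\<exists>i. x \<in> A i")
      case True
      then obtain i where i: "x \<in> A i" by blast
      have "F j x = 0" if "j \<notin> {i}" for j using disj[of j i] that i by (auto simp: F_def indicator_def)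
      hence "(\<Sum>i. F i x) = (\<Sum>j\<in>{i}. F j x)" by (intro suminf_finite) auto
      moreover have "x \<in> (\<Union>i. A i)" using i by blast
      ultimately show ?thesis using i by (simp add: F_def)
    qed (simp add: F_def)
  qed
  finally show ?thesis by (simp add: F_def set_lebesgue_integral_def)
qed

lemma continuous_on_open_set_borel_measurable:
  fixes f :: "complex \<Rightarrow> 'b :: real_normed_vector"
  shows "open S \<Longrightarrow> continuous_on S f \<Longrightarrow> set_borel_measurable borel S f"
  unfolding set_borel_measurable_def by (intro borel_measurable_continuous_on_indicator) auto

lemma set_integrable_bound_continuous:
  fixes f :: "complex \<Rightarrow> 'b :: {banach, second_countable_topology}"
  assumes S: "open S" and g: "set_integrable lborel S g" and f: "continuous_on S f"
    and le: "\<And>z. z \<in> S \<Longrightarrow> norm (f z) \<le> g z"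
  shows "set_integrable lborel S f"
  unfolding set_integrable_def
proof (rule Bochner_Integration.integrable_bound[OF g[unfolded set_integrable_def]])
  show "(\<lambda>z. indicat_real S z *\<^sub>R f z) \<in> borel_measurable lborel"
    using continuous_on_open_set_borel_measurable[OF S f] by (simp add: set_borel_measurable_def)
  show "AE z in lborel. norm (indicat_real S z *\<^sub>R f z) \<le> norm (indicat_real S z *\<^sub>R g z)"
    using le by (intro AE_I2) (force simp: indicator_def)
qed

lemma set_integrable_bounded_mult:
  fixes f g :: "complex \<Rightarrow> complex"
  assumes S: "open S" and f: "set_integrable lborel S f" "continuous_on S f"
    and g: "continuous_on S g" "\<And>z. z \<in> S \<Longrightarrow> cmod (g z) \<le> C"
  shows "set_integrable lborel S (\<lambda>z. g z * f z)"
proof (rule set_integrable_bound_continuous[OF S])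
  show "set_integrable lborel S (\<lambda>z. C * cmod (f z))"
    using set_integrable_norm[OF f(1)] by simp
  show "cmod (g z * f z) \<le> C * cmod (f z)" if "z \<in> S" for z
    unfolding norm_mult using g(2)[OF that] by (rule mult_right_mono) simp
qed (intro continuous_intros f g)

text \<open>
  The functional \<open>\<xi> \<mapsto> \<integral> \<xi>(B) f\<close> kills all monomials in \<open>u\<close> and \<open>cnj u\<close>, hence all real
  polynomial functions: multiplication by one of these preserves the set \<open>Mom\<close> of functions
  whose products with all monomials are killed. By the Stone-Weierstrass theorem they are dense
  in the continuous functions on the closed disc.
\<close>

lemma vanishing_moments_imp_zero:
  fixes f B :: "complex \<Rightarrow> complex" and \<phi> :: "complex \<Rightarrow> real"
  assumes f: "set_integrable lborel (ball 0 1) f" "continuous_on (ball 0 1) f"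
    and B: "continuous_on (ball 0 1) B" "\<And>z. z \<in> ball 0 1 \<Longrightarrow> cmod (B z) \<le> 1"
    and moments: "\<And>m n. (LINT z:ball 0 1|lborel. B z ^ m * cnj (B z) ^ n * f z) = 0"
    and \<phi>: "continuous_on UNIV \<phi>"
  shows "(LINT z:ball 0 1|lborel. of_real (\<phi> (B z)) * f z) = 0"
proof -
  define J where "J = (\<lambda>(\<xi> :: complex \<Rightarrow> complex). LINT z:ball 0 1|lborel. \<xi> (B z) * f z)"
  have bdd: "\<exists>C. \<forall>z\<in>ball 0 1. cmod (\<xi> (B z)) \<le> C" if "continuous_on UNIV \<xi>" for \<xi> :: "complex \<Rightarrow> complex"
  proof -
    have "compact (\<xi> ` cball 0 1)"
      by (rule compact_continuous_image[OF continuous_on_subset[OF that]]) auto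
    hence "bounded (\<xi> ` cball 0 1)" by (rule compact_imp_bounded)
    then obtain C where "\<forall>x\<in>cball 0 1. cmod (\<xi> x) \<le> C"
      by (auto simp: bounded_iff)
    thus ?thesis using B(2) by (intro exI[of _ C]) auto
  qed
  have int: "set_integrable lborel (ball 0 1) (\<lambda>z. \<xi> (B z) * f z)" if \<xi>: "continuous_on UNIV \<xi>" for \<xi>
  proof -
    obtain C where "\<forall>z\<in>ball 0 1. cmod (\<xi> (B z)) \<le> C" using bdd[OF \<xi>] by blast
    thus ?thesis
      by (intro set_integrable_bounded_mult[OF open_ball f, where C = C] continuous_on_compose2[OF \<xi> B(1)]) auto
  qed
  have J_add: "J (\<lambda>u. \<xi> u + \<psi> u) = J \<xi> + J \<psi>" if "continuous_on UNIV \<xi>" "continuous_on UNIV \<psi>" for \<xi> \<psi>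
    using set_integral_add(2)[OF int[OF that(1)] int[OF that(2)]] by (simp add: J_def ring_distribs)
  have J_scale: "J (\<lambda>u. c * \<xi> u) = c * J \<xi>" for c \<xi>
    by (simp add: J_def mult.assoc)
  define Mom where "Mom = (\<lambda>\<xi>. \<forall>m n. J (\<lambda>u. \<xi> u * (u ^ m * cnj u ^ n)) = 0)"
  have Mom_add: "Mom (\<lambda>u. \<xi> u + \<psi> u)" if "continuous_on UNIV \<xi>" "continuous_on UNIV \<psi>" "Mom \<xi>" "Mom \<psi>" for \<xi> \<psi>
    unfolding Mom_def
  proof (intro allI)
    fix m n
    have "J (\<lambda>u. \<xi> u * (u ^ m * cnj u ^ n) + \<psi> u * (u ^ m * cnj u ^ n)) = 0"
      using that unfolding Mom_def by (subst J_add) (auto intro!: continuous_intros)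
    thus "J (\<lambda>u. (\<xi> u + \<psi> u) * (u ^ m * cnj u ^ n)) = 0" by (simp add: ring_distribs)
  qed
  have Mom_scale: "Mom (\<lambda>u. c * \<xi> u)" if "Mom \<xi>" for c \<xi>
    using that by (simp add: Mom_def J_scale mult.assoc)
  have Mom_u: "Mom (\<lambda>u. u * \<xi> u)" if "Mom \<xi>" for \<xi>
    unfolding Mom_def
  proof (intro allI)
    fix m n
    have "J (\<lambda>u. \<xi> u * (u ^ Suc m * cnj u ^ n)) = 0" using that unfolding Mom_def by blast
    thus "J (\<lambda>u. u * \<xi> u * (u ^ m * cnj u ^ n)) = 0" by (simp add: mult_ac)
  qed
  have Mom_cnj: "Mom (\<lambda>u. cnj u * \<xi> u)" if "Mom \<xi>" for \<xi>
    unfolding Mom_def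
  proof (intro allI)
    fix m n
    have "J (\<lambda>u. \<xi> u * (u ^ m * cnj u ^ Suc n)) = 0" using that unfolding Mom_def by blast
    thus "J (\<lambda>u. cnj u * \<xi> u * (u ^ m * cnj u ^ n)) = 0" by (simp add: mult_ac)
  qed
  have poly: "continuous_on UNIV p \<and> (\<forall>\<xi>. continuous_on UNIV \<xi> \<longrightarrow> Mom \<xi> \<longrightarrow> Mom (\<lambda>u. of_real (p u) * \<xi> u))"
    if "real_polynomial_function p" for p :: "complex \<Rightarrow> real"
    using that
  proof (induction p rule: real_polynomial_function.induct)
    case (linear p)
    have cont: "continuous_on UNIV p" using linear by (rule linear_continuous_on)
    \<comment> \<open>A real linear functional is a complex combination of \<open>u\<close> and \<open>cnj u\<close>.\<close>
    define \<alpha> where "\<alpha> = Complex (p 1 / 2) (- p \<i> / 2)"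
    have p: "complex_of_real (p u) = \<alpha> * u + cnj \<alpha> * cnj u" for u
    proof -
      have "u = Re u *\<^sub>R 1 + Im u *\<^sub>R \<i>" by (simp add: complex_eq_iff)
      hence "p u = Re u * p 1 + Im u * p \<i>"
        using linear_simps(1,5)[OF linear] by (metis real_scaleR_def)
      thus ?thesis by (simp add: \<alpha>_def complex_eq_iff)
    qed
    have "Mom (\<lambda>u. of_real (p u) * \<xi> u)" if "continuous_on UNIV \<xi>" "Mom \<xi>" for \<xi>
    proof -
      have "Mom (\<lambda>u. \<alpha> * (u * \<xi> u) + cnj \<alpha> * (cnj u * \<xi> u))"
        using that by (intro Mom_add Mom_scale Mom_u Mom_cnj continuous_intros) auto
      thus ?thesis by (simp add: p algebra_simps)
    qed
    thus ?case using cont by blast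
  next
    case (const c)
    thus ?case using Mom_scale by auto
  next
    case (add p q)
    have "Mom (\<lambda>u. of_real (p u) * \<xi> u + of_real (q u) * \<xi> u)" if "continuous_on UNIV \<xi>" "Mom \<xi>" for \<xi>
      using that add by (intro Mom_add continuous_intros) auto
    thus ?case using add by (auto intro!: continuous_intros simp: ring_distribs)
  next
    case (mult p q)
    have "Mom (\<lambda>u. of_real (p u) * (of_real (q u) * \<xi> u))" if "continuous_on UNIV \<xi>" "Mom \<xi>" for \<xi>
    proof -
      have "continuous_on UNIV (\<lambda>u. complex_of_real (q u) * \<xi> u)"
        using mult that by (intro continuous_intros) auto
      thus ?thesis using mult that by blast
    qed
    thus ?case using mult by (auto intro!: continuous_intros simp: mult.assoc)
  qed
  have "Mom (\<lambda>u. 1)" using moments by (simp add: Mom_def J_def)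
  have Jp: "J (\<lambda>u. of_real (p u)) = 0" if "real_polynomial_function p" for p
  proof -
    have "Mom (\<lambda>u. of_real (p u) * 1)"
      using poly[OF that, THEN conjunct2, rule_format, of "\<lambda>u. 1"] \<open>Mom (\<lambda>u. 1)\<close> by simp
    hence "J (\<lambda>u. of_real (p u) * 1 * (u ^ 0 * cnj u ^ 0)) = 0" unfolding Mom_def by blast
    thus ?thesis by simp
  qed
  define I where "I = (LINT z:ball 0 1|lborel. cmod (f z))"
  have "cmod (J (\<lambda>u. of_real (\<phi> u))) \<le> e" if e: "0 < e" for e
  proof -
    have I0: "0 \<le> I" unfolding I_def set_lebesgue_integral_def by (intro integral_nonneg_AE) auto
    obtain p where p: "real_polynomial_function p" "\<And>x. x \<in> cball 0 1 \<Longrightarrow> \<bar>\<phi> x - p x\<bar> < e / (I + 1)"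
      using Stone_Weierstrass_real_polynomial_function[of "cball 0 1" \<phi> "e / (I + 1)"] \<phi> e I0
      by (auto intro: continuous_on_subset)
    have cont: "continuous_on UNIV (\<lambda>u. complex_of_real (\<phi> u - p u))"
      using poly[OF p(1)] \<phi> by (intro continuous_intros) auto
    have "J (\<lambda>u. of_real (\<phi> u)) = J (\<lambda>u. of_real (\<phi> u - p u) + of_real (p u))" by simp
    also have "\<dots> = J (\<lambda>u. of_real (\<phi> u - p u))"
      using poly[OF p(1)] cont Jp[OF p(1)] by (subst J_add) (auto intro!: continuous_intros)
    also have "cmod \<dots> \<le> (\<integral>z. cmod (indicat_real (ball 0 1) z *\<^sub>R (of_real (\<phi> (B z) - p (B z)) * f z)) \<partial>lborel)"
      unfolding J_def set_lebesgue_integral_def by (rule integral_norm_bound)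
    also have "\<dots> \<le> (\<integral>z. (e / (I + 1)) * (indicat_real (ball 0 1) z *\<^sub>R cmod (f z)) \<partial>lborel)"
    proof (rule integral_mono)
      show "integrable lborel (\<lambda>z. cmod (indicat_real (ball 0 1) z *\<^sub>R (of_real (\<phi> (B z) - p (B z)) * f z)))"
        using int[OF cont] unfolding set_integrable_def by (rule integrable_norm)
      show "integrable lborel (\<lambda>z. (e / (I + 1)) * (indicat_real (ball 0 1) z *\<^sub>R cmod (f z)))"
        using set_integrable_norm[OF f(1)] unfolding set_integrable_def by (intro integrable_mult_right)
      fix z
      have "\<bar>\<phi> (B z) - p (B z)\<bar> * cmod (f z) \<le> e / (I + 1) * cmod (f z)" if "z \<in> ball 0 1"
        using p(2)[of "B z"] B(2)[OF that] by (intro mult_right_mono) auto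
      thus "cmod (indicat_real (ball 0 1) z *\<^sub>R (of_real (\<phi> (B z) - p (B z)) * f z)) \<le> e / (I + 1) * (indicat_real (ball 0 1) z *\<^sub>R cmod (f z))"
        by (auto simp: indicator_def norm_mult simp flip: of_real_diff)
    qed
    also have "\<dots> = e / (I + 1) * I" by (simp add: I_def set_lebesgue_integral_def)
    also have "\<dots> \<le> e" using I0 e by (simp add: field_simps)
    finally show ?thesis .
  qed
  hence "cmod (J (\<lambda>u. of_real (\<phi> u))) \<le> 0" by (rule field_le_epsilon[of _ 0, simplified])
  thus ?thesis by (simp add: J_def)
qed

lemma norm_mult_cnj_le: "cmod (x * cnj y) \<le> (cmod x)\<^sup>2 + (cmod y)\<^sup>2"
proof -
  have "2 * (cmod x * cmod y) \<le> (cmod x)\<^sup>2 + (cmod y)\<^sup>2"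
    using sum_squares_bound[of "cmod x" "cmod y"] by simp
  moreover have "0 \<le> cmod x * cmod y" by simp
  ultimately show ?thesis unfolding norm_mult complex_mod_cnj by linarith
qed

lemma bergmanD:
  assumes "h \<in> bergman"
  shows "h holomorphic_on ball 0 1" "set_integrable lborel (ball 0 1) (\<lambda>z. (cmod (h z))\<^sup>2)"
    "z \<notin> ball 0 1 \<Longrightarrow> h z = 0"
  using assms by (auto simp: bergman_def)

lemma bergman_integrable_mult_cnj:
  assumes "h \<in> bergman" "g \<in> bergman"
  shows "set_integrable lborel (ball 0 1) (\<lambda>z. h z * cnj (g z))"
proof (rule set_integrable_bound_continuous[OF open_ball])
  show "set_integrable lborel (ball 0 1) (\<lambda>z. (cmod (h z))\<^sup>2 + (cmod (g z))\<^sup>2)"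
    by (intro set_integral_add(1) bergmanD(2) assms)
  show "continuous_on (ball 0 1) (\<lambda>z. h z * cnj (g z))"
    by (intro continuous_intros holomorphic_on_imp_continuous_on bergmanD(1) assms)
qed (rule norm_mult_cnj_le)

lemma bergman_mult_bounded:
  assumes h: "h \<in> bergman" and B: "B holomorphic_on ball 0 1" "\<And>z. z \<in> ball 0 1 \<Longrightarrow> cmod (B z) \<le> 1"
  shows "mult_op B h \<in> bergman"
proof -
  have hol: "(\<lambda>z. B z * h z) holomorphic_on ball 0 1" by (intro holomorphic_intros bergmanD(1)[OF h] B)
  have "set_integrable lborel (ball 0 1) (\<lambda>z. (cmod (B z * h z))\<^sup>2)"
  proof (rule set_integrable_bound_continuous[OF open_ball bergmanD(2)[OF h]])
    show "continuous_on (ball 0 1) (\<lambda>z. (cmod (B z * h z))\<^sup>2)"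
      by (intro continuous_on_power continuous_on_norm holomorphic_on_imp_continuous_on hol)
    show "norm ((cmod (B z * h z))\<^sup>2) \<le> (cmod (h z))\<^sup>2" if "z \<in> ball 0 1" for z
      using B(2)[OF that] by (simp add: norm_mult mult_left_le_one_le)
  qed
  thus ?thesis using hol bergmanD(3)[OF h] by (auto simp: bergman_def mult_op_def)
qed

lemma bounded_holomorphic_in_bergman:
  assumes h: "h holomorphic_on ball 0 1" and C: "\<And>z. z \<in> ball 0 1 \<Longrightarrow> cmod (h z) \<le> C"
  shows "(\<lambda>z. if z \<in> ball 0 1 then h z else 0) \<in> bergman" (is "?h \<in> _")
proof -
  have hol: "?h holomorphic_on ball 0 1" using h by (rule holomorphic_transform) auto
  have "set_integrable lborel (ball 0 1) (\<lambda>z. (cmod (?h z))\<^sup>2)"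
  proof (rule set_integrable_bound_continuous[OF open_ball])
    show "set_integrable lborel (ball 0 1 :: complex set) (\<lambda>z. C\<^sup>2)"
      unfolding set_integrable_def
      by (intro integrable_scaleR_left) (auto intro!: integrable_real_indicator emeasure_lborel_ball_finite)
    show "continuous_on (ball 0 1) (\<lambda>z. (cmod (?h z))\<^sup>2)"
      by (intro continuous_on_power continuous_on_norm holomorphic_on_imp_continuous_on hol)
    show "norm ((cmod (?h z))\<^sup>2) \<le> C\<^sup>2" if "z \<in> ball 0 1" for z
      using C[OF that] that by (simp add: power_mono)
  qed
  thus ?thesis using hol by (auto simp: bergman_def)
qed

section \<open>Polarization\<close>

lemma islimpt_0_of_real_interval:
  assumes "0 < r"
  shows "(0::complex) islimpt (of_real ` {-r<..<r})"
  unfolding islimpt_approachable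
proof (intro allI impI)
  fix e :: real assume "0 < e"
  define x where "x = min (e / 2) (r / 2)"
  have "0 < x" "x < e" "x < r" using assms \<open>0 < e\<close> by (auto simp: x_def min_def)
  thus "\<exists>y\<in>complex_of_real ` {-r<..<r}. y \<noteq> 0 \<and> dist y 0 < e"
    using assms by (intro bexI[of _ "of_real x"]) auto
qed

text \<open>
  In the coordinates \<open>a\<close> and \<open>b\<close> of the proof, \<open>K\<close> is holomorphic in each of them, and real \<open>a\<close>
  and \<open>b\<close> give points of the diagonal; two applications of the identity theorem in one variable
  give vanishing near a point of the diagonal, two more spread it over \<open>G\<close>.
\<close>

theorem sesquiholomorphic_zero_on_diagonal:
  fixes K :: "complex \<Rightarrow> complex \<Rightarrow> complex"
  assumes G: "open G" "connected G"
    and hol: "\<And>A f g. open A \<Longrightarrow> f holomorphic_on A \<Longrightarrow> g holomorphic_on A \<Longrightarrow> f ` A \<subseteq> G \<Longrightarrow> (\<lambda>x. cnj (g x)) ` A \<subseteq> G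
               \<Longrightarrow> (\<lambda>x. K (f x) (cnj (g x))) holomorphic_on A"
    and diag: "\<And>w. w \<in> G \<Longrightarrow> K w w = 0"
    and w: "w \<in> G" and v: "v \<in> G"
  shows "K w v = 0"
proof -
  obtain r where r: "0 < r" "ball w r \<subseteq> G" using G w open_contains_ball by blast
  define D where "D = ball (0::complex) (r / 2)"
  define x where "x = (\<lambda>a b. w + a + \<i> * b)"
  define y where "y = (\<lambda>a b. cnj w + a - \<i> * b)"
  have x_in: "x a b \<in> G" and y_in: "cnj (y a b) \<in> G" if "a \<in> D" "b \<in> D" for a b
  proof -
    have "cmod (a + \<i> * b) \<le> cmod a + cmod b" "cmod (a - \<i> * b) \<le> cmod a + cmod b"
      using norm_triangle_ineq[of a "\<i> * b"] norm_triangle_ineq4[of a "\<i> * b"] by (simp_all add: norm_mult)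
    moreover have "cmod (cnj (a - \<i> * b)) = cmod (a - \<i> * b)" by (rule complex_mod_cnj)
    moreover have "x a b - w = a + \<i> * b" "cnj (y a b) - w = cnj (a - \<i> * b)" by (simp_all add: x_def y_def)
    ultimately have "cmod (x a b - w) < r" "cmod (cnj (y a b) - w) < r" using that by (auto simp: D_def)
    thus "x a b \<in> G" "cnj (y a b) \<in> G" using r(2) by (auto simp: dist_norm norm_minus_commute)
  qed
  have D: "open D" "connected D" "0 \<in> D" using r by (auto simp: D_def)
  have reals: "complex_of_real ` {-(r/2)<..<r/2} \<subseteq> D" by (auto simp: D_def)
  have lim: "0 islimpt complex_of_real ` {-(r/2)<..<r/2}"
    using r by (intro islimpt_0_of_real_interval) auto
  have hol_a: "(\<lambda>a. K (x a b) (cnj (y a b))) holomorphic_on D" if "b \<in> D" for b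
    using x_in[OF _ that] y_in[OF _ that] D(1) by (intro hol) (auto simp: x_def y_def intro!: holomorphic_intros)
  have hol_b: "(\<lambda>b. K (x a b) (cnj (y a b))) holomorphic_on D" if "a \<in> D" for a
    using x_in[OF that] y_in[OF that] D(1) by (intro hol) (auto simp: x_def y_def intro!: holomorphic_intros)
  have 1: "K (x a b) (cnj (y a b)) = 0" if a: "a \<in> D" and b: "b \<in> complex_of_real ` {-(r/2)<..<r/2}" for a b
  proof -
    have bD: "b \<in> D" using b reals by blast
    show ?thesis
    proof (rule analytic_continuation[OF hol_a[OF bD] D(1,2) reals D(3) lim])
      fix a assume a: "a \<in> complex_of_real ` {-(r/2)<..<r/2}"
      have "cnj (y a b) = x a b" using a b by (auto simp: x_def y_def)
      thus "K (x a b) (cnj (y a b)) = 0" using diag[of "x a b"] x_in[of a b] a reals bD by auto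
    qed (fact a)
  qed
  have 2: "K (x a b) (cnj (y a b)) = 0" if a: "a \<in> D" and b: "b \<in> D" for a b
    by (rule analytic_continuation[OF hol_b[OF a] D(1,2) reals D(3) lim])
       (use 1[OF a] b in auto)
  have near: "K p (cnj q) = 0" if p: "p \<in> ball w (r / 2)" and q: "q \<in> ball (cnj w) (r / 2)" for p q
  proof -
    \<comment> \<open>The solution of \<open>x a b = p\<close> and \<open>y a b = q\<close>.\<close>
    define a where "a = ((p - w) + (q - cnj w)) / 2"
    define b where "b = ((p - w) - (q - cnj w)) / (2 * \<i>)"
    have "cmod a * 2 \<le> cmod (p - w) + cmod (q - cnj w)" "cmod b * 2 \<le> cmod (p - w) + cmod (q - cnj w)"
      unfolding a_def b_def using norm_triangle_ineq[of "p - w" "q - cnj w"] norm_triangle_ineq4[of "p - w" "q - cnj w"]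
      by (simp_all add: norm_divide norm_mult)
    hence "a \<in> D" "b \<in> D" using p q by (auto simp: D_def dist_norm norm_minus_commute)
    moreover have "x a b = p" "y a b = q" by (simp_all add: x_def y_def a_def b_def field_simps)
    ultimately show ?thesis using 2 by blast
  qed
  have cnjG: "open (cnj ` G)" "connected (cnj ` G)"
    using G by (auto simp: image_cnj_conv_vimage_cnj[of G] intro!: open_vimage continuous_intros)
               (auto simp: image_cnj_conv_vimage_cnj[symmetric] intro!: connected_continuous_image continuous_intros)
  have 3: "K p v = 0" if p: "p \<in> ball w (r / 2)" for p
  proof -
    have pG: "p \<in> G" using p r by auto
    have "K p (cnj (cnj v)) = 0"
    proof (rule analytic_continuation[of "\<lambda>q. K p (cnj q)" "cnj ` G" "ball (cnj w) (r / 2)" "cnj w"])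
      show "(\<lambda>q. K p (cnj q)) holomorphic_on cnj ` G"
        using cnjG pG by (intro hol) (auto intro!: holomorphic_intros)
      show "ball (cnj w) (r / 2) \<subseteq> cnj ` G"
      proof
        fix q assume "q \<in> ball (cnj w) (r / 2)"
        hence "cmod (cnj (cnj w - q)) < r" using r by (simp add: dist_norm complex_mod_cnj del: complex_cnj_diff)
        hence "cnj q \<in> ball w r" by (simp add: dist_norm)
        thus "q \<in> cnj ` G" using r by (intro image_eqI[of _ _ "cnj q"]) auto
      qed
      show "cnj w islimpt ball (cnj w) (r / 2)" using r by (simp add: islimpt_ball)
    qed (use cnjG w v near[OF p] in auto)
    thus ?thesis by simp
  qed
  show ?thesis
  proof (rule analytic_continuation[of "\<lambda>p. K p v" G "ball w (r / 2)" w])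
    have "(\<lambda>p. K p (cnj (cnj v))) holomorphic_on G"
      using G v by (intro hol) (auto intro!: holomorphic_intros)
    thus "(\<lambda>p. K p v) holomorphic_on G" by simp
    show "ball w (r / 2) \<subseteq> G" using r by auto
    show "w islimpt ball w (r / 2)" using r by (simp add: islimpt_ball)
  qed (use G w 3 in auto)
qed

section \<open>Operators on square summable sequences\<close>

definition l2_unit :: "nat \<Rightarrow> nat \<Rightarrow> complex" where
  "l2_unit k = (\<lambda>j. if j = k then 1 else 0)"

lemma l2I: "summable (\<lambda>k. (cmod (a k))\<^sup>2) \<Longrightarrow> a \<in> l2"
  and l2D: "a \<in> l2 \<Longrightarrow> summable (\<lambda>k. (cmod (a k))\<^sup>2)"
  by (simp_all add: l2_def)

lemma l2_summable_norm_mult: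
  assumes "a \<in> l2" "b \<in> l2"
  shows "summable (\<lambda>k. cmod (a k) * cmod (b k))"
proof (rule summable_comparison_test'[of "\<lambda>k. (cmod (a k))\<^sup>2 + (cmod (b k))\<^sup>2" 0])
  show "summable (\<lambda>k. (cmod (a k))\<^sup>2 + (cmod (b k))\<^sup>2)"
    by (rule summable_add[OF l2D l2D]) (use assms in auto)
  fix k
  show "norm (cmod (a k) * cmod (b k)) \<le> (cmod (a k))\<^sup>2 + (cmod (b k))\<^sup>2"
    using norm_mult_cnj_le[of "a k" "b k"] by (simp add: norm_mult)
qed

lemma l2_inner_summable:
  assumes "a \<in> l2" "b \<in> l2"
  shows "summable (\<lambda>k. a k * cnj (b k))"
proof (rule summable_norm_cancel)
  show "summable (\<lambda>k. cmod (a k * cnj (b k)))"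
    unfolding norm_mult complex_mod_cnj by (rule l2_summable_norm_mult[OF assms])
qed

lemma l2_inner_sums:
  assumes "a \<in> l2" "b \<in> l2"
  shows "(\<lambda>k. a k * cnj (b k)) sums l2_inner a b"
  unfolding l2_inner_def by (rule summable_sums[OF l2_inner_summable[OF assms]])

lemma l2_add: "a \<in> l2 \<Longrightarrow> b \<in> l2 \<Longrightarrow> (\<lambda>k. a k + b k) \<in> l2"
proof (rule l2I)
  assume ab: "a \<in> l2" "b \<in> l2"
  show "summable (\<lambda>k. (cmod (a k + b k))\<^sup>2)"
  proof (rule summable_comparison_test')
    show "summable (\<lambda>k. (cmod (a k))\<^sup>2 + 2 * (cmod (a k) * cmod (b k)) + (cmod (b k))\<^sup>2)"
      by (rule summable_add[OF summable_add[OF l2D summable_mult[OF l2_summable_norm_mult]] l2D]) (use ab in auto)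
    fix k
    have "(cmod (a k + b k))\<^sup>2 \<le> (cmod (a k) + cmod (b k))\<^sup>2"
      by (intro power_mono norm_triangle_ineq) auto
    thus "norm ((cmod (a k + b k))\<^sup>2) \<le> (cmod (a k))\<^sup>2 + 2 * (cmod (a k) * cmod (b k)) + (cmod (b k))\<^sup>2"
      by (simp add: power2_sum algebra_simps)
  qed
qed

lemma l2_scale: "a \<in> l2 \<Longrightarrow> (\<lambda>k. c * a k) \<in> l2"
  using summable_mult[OF l2D[of a], of "(cmod c)\<^sup>2"] by (intro l2I) (simp add: norm_mult power_mult_distrib)

lemma l2_unit_in_l2: "l2_unit k \<in> l2"
  by (rule l2I, rule summable_finite[of "{k}"]) (auto simp: l2_unit_def)

lemma l2_inner_add_left: "a \<in> l2 \<Longrightarrow> b \<in> l2 \<Longrightarrow> c \<in> l2 \<Longrightarrow> l2_inner (\<lambda>k. a k + b k) c = l2_inner a c + l2_inner b c"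
  using sums_add[OF l2_inner_sums[of a c] l2_inner_sums[of b c]]
  by (auto simp: l2_inner_def sums_iff ring_distribs)

lemma l2_inner_scale_left: "a \<in> l2 \<Longrightarrow> b \<in> l2 \<Longrightarrow> l2_inner (\<lambda>k. c * a k) b = c * l2_inner a b"
  using sums_mult[OF l2_inner_sums[of a b], of c]
  by (auto simp: l2_inner_def sums_iff mult.assoc)

lemma l2_inner_commute: "a \<in> l2 \<Longrightarrow> b \<in> l2 \<Longrightarrow> l2_inner b a = cnj (l2_inner a b)"
proof -
  assume "a \<in> l2" "b \<in> l2"
  hence "(\<lambda>k. cnj (a k * cnj (b k))) sums cnj (l2_inner a b)"
    by (simp add: sums_cnj l2_inner_sums del: complex_cnj_mult)
  thus ?thesis by (simp add: l2_inner_def sums_iff mult.commute)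
qed

lemma l2_inner_add_right: "a \<in> l2 \<Longrightarrow> b \<in> l2 \<Longrightarrow> c \<in> l2 \<Longrightarrow> l2_inner c (\<lambda>k. a k + b k) = l2_inner c a + l2_inner c b"
  by (simp add: l2_inner_commute[of _ c] l2_add l2_inner_add_left)

lemma l2_inner_scale_right: "a \<in> l2 \<Longrightarrow> b \<in> l2 \<Longrightarrow> l2_inner b (\<lambda>k. c * a k) = cnj c * l2_inner b a"
  by (simp add: l2_inner_commute[of _ b] l2_scale l2_inner_scale_left)

lemma l2_inner_unit_right: "l2_inner a (l2_unit k) = a k"
proof -
  have "(\<lambda>j. a j * cnj (l2_unit k j)) sums (\<Sum>j\<in>{k}. a j * cnj (l2_unit k j))"
    by (rule sums_finite) (auto simp: l2_unit_def)
  thus ?thesis by (simp add: l2_inner_def sums_iff l2_unit_def)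
qed

lemma l2_inner_self: "a \<in> l2 \<Longrightarrow> l2_inner a a = of_real (\<Sum>k. (cmod (a k))\<^sup>2)"
proof -
  assume "a \<in> l2"
  hence "(\<lambda>k. complex_of_real ((cmod (a k))\<^sup>2)) sums of_real (\<Sum>k. (cmod (a k))\<^sup>2)"
    by (rule sums_of_real[OF summable_sums[OF l2D]])
  thus ?thesis by (simp only: l2_inner_def sums_iff complex_norm_square)
qed

lemma Re_l2_inner_self: "a \<in> l2 \<Longrightarrow> Re (l2_inner a a) = (\<Sum>k. (cmod (a k))\<^sup>2)"
  by (simp add: l2_inner_self)

lemma l2_norm_square: "a \<in> l2 \<Longrightarrow> (ip_norm l2_inner a)\<^sup>2 = (\<Sum>k. (cmod (a k))\<^sup>2)"
  unfolding ip_norm_def by (subst real_sqrt_pow2) (auto simp: Re_l2_inner_self suminf_nonneg l2D)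

lemma l2_component_le_norm:
  assumes "a \<in> l2"
  shows "cmod (a k) \<le> ip_norm l2_inner a"
proof -
  have "(\<Sum>k\<in>{k}. (cmod (a k))\<^sup>2) \<le> (\<Sum>k. (cmod (a k))\<^sup>2)"
    by (rule sum_le_suminf[OF l2D[OF assms]]) auto
  hence "sqrt ((cmod (a k))\<^sup>2) \<le> ip_norm l2_inner a"
    unfolding ip_norm_def Re_l2_inner_self[OF assms] by (intro real_sqrt_le_mono) simp
  thus ?thesis by simp
qed

lemma l2_sum: "(\<And>k. k < n \<Longrightarrow> u k \<in> l2) \<Longrightarrow> (\<lambda>j. \<Sum>k<n. c k * u k j) \<in> l2" for n :: nat
  by (induction n) (simp_all add: l2_add l2_scale, simp add: l2_def)

lemma l2_inner_sum_left:
  "(\<And>k. k < n \<Longrightarrow> u k \<in> l2) \<Longrightarrow> b \<in> l2 \<Longrightarrow>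
     l2_inner (\<lambda>j. \<Sum>k<n. c k * u k j) b = (\<Sum>k<n. c k * l2_inner (u k) b)" for n :: nat
  by (induction n) (simp_all add: l2_inner_add_left l2_inner_scale_left l2_sum l2_scale, simp add: l2_inner_def)

text \<open>
  Bessel's inequality, from the nonnegative norm of \<open>a\<close> minus its projection to finitely many of
  the vectors.
\<close>

lemma l2_bessel:
  assumes a: "a \<in> l2" and u: "\<And>k. u k \<in> l2" "\<And>j k. l2_inner (u j) (u k) = (if j = k then 1 else 0)"
  shows "(\<lambda>k. l2_inner a (u k)) \<in> l2"
    and "ip_norm l2_inner (\<lambda>k. l2_inner a (u k)) \<le> ip_norm l2_inner a"
proof -
  have le: "(\<Sum>k<n. (cmod (l2_inner a (u k)))\<^sup>2) \<le> Re (l2_inner a a)" for n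
  proof -
    define c where "c = (\<lambda>k. l2_inner a (u k))"
    define s where "s = (\<lambda>j. \<Sum>k<n. c k * u k j)"
    define \<sigma> where "\<sigma> = (\<Sum>k<n. (cmod (c k))\<^sup>2)"
    have s: "s \<in> l2" unfolding s_def using u by (intro l2_sum)
    have "l2_inner s b = (\<Sum>k<n. c k * l2_inner (u k) b)" if "b \<in> l2" for b
      unfolding s_def using that u by (intro l2_inner_sum_left)
    note sb = this
    have "l2_inner s a = (\<Sum>k<n. c k * cnj (c k))"
      using a u by (simp add: sb l2_inner_commute[of a] c_def)
    hence sa: "l2_inner s a = of_real \<sigma>" by (simp only: \<sigma>_def complex_norm_square of_real_sum)
    hence as: "l2_inner a s = of_real \<sigma>" using l2_inner_commute[OF s a] by simp
    have us: "l2_inner (u k) s = cnj (c k)" if "k < n" for k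
    proof -
      have "l2_inner s (u k) = (\<Sum>j<n. c j * (if j = k then 1 else 0))"
        using u by (simp add: sb)
      also have "\<dots> = c k" using that by (simp add: if_distrib cong: if_cong)
      finally show ?thesis using l2_inner_commute[OF s u(1)[of k]] by simp
    qed
    have "l2_inner s s = (\<Sum>k<n. c k * cnj (c k))"
      using us by (simp add: sb[OF s])
    hence ss: "l2_inner s s = of_real \<sigma>" by (simp only: \<sigma>_def complex_norm_square of_real_sum)
    define d where "d = (\<lambda>j. a j + (-1) * s j)"
    have s1: "(\<lambda>j. (-1) * s j) \<in> l2" using s by (rule l2_scale)
    have d: "d \<in> l2" unfolding d_def using a s1 by (rule l2_add)
    have "l2_inner d d = l2_inner a a + (-1) * l2_inner s a + cnj (-1) * (l2_inner a s + (-1) * l2_inner s s)"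
      using a s s1 d unfolding d_def
      by (simp only: l2_inner_add_left l2_inner_add_right l2_inner_scale_left l2_inner_scale_right)
         (simp add: algebra_simps)
    hence "Re (l2_inner d d) = Re (l2_inner a a) - \<sigma>"
      by (simp add: sa as ss)
    moreover have "0 \<le> Re (l2_inner d d)" using d by (simp add: Re_l2_inner_self suminf_nonneg l2D)
    ultimately show ?thesis by (simp add: \<sigma>_def c_def)
  qed
  have summ: "summable (\<lambda>k. (cmod (l2_inner a (u k)))\<^sup>2)"
    by (rule summableI_nonneg_bounded[OF _ le]) auto
  thus l2: "(\<lambda>k. l2_inner a (u k)) \<in> l2" by (rule l2I)
  show "ip_norm l2_inner (\<lambda>k. l2_inner a (u k)) \<le> ip_norm l2_inner a"
    unfolding ip_norm_def Re_l2_inner_self[OF l2]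
    by (intro real_sqrt_le_mono suminf_le_const[OF summ] le)
qed

lemma bounded_operatorD:
  assumes "bounded_operator l2 l2_inner T"
  shows "a \<in> l2 \<Longrightarrow> T a \<in> l2"
    and "a \<in> l2 \<Longrightarrow> b \<in> l2 \<Longrightarrow> T (\<lambda>x. a x + b x) = (\<lambda>x. T a x + T b x)"
    and "a \<in> l2 \<Longrightarrow> T (\<lambda>x. c * a x) = (\<lambda>x. c * T a x)"
    and "\<exists>C. \<forall>f\<in>l2. ip_norm l2_inner (T f) \<le> C * ip_norm l2_inner f"
  using assms by (auto simp: bounded_operator_def)

text \<open>
  Truncations converge in norm, and coordinates are continuous, so a bounded operator is
  determined by its values on the unit vectors.
\<close>

lemma bounded_operator_truncate:
  assumes T: "bounded_operator l2 l2_inner T" and a: "a \<in> l2"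
  shows "(\<lambda>n. \<Sum>k<n. a k * T (l2_unit k) j) \<longlonglongrightarrow> T a j"
proof -
  obtain C where C: "\<And>f. f \<in> l2 \<Longrightarrow> ip_norm l2_inner (T f) \<le> C * ip_norm l2_inner f"
    using bounded_operatorD(4)[OF T] by blast
  define h where "h = (\<lambda>n j. \<Sum>k<n. a k * l2_unit k j)"
  define t where "t = (\<lambda>n j. if j < n then 0 else a j)"
  have h_l2: "h n \<in> l2" for n unfolding h_def by (intro l2_sum l2_unit_in_l2)
  have t_l2: "t n \<in> l2" for n
    by (rule l2I, rule summable_comparison_test'[OF l2D[OF a]]) (auto simp: t_def)
  have split: "a = (\<lambda>j. h n j + t n j)" for n
  proof
    fix j
    have "h n j = (\<Sum>k<n. if k = j then a k else 0)"
      unfolding h_def l2_unit_def by (intro sum.cong) auto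
    thus "a j = h n j + t n j" by (simp add: t_def)
  qed
  have Th: "T (h n) = (\<lambda>j. \<Sum>k<n. a k * T (l2_unit k) j)" for n
  proof (induction n)
    case 0
    have "T (\<lambda>x. 0 * a x) = (\<lambda>x. 0 * T a x)" by (rule bounded_operatorD(3)[OF T a])
    thus ?case by (simp add: h_def)
  next
    case (Suc n)
    have "h (Suc n) = (\<lambda>j. h n j + a n * l2_unit n j)" by (simp add: h_def)
    thus ?case using bounded_operatorD(2)[OF T h_l2[of n] l2_scale[OF l2_unit_in_l2[of n], of "a n"]]
        bounded_operatorD(3)[OF T l2_unit_in_l2[of n], of "a n"] Suc by simp
  qed
  have diff: "cmod (T (h n) j - T a j) \<le> \<bar>C\<bar> * ip_norm l2_inner (t n)" for n
  proof -
    have "T a = (\<lambda>j. T (h n) j + T (t n) j)"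
      using bounded_operatorD(2)[OF T h_l2 t_l2, of n n] split[of n] by simp
    hence "cmod (T (h n) j - T a j) = cmod (T (t n) j)" by (simp add: norm_minus_commute)
    also have "\<dots> \<le> ip_norm l2_inner (T (t n))" by (intro l2_component_le_norm bounded_operatorD(1)[OF T] t_l2)
    also have "\<dots> \<le> C * ip_norm l2_inner (t n)" by (rule C[OF t_l2])
    also have "\<dots> \<le> \<bar>C\<bar> * ip_norm l2_inner (t n)"
      by (intro mult_right_mono) (auto simp: ip_norm_def Re_l2_inner_self t_l2 suminf_nonneg l2D)
    finally show ?thesis .
  qed
  have "(\<lambda>n. ip_norm l2_inner (t n)) \<longlonglongrightarrow> 0"
  proof -
    have "(\<Sum>k. (cmod (t n k))\<^sup>2) = (\<Sum>k. (cmod (a (k + n)))\<^sup>2)" for n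
      using suminf_split_initial_segment[OF l2D[OF t_l2[of n]], of n] by (simp add: t_def)
    hence "(\<lambda>n. \<Sum>k. (cmod (t n k))\<^sup>2) \<longlonglongrightarrow> 0"
      using suminf_exist_split2[OF l2D[OF a]] by simp
    from tendsto_real_sqrt[OF this] show ?thesis
      by (simp add: ip_norm_def Re_l2_inner_self t_l2)
  qed
  hence "(\<lambda>n. \<bar>C\<bar> * ip_norm l2_inner (t n)) \<longlonglongrightarrow> 0" by (rule tendsto_mult_right_zero)
  hence "(\<lambda>n. T (h n) j - T a j) \<longlonglongrightarrow> 0"
    by (rule Lim_null_comparison[rotated]) (use diff in auto)
  hence "(\<lambda>n. T (h n) j) \<longlonglongrightarrow> T a j" by (simp add: LIM_zero_cancel)
  thus ?thesis by (simp add: Th)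
qed

lemma bounded_operator_l2_eqI:
  assumes "bounded_operator l2 l2_inner T" "bounded_operator l2 l2_inner U"
    and "\<And>k. T (l2_unit k) = U (l2_unit k)"
  shows "T = U"
proof (rule PiE_ext)
  show "T \<in> l2 \<rightarrow>\<^sub>E l2" "U \<in> l2 \<rightarrow>\<^sub>E l2" using assms by (auto simp: bounded_operator_def)
  fix a :: "nat \<Rightarrow> complex" assume a: "a \<in> l2"
  show "T a = U a"
  proof
    fix j
    show "T a j = U a j"
      using bounded_operator_truncate[OF assms(1) a, of j] bounded_operator_truncate[OF assms(2) a, of j] assms(3)
      by (auto intro: LIMSEQ_unique)
  qed
qed

lemma bounded_operator_inner_coefficients:
  assumes u: "\<And>k. u k \<in> l2" "\<And>j k. l2_inner (u j) (u k) = (if j = k then 1 else 0)"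
  shows "bounded_operator l2 l2_inner (\<lambda>a\<in>l2. \<lambda>k. l2_inner a (u k))"
  unfolding bounded_operator_def
proof (intro conjI ballI allI)
  show "(\<lambda>a\<in>l2. \<lambda>k. l2_inner a (u k)) \<in> l2 \<rightarrow>\<^sub>E l2" using l2_bessel(1)[OF _ u] by auto
  show "\<exists>C. \<forall>f\<in>l2. ip_norm l2_inner ((\<lambda>a\<in>l2. \<lambda>k. l2_inner a (u k)) f) \<le> C * ip_norm l2_inner f"
    using l2_bessel(2)[OF _ u] by (intro exI[of _ 1]) auto
qed (use u in \<open>auto simp: l2_add l2_scale l2_inner_add_left l2_inner_scale_left\<close>)

lemma l2_inner_polarization:
  assumes lin: "bounded_operator l2 l2_inner T"
    and nrm: "\<And>a. a \<in> l2 \<Longrightarrow> Re (l2_inner (T a) (T a)) = Re (l2_inner a a)"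
    and a: "a \<in> l2" and b: "b \<in> l2"
  shows "l2_inner (T a) (T b) = l2_inner a b"
proof -
  note T = bounded_operatorD[OF lin]
  have expand: "Re (l2_inner (\<lambda>k. x k + y k) (\<lambda>k. x k + y k)) = Re (l2_inner x x) + Re (l2_inner y y) + 2 * Re (l2_inner x y)"
    if "x \<in> l2" "y \<in> l2" for x y
    using that by (simp add: l2_inner_add_left l2_inner_add_right l2_add l2_inner_commute[of x y])
  have re: "Re (l2_inner (T a) (T b)) = Re (l2_inner a b)" if "a \<in> l2" "b \<in> l2" for a b
    using expand[OF that] expand[OF T(1)[OF that(1)] T(1)[OF that(2)]] nrm[OF l2_add[OF that]] nrm that T(2)[OF that] by simp
  have "Re (l2_inner (T a) (T (\<lambda>k. \<i> * b k))) = Re (l2_inner a (\<lambda>k. \<i> * b k))"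
    using a b by (intro re l2_scale)
  hence "Im (l2_inner (T a) (T b)) = Im (l2_inner a b)"
    using a b by (simp add: T l2_inner_scale_right)
  with re[OF a b] show ?thesis by (simp add: complex_eq_iff)
qed

text \<open>
  If \<open>q (t k)\<close> is the unit vector of index \<open>k\<close>, then the coordinate of \<open>q i\<close> of index \<open>k\<close> is an
  inner product of two vectors \<open>q\<close>, hence by hypothesis one of two vectors \<open>p\<close>. This dictates
  the formula for \<open>W\<close>, and Bessel's inequality makes it a contraction. Exchanging the two
  families gives a contraction in the other direction, the inverse of \<open>W\<close>.
\<close>

theorem equal_gram_unitary:
  fixes p q :: "'i \<Rightarrow> nat \<Rightarrow> complex"
  assumes l2: "\<And>i. i \<in> I \<Longrightarrow> p i \<in> l2" "\<And>i. i \<in> I \<Longrightarrow> q i \<in> l2"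
    and gram: "\<And>i j. i \<in> I \<Longrightarrow> j \<in> I \<Longrightarrow> l2_inner (p i) (p j) = l2_inner (q i) (q j)"
    and ps: "\<And>k. s k \<in> I" "\<And>k. p (s k) = l2_unit k"
    and qt: "\<And>k. t k \<in> I" "\<And>k. q (t k) = l2_unit k"
  defines "W \<equiv> (\<lambda>a\<in>l2. \<lambda>k. l2_inner a (p (t k)))"
  shows "unitary_operator l2 l2_inner W" and "\<And>i. i \<in> I \<Longrightarrow> W (p i) = q i"
    and "\<And>U. bounded_operator l2 l2_inner U \<Longrightarrow> (\<And>i. i \<in> I \<Longrightarrow> U (p i) = q i) \<Longrightarrow> U = W"
proof -
  define V where "V = (\<lambda>a\<in>l2. \<lambda>k. l2_inner a (q (s k)))"
  have unit: "l2_inner (l2_unit j) (l2_unit k) = (if j = k then 1 else 0)" for j k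
    unfolding l2_inner_unit_right by (auto simp: l2_unit_def)
  have orth: "l2_inner (p (t j)) (p (t k)) = (if j = k then 1 else 0)"
    "l2_inner (q (s j)) (q (s k)) = (if j = k then 1 else 0)" for j k
    using gram[of "t j" "t k"] gram[of "s j" "s k"] ps qt unit by auto
  have l2': "p (t k) \<in> l2" "q (s k) \<in> l2" for k
    using l2(1)[OF qt(1)] l2(2)[OF ps(1)] by auto
  have W: "bounded_operator l2 l2_inner W"
    unfolding W_def using l2' orth by (intro bounded_operator_inner_coefficients)
  have V: "bounded_operator l2 l2_inner V"
    unfolding V_def using l2' orth by (intro bounded_operator_inner_coefficients)
  show Wp: "W (p i) = q i" if "i \<in> I" for i
    using that gram[OF that qt(1)] l2 by (auto simp: W_def qt(2) l2_inner_unit_right)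
  have Vq: "V (q i) = p i" if "i \<in> I" for i
    using that gram[OF that ps(1)] l2 by (auto simp: V_def ps(2) l2_inner_unit_right simp flip: gram)
  show uniq: "U = W" if U: "bounded_operator l2 l2_inner U" "\<And>i. i \<in> I \<Longrightarrow> U (p i) = q i" for U
    by (rule bounded_operator_l2_eqI[OF U(1) W]) (use U(2) Wp ps in \<open>metis\<close>)
  have Wle: "ip_norm l2_inner (W a) \<le> ip_norm l2_inner a" if "a \<in> l2" for a
    using l2_bessel(2)[OF that, of "\<lambda>k. p (t k)"] l2' orth that by (simp add: W_def)
  have Vle: "ip_norm l2_inner (V a) \<le> ip_norm l2_inner a" if "a \<in> l2" for a
    using l2_bessel(2)[OF that, of "\<lambda>k. q (s k)"] l2' orth that by (simp add: V_def)
  have id: "bounded_operator l2 l2_inner (\<lambda>a\<in>l2. a)"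
    unfolding bounded_operator_def by (auto simp: l2_add l2_scale intro!: exI[of _ 1])
  have comp: "bounded_operator l2 l2_inner (\<lambda>a\<in>l2. T (U a))"
    if T: "bounded_operator l2 l2_inner T" "\<And>a. a \<in> l2 \<Longrightarrow> ip_norm l2_inner (T a) \<le> ip_norm l2_inner a"
      and U: "bounded_operator l2 l2_inner U" "\<And>a. a \<in> l2 \<Longrightarrow> ip_norm l2_inner (U a) \<le> ip_norm l2_inner a" for T U
    unfolding bounded_operator_def
  proof (intro conjI ballI allI)
    note D = bounded_operatorD[OF T(1)] bounded_operatorD[OF U(1)]
    show "(\<lambda>a\<in>l2. T (U a)) \<in> l2 \<rightarrow>\<^sub>E l2" using D by auto
    have "ip_norm l2_inner (T (U f)) \<le> ip_norm l2_inner f" if "f \<in> l2" for f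
      using T(2)[OF bounded_operatorD(1)[OF U(1) that]] U(2)[OF that] by (rule order.trans)
    thus "\<exists>C. \<forall>f\<in>l2. ip_norm l2_inner ((\<lambda>a\<in>l2. T (U a)) f) \<le> C * ip_norm l2_inner f"
      by (intro exI[of _ 1]) auto
  qed (use bounded_operatorD[OF T(1)] bounded_operatorD[OF U(1)] in \<open>auto simp: l2_add l2_scale\<close>)
  have "(\<lambda>a\<in>l2. V (W a)) = (\<lambda>a\<in>l2. a)"
  proof (rule bounded_operator_l2_eqI[OF comp[OF V Vle W Wle] id])
    fix k show "(\<lambda>a\<in>l2. V (W a)) (l2_unit k) = (\<lambda>a\<in>l2. a) (l2_unit k)"
      using Wp[OF ps(1)[of k]] Vq[OF ps(1)[of k]] ps(2)[of k] by (simp add: l2_unit_in_l2)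
  qed
  hence VW: "V (W a) = a" if "a \<in> l2" for a using that by (metis restrict_apply')
  have "(\<lambda>a\<in>l2. W (V a)) = (\<lambda>a\<in>l2. a)"
  proof (rule bounded_operator_l2_eqI[OF comp[OF W Wle V Vle] id])
    fix k show "(\<lambda>a\<in>l2. W (V a)) (l2_unit k) = (\<lambda>a\<in>l2. a) (l2_unit k)"
      using Wp[OF qt(1)[of k]] Vq[OF qt(1)[of k]] qt(2)[of k] by (simp add: l2_unit_in_l2)
  qed
  hence WV: "W (V a) = a" if "a \<in> l2" for a using that by (metis restrict_apply')
  have in_l2: "W a \<in> l2" "V a \<in> l2" if "a \<in> l2" for a
    using that bounded_operatorD(1)[OF W] bounded_operatorD(1)[OF V] by auto
  show "unitary_operator l2 l2_inner W"
    unfolding unitary_operator_def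
  proof (intro conjI ballI W)
    show "W ` l2 = l2"
    proof
      show "l2 \<subseteq> W ` l2"
      proof
        fix a :: "nat \<Rightarrow> complex" assume "a \<in> l2"
        thus "a \<in> W ` l2" using WV in_l2 by (intro image_eqI[of _ _ "V a"]) auto
      qed
    qed (use in_l2 in auto)
    fix a b :: "nat \<Rightarrow> complex" assume ab: "a \<in> l2" "b \<in> l2"
    show "l2_inner (W a) (W b) = l2_inner a b"
    proof (rule l2_inner_polarization[OF W _ ab])
      fix x :: "nat \<Rightarrow> complex" assume x: "x \<in> l2"
      have "ip_norm l2_inner (W x) = ip_norm l2_inner x"
        using Wle[OF x] Vle[OF in_l2(1)[OF x]] VW[OF x] by simp
      thus "Re (l2_inner (W x) (W x)) = Re (l2_inner x x)"
        using l2_norm_square[OF x] l2_norm_square[OF in_l2(1)[OF x]] by (simp add: Re_l2_inner_self x in_l2)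
    qed
  qed
qed

section \<open>The sequences of fibre values\<close>

lemma l2_inner_uniform_limit:
  assumes M: "summable M" "\<And>z k. z \<in> X \<Longrightarrow> (cmod (u z k))\<^sup>2 \<le> M k"
    and N: "summable N" "\<And>z k. z \<in> X \<Longrightarrow> (cmod (v z k))\<^sup>2 \<le> N k"
  shows "uniform_limit X (\<lambda>n z. \<Sum>k<n. u z k * cnj (v z k)) (\<lambda>z. l2_inner (u z) (v z)) sequentially"
  unfolding l2_inner_def
proof (rule Weierstrass_m_test)
  show "summable (\<lambda>k. M k + N k)" using M(1) N(1) by (rule summable_add)
  fix k z assume z: "z \<in> X"
  show "norm (u z k * cnj (v z k)) \<le> M k + N k"
    using norm_mult_cnj_le[of "u z k" "v z k"] M(2)[OF z, of k] N(2)[OF z, of k] by linarith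
qed

context thin_blaschke_local_inverses
begin

lemma pi_map_holomorphic:
  assumes h: "h holomorphic_on ball 0 1"
  shows "(\<lambda>z. pi_map \<rho> z h k) holomorphic_on G"
proof -
  have "(h \<circ> \<rho> k) holomorphic_on G"
    by (rule holomorphic_on_compose_gen[OF rho_holomorphic h]) (use rho_in_disc in auto)
  hence "(\<lambda>z. (h \<circ> \<rho> k) z * deriv (\<rho> k) z) holomorphic_on G"
    by (intro holomorphic_intros holomorphic_deriv[OF rho_holomorphic open_G])
  thus ?thesis by (simp add: pi_map_def)
qed

lemma open_sheet: "open V \<Longrightarrow> V \<subseteq> G \<Longrightarrow> inj_on B V \<Longrightarrow> open (\<rho> k ` V)"
  using open_mapping_thm3[OF holomorphic_on_subset[OF rho_holomorphic] _ sheets(1)] by blast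

text \<open>
  The sheets \<open>\<rho> k ` V\<close> are disjoint and fill the part of the disc above \<open>B ` V\<close>; \<open>\<rho> k\<close>
  parametrizes one of them, and the weight is its Jacobian.
\<close>

lemma integral_over_sheets:
  fixes f :: "complex \<Rightarrow> complex"
  assumes V: "open V" "V \<subseteq> G" "inj_on B V"
    and f: "set_integrable lborel (ball 0 1) f" "continuous_on (ball 0 1) f"
  shows "set_integrable lborel V (\<lambda>z. of_real ((cmod (deriv (\<rho> k) z))\<^sup>2) * f (\<rho> k z))"
    and "(\<lambda>k. LINT z:V|lborel. of_real ((cmod (deriv (\<rho> k) z))\<^sup>2) * f (\<rho> k z)) sums
           (LINT z:{z \<in> ball 0 1. B z \<in> B ` V}|lborel. f z)"
proof -
  have op: "open (\<rho> k ` V)" for k by (rule open_sheet[OF V])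
  have sub: "\<rho> k ` V \<subseteq> ball 0 1" for k using V(2) rho_in_disc by blast
  have meas: "set_borel_measurable borel (\<rho> k ` V) f" for k
    by (rule continuous_on_open_set_borel_measurable[OF op continuous_on_subset[OF f(2) sub]])
  have hol: "\<rho> k holomorphic_on V" for k by (rule holomorphic_on_subset[OF rho_holomorphic V(2)])
  note cov = holomorphic_change_of_variables[OF V(1) hol sheets(1)[OF V(2,3)] meas]
  have "set_integrable lborel (\<rho> k ` V) f"
    using op sub by (intro set_integrable_subset[OF f(1)]) auto
  thus "set_integrable lborel V (\<lambda>z. of_real ((cmod (deriv (\<rho> k) z))\<^sup>2) * f (\<rho> k z))"
    using cov(1) by blast
  have "(\<lambda>k. LINT z:\<rho> k ` V|lborel. f z) sums (LINT z:(\<Union>k. \<rho> k ` V)|lborel. f z)"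
  proof (rule set_integral_countable_sums)
    show "set_integrable lborel (\<Union>k. \<rho> k ` V) f"
      using op sub by (intro set_integrable_subset[OF f(1)]) auto
  qed (use op sheets(2)[OF V(2,3)] in auto)
  thus "(\<lambda>k. LINT z:V|lborel. of_real ((cmod (deriv (\<rho> k) z))\<^sup>2) * f (\<rho> k z)) sums
           (LINT z:{z \<in> ball 0 1. B z \<in> B ` V}|lborel. f z)"
    unfolding cov(2) sheets(3)[OF V(2,3)] .
qed

lemma pi_map_square_integrals:
  assumes V: "open V" "V \<subseteq> G" "inj_on B V" and h: "h \<in> bergman"
  shows "set_integrable lborel V (\<lambda>z. (cmod (pi_map \<rho> z h k))\<^sup>2)"
    and "summable (\<lambda>k. LINT z:V|lborel. (cmod (pi_map \<rho> z h k))\<^sup>2)"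
proof -
  define f where "f = (\<lambda>z. complex_of_real ((cmod (h z))\<^sup>2))"
  have fi: "set_integrable lborel (ball 0 1) f"
  proof -
    have "f = (\<lambda>z. h z * cnj (h z))" by (simp only: f_def complex_norm_square)
    thus ?thesis using bergman_integrable_mult_cnj[OF h h] by simp
  qed
  have fc: "continuous_on (ball 0 1) f"
    unfolding f_def using h by (intro continuous_intros holomorphic_on_imp_continuous_on) (auto simp: bergman_def)
  have eq: "of_real ((cmod (deriv (\<rho> k) z))\<^sup>2) * f (\<rho> k z) = of_real ((cmod (pi_map \<rho> z h k))\<^sup>2)" for k z
    by (simp add: f_def pi_map_def norm_mult power_mult_distrib mult.commute)
  note sh = integral_over_sheets[OF V fi fc, unfolded eq]
  show "set_integrable lborel V (\<lambda>z. (cmod (pi_map \<rho> z h k))\<^sup>2)"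
    using sh(1)[of k] unfolding set_integrable_def scaleR_conv_of_real
    by (simp flip: of_real_mult of_real_power add: complex_of_real_integrable_eq)
  have "summable (\<lambda>k. complex_of_real (LINT z:V|lborel. (cmod (pi_map \<rho> z h k))\<^sup>2))"
    using sums_summable[OF sh(2)] by (simp only: set_integral_complex_of_real)
  thus "summable (\<lambda>k. LINT z:V|lborel. (cmod (pi_map \<rho> z h k))\<^sup>2)"
    by (simp only: summable_of_real_iff)
qed

text \<open>
  By the mean value property the square of a holomorphic function is bounded by its area
  integral, and these integrals are summable because the sheets are disjoint.
\<close>

lemma pi_map_locally_dominated:
  assumes w: "w \<in> G" and h: "h \<in> bergman"
  shows "\<exists>r>0. ball w r \<subseteq> G \<and> (\<exists>M. summable M \<and> (\<forall>z\<in>ball w r. \<forall>k. (cmod (pi_map \<rho> z h k))\<^sup>2 \<le> M k))"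
proof -
  obtain R where R: "0 < R" "ball w R \<subseteq> G" "inj_on B (ball w R)" using good_disc[OF w] .
  define r where "r = R / 3"
  have r: "0 < r" using R by (simp add: r_def)
  define c where "c = measure lborel (ball (0::complex) r)"
  have c: "0 < c" using r content_ball_pos[of r "0::complex"] by (simp add: c_def)
  define I where "I = (\<lambda>k. LINT z:ball w R|lborel. (cmod (pi_map \<rho> z h k))\<^sup>2)"
  note sq = pi_map_square_integrals[OF open_ball R(2,3) h]
  have "c * (cmod (pi_map \<rho> z h k))\<^sup>2 \<le> I k" if z: "z \<in> ball w r" for z k
  proof -
    have sub: "ball z (2 * r) \<subseteq> ball w R"
    proof
      fix y assume "y \<in> ball z (2 * r)"
      thus "y \<in> ball w R" using z dist_triangle[of w y z] by (simp add: r_def dist_commute)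
    qed
    have "(\<lambda>z. pi_map \<rho> z h k) holomorphic_on ball z (2 * r)"
      using sub R(2) h by (intro holomorphic_on_subset[OF pi_map_holomorphic]) (auto simp: bergman_def)
    hence "c * (cmod (pi_map \<rho> z h k))\<^sup>2 \<le> (LINT x:ball z r|lborel. (cmod (pi_map \<rho> x h k))\<^sup>2)"
      unfolding c_def by (rule norm_square_le_set_integral) (use r in auto)
    also have "\<dots> \<le> I k"
      unfolding I_def set_lebesgue_integral_def
    proof (rule integral_mono)
      have b: "ball z r \<subseteq> ball w R" using sub r subset_ball[of r "2 * r" z] by auto
      show "integrable lborel (\<lambda>x. indicat_real (ball w R) x *\<^sub>R (cmod (pi_map \<rho> x h k))\<^sup>2)"
        using sq(1)[of k] unfolding set_integrable_def .
      show "integrable lborel (\<lambda>x. indicat_real (ball z r) x *\<^sub>R (cmod (pi_map \<rho> x h k))\<^sup>2)"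
        using set_integrable_subset[OF sq(1)[of k] _ b] unfolding set_integrable_def by simp
      show "indicat_real (ball z r) x *\<^sub>R (cmod (pi_map \<rho> x h k))\<^sup>2 \<le> indicat_real (ball w R) x *\<^sub>R (cmod (pi_map \<rho> x h k))\<^sup>2" for x
        using b by (auto simp: indicator_def)
    qed
    finally show ?thesis .
  qed
  hence "(cmod (pi_map \<rho> z h k))\<^sup>2 \<le> I k / c" if "z \<in> ball w r" for z k
    using that c by (simp add: field_simps)
  moreover have "summable (\<lambda>k. I k / c)" using sq(2) unfolding I_def by (rule summable_divide)
  moreover have "ball w r \<subseteq> G" using R by (auto simp: r_def)
  ultimately show ?thesis using r by blast
qed

lemma pi_map_compact_dominated:
  assumes K: "compact K" "K \<subseteq> G" and h: "h \<in> bergman"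
  shows "\<exists>M. summable M \<and> (\<forall>z\<in>K. \<forall>k. (cmod (pi_map \<rho> z h k))\<^sup>2 \<le> M k)"
proof -
  have "\<forall>w\<in>G. \<exists>r M. 0 < r \<and> summable M \<and> (\<forall>z\<in>ball w r. \<forall>k. (cmod (pi_map \<rho> z h k))\<^sup>2 \<le> M k)"
    using pi_map_locally_dominated[OF _ h] by blast
  then obtain r M where rM: "\<And>w. w \<in> G \<Longrightarrow> 0 < r w" "\<And>w. w \<in> G \<Longrightarrow> summable (M w)"
    "\<And>w z k. w \<in> G \<Longrightarrow> z \<in> ball w (r w) \<Longrightarrow> (cmod (pi_map \<rho> z h k))\<^sup>2 \<le> M w k"
    by metis
  obtain T where T: "T \<subseteq> K" "finite T" "K \<subseteq> (\<Union>w\<in>T. ball w (r w))"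
  proof (rule compactE_image[OF K(1), of K "\<lambda>w. ball w (r w)"])
    show "K \<subseteq> (\<Union>w\<in>K. ball w (r w))" using rM(1) K(2) by force
  qed auto
  show ?thesis
  proof (intro exI conjI ballI allI)
    show "summable (\<lambda>k. \<Sum>w\<in>T. M w k)" using rM(2) T K by (intro summable_sum) auto
    fix z k assume "z \<in> K"
    then obtain w where w: "w \<in> T" "z \<in> ball w (r w)" using T by blast
    have "0 \<le> M v k" if "v \<in> T" for v
      using rM(3)[of v v k] rM(1)[of v] that T K zero_le_power2 order.trans by (metis centre_in_ball subsetD)
    hence "M w k \<le> (\<Sum>w\<in>T. M w k)" using T w by (intro member_le_sum) auto
    moreover have "(cmod (pi_map \<rho> z h k))\<^sup>2 \<le> M w k" using rM(3) w T K by blast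
    ultimately show "(cmod (pi_map \<rho> z h k))\<^sup>2 \<le> (\<Sum>w\<in>T. M w k)" by simp
  qed
qed

lemma pi_map_in_l2: "w \<in> G \<Longrightarrow> h \<in> bergman \<Longrightarrow> pi_map \<rho> w h \<in> l2"
proof (rule l2I)
  assume "w \<in> G" "h \<in> bergman"
  then obtain M where M: "summable M" "\<And>k. (cmod (pi_map \<rho> w h k))\<^sup>2 \<le> M k"
    using pi_map_compact_dominated[of "{w}" h] by auto
  show "summable (\<lambda>k. (cmod (pi_map \<rho> w h k))\<^sup>2)"
    by (rule summable_comparison_test'[OF M(1)]) (use M(2) in auto)
qed

text \<open>
  Stated with a holomorphic \<open>q\<close> and its conjugate, so that holomorphy in the first argument and
  antiholomorphy in the second are expressed together.
\<close>

lemma inner_pi_map_holomorphic: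
  assumes h: "h \<in> bergman" "g \<in> bergman" and A: "open A"
    and p: "p holomorphic_on A" "p ` A \<subseteq> G" and q: "q holomorphic_on A" "(\<lambda>x. cnj (q x)) ` A \<subseteq> G"
  shows "(\<lambda>x. l2_inner (pi_map \<rho> (p x) h) (pi_map \<rho> (cnj (q x)) g)) holomorphic_on A"
proof (rule holomorphic_uniform_sequence[OF A, of "\<lambda>n x. \<Sum>k<n. pi_map \<rho> (p x) h k * cnj (pi_map \<rho> (cnj (q x)) g k)"])
  have hol: "h holomorphic_on ball 0 1" "g holomorphic_on ball 0 1" using bergmanD(1) h by auto
  fix n
  have 1: "(\<lambda>x. pi_map \<rho> (p x) h k) holomorphic_on A" for k
    using holomorphic_on_compose_gen[OF p(1) pi_map_holomorphic[OF hol(1)] p(2)] by (simp add: o_def)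
  have 2: "(\<lambda>x. cnj (pi_map \<rho> (cnj (q x)) g k)) holomorphic_on A" for k
  proof -
    have "open (cnj ` G)"
      unfolding image_cnj_conv_vimage_cnj by (rule open_vimage[OF open_G]) (auto intro!: continuous_intros)
    have "(\<lambda>z. pi_map \<rho> z g k) holomorphic_on cnj ` cnj ` G"
      using pi_map_holomorphic[OF hol(2)] by (simp add: image_image)
    hence c: "(cnj \<circ> (\<lambda>z. pi_map \<rho> z g k) \<circ> cnj) holomorphic_on cnj ` G"
      by (rule holomorphic_on_compose_cnj_cnj) fact
    have "q ` A \<subseteq> cnj ` G"
      using q(2) by (auto simp: image_subset_iff) (metis complex_cnj_cnj imageI)
    from holomorphic_on_compose_gen[OF q(1) c this] show ?thesis by (simp add: o_def)
  qed
  show "(\<lambda>x. \<Sum>k<n. pi_map \<rho> (p x) h k * cnj (pi_map \<rho> (cnj (q x)) g k)) holomorphic_on A"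
    by (intro holomorphic_intros 1 2)
next
  fix x assume "x \<in> A"
  then obtain d where d: "0 < d" "cball x d \<subseteq> A" using A open_contains_cball by blast
  have cp: "continuous_on (cball x d) p" "continuous_on (cball x d) (\<lambda>x. cnj (q x))"
    by (intro continuous_intros holomorphic_on_imp_continuous_on holomorphic_on_subset[OF p(1) d(2)]
          holomorphic_on_subset[OF q(1) d(2)])+
  have K: "compact (p ` cball x d)" "compact ((\<lambda>x. cnj (q x)) ` cball x d)"
    by (rule compact_continuous_image[OF cp(1) compact_cball], rule compact_continuous_image[OF cp(2) compact_cball])
  have KG: "p ` cball x d \<subseteq> G" "(\<lambda>x. cnj (q x)) ` cball x d \<subseteq> G" using d p(2) q(2) by blast+
  obtain M where M: "summable M" "\<And>z k. z \<in> p ` cball x d \<Longrightarrow> (cmod (pi_map \<rho> z h k))\<^sup>2 \<le> M k"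
    using pi_map_compact_dominated[OF K(1) KG(1) h(1)] by blast
  obtain N where N: "summable N" "\<And>z k. z \<in> (\<lambda>x. cnj (q x)) ` cball x d \<Longrightarrow> (cmod (pi_map \<rho> z g k))\<^sup>2 \<le> N k"
    using pi_map_compact_dominated[OF K(2) KG(2) h(2)] by blast
  have "uniform_limit (cball x d) (\<lambda>n x. \<Sum>k<n. pi_map \<rho> (p x) h k * cnj (pi_map \<rho> (cnj (q x)) g k))
         (\<lambda>x. l2_inner (pi_map \<rho> (p x) h) (pi_map \<rho> (cnj (q x)) g)) sequentially"
    by (rule l2_inner_uniform_limit[OF M(1) _ N(1)]) (use M(2) N(2) in auto)
  thus "\<exists>d>0. cball x d \<subseteq> A \<and> uniform_limit (cball x d) (\<lambda>n x. \<Sum>k<n. pi_map \<rho> (p x) h k * cnj (pi_map \<rho> (cnj (q x)) g k))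
         (\<lambda>x. l2_inner (pi_map \<rho> (p x) h) (pi_map \<rho> (cnj (q x)) g)) sequentially"
    using d by blast
qed

lemma inner_pi_map_continuous:
  assumes h: "h \<in> bergman" "g \<in> bergman"
  shows "continuous_on G (\<lambda>z. l2_inner (pi_map \<rho> z h) (pi_map \<rho> z g))"
  unfolding continuous_on_eq_continuous_at[OF open_G]
proof
  fix w assume w: "w \<in> G"
  have hol: "h holomorphic_on ball 0 1" "g holomorphic_on ball 0 1" using bergmanD(1) h by auto
  obtain t where t: "0 < t" "cball w t \<subseteq> G" using open_G w open_contains_cball by blast
  have tG: "ball w t \<subseteq> G" using t(2) ball_subset_cball by blast
  obtain M N where M: "summable M" "\<And>z k. z \<in> cball w t \<Longrightarrow> (cmod (pi_map \<rho> z h k))\<^sup>2 \<le> M k"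
    and N: "summable N" "\<And>z k. z \<in> cball w t \<Longrightarrow> (cmod (pi_map \<rho> z g k))\<^sup>2 \<le> N k"
    using pi_map_compact_dominated[OF compact_cball t(2)] h by metis
  have unif: "uniform_limit (ball w t) (\<lambda>n z. \<Sum>k<n. pi_map \<rho> z h k * cnj (pi_map \<rho> z g k))
         (\<lambda>z. l2_inner (pi_map \<rho> z h) (pi_map \<rho> z g)) sequentially"
    by (rule l2_inner_uniform_limit[OF M(1) _ N(1)]) (use M(2) N(2) ball_subset_cball in blast)+
  have c: "continuous_on (ball w t) (\<lambda>z. pi_map \<rho> z f k)" if "f holomorphic_on ball 0 1" for f k
    by (intro holomorphic_on_imp_continuous_on holomorphic_on_subset[OF pi_map_holomorphic[OF that] tG])
  have "continuous_on (ball w t) (\<lambda>z. l2_inner (pi_map \<rho> z h) (pi_map \<rho> z g))"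
  proof (rule uniform_limit_theorem[OF _ unif])
    show "\<forall>\<^sub>F n in sequentially. continuous_on (ball w t) (\<lambda>z. \<Sum>k<n. pi_map \<rho> z h k * cnj (pi_map \<rho> z g k))"
      by (intro always_eventually allI continuous_intros c hol)
  qed simp
  thus "isCont (\<lambda>z. l2_inner (pi_map \<rho> z h) (pi_map \<rho> z g)) w"
    using t by (simp add: continuous_on_eq_continuous_at)
qed

end

section \<open>Unitary operators commuting with multiplication\<close>

lemma funpow_mult_op: "(mult_op B ^^ n) h = (\<lambda>z. B z ^ n * h z)"
  by (induction n) (simp_all add: mult_op_def mult.assoc)

text \<open>
  \<open>S\<close> maps \<open>B ^ m h\<close> to \<open>B ^ m S h\<close> and preserves inner products.
\<close>

lemma commuting_unitary_moments:
  assumes S: "unitary_operator bergman bergman_inner S"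
    and comm: "\<And>h. h \<in> bergman \<Longrightarrow> S (mult_op B h) = mult_op B (S h)"
    and B: "B holomorphic_on ball 0 1" "\<And>z. z \<in> ball 0 1 \<Longrightarrow> cmod (B z) \<le> 1"
    and h: "h \<in> bergman" "g \<in> bergman"
  shows "(LINT z:ball 0 1|lborel. B z ^ m * cnj (B z) ^ n * (h z * cnj (g z) - S h z * cnj (S g z))) = 0"
proof -
  have Sb: "S f \<in> bergman" if "f \<in> bergman" for f
    using S that by (auto simp: unitary_operator_def)
  have pow: "(mult_op B ^^ k) f \<in> bergman" if "f \<in> bergman" for k f
    using that by (induction k) (auto intro!: bergman_mult_bounded B)
  have Spow: "S ((mult_op B ^^ k) f) = (mult_op B ^^ k) (S f)" if "f \<in> bergman" for k f
    using that by (induction k) (simp_all add: comm pow)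
  have "bergman_inner (S ((mult_op B ^^ m) h)) (S ((mult_op B ^^ n) g)) = bergman_inner ((mult_op B ^^ m) h) ((mult_op B ^^ n) g)"
    using S pow h by (auto simp: unitary_operator_def)
  hence eq: "(LINT z:ball 0 1|lborel. (mult_op B ^^ m) (S h) z * cnj ((mult_op B ^^ n) (S g) z)) =
     (LINT z:ball 0 1|lborel. (mult_op B ^^ m) h z * cnj ((mult_op B ^^ n) g z))"
    by (simp add: bergman_inner_def Spow h)
  have "(LINT z:ball 0 1|lborel. (mult_op B ^^ m) h z * cnj ((mult_op B ^^ n) g z) - (mult_op B ^^ m) (S h) z * cnj ((mult_op B ^^ n) (S g) z)) = 0"
    by (subst set_integral_diff(2)) (use eq pow Sb h in \<open>auto intro!: bergman_integrable_mult_cnj\<close>)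
  also have "(\<lambda>z. (mult_op B ^^ m) h z * cnj ((mult_op B ^^ n) g z) - (mult_op B ^^ m) (S h) z * cnj ((mult_op B ^^ n) (S g) z))
     = (\<lambda>z. B z ^ m * cnj (B z) ^ n * (h z * cnj (g z) - S h z * cnj (S g z)))"
    by (simp add: funpow_mult_op fun_eq_iff algebra_simps)
  finally show ?thesis .
qed

text \<open>
  After multiplication by \<open>cnj a\<close> the integrand has nonnegative real part, which is bounded
  below on a ball.
\<close>

lemma weighted_integral_nonzero:
  fixes \<Phi> :: "complex \<Rightarrow> complex" and \<phi> :: "complex \<Rightarrow> real"
  assumes int: "set_integrable lborel V (\<lambda>z. of_real (\<phi> z) * \<Phi> z)"
    and nonneg: "\<And>z. z \<in> V \<Longrightarrow> 0 \<le> \<phi> z"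
    and near: "\<And>z. z \<in> V \<Longrightarrow> cmod (\<Phi> z - a) \<le> cmod a / 2" and a: "a \<noteq> 0"
    and d: "0 < d" "ball w d \<subseteq> V" and s: "0 < s" "\<And>z. z \<in> ball w d \<Longrightarrow> s \<le> \<phi> z"
  shows "(LINT z:V|lborel. of_real (\<phi> z) * \<Phi> z) \<noteq> 0"
proof
  assume 0: "(LINT z:V|lborel. of_real (\<phi> z) * \<Phi> z) = 0"
  define c where "c = (cmod a)\<^sup>2 / 2"
  have c: "0 < c" using a by (simp add: c_def)
  define q where "q = (\<lambda>z. indicat_real V z *\<^sub>R (of_real (\<phi> z) * \<Phi> z))"
  have q: "integrable lborel q" using int by (simp add: q_def set_integrable_def)
  have "(\<integral>z. Re (cnj a * q z) \<partial>lborel) = Re (\<integral>z. cnj a * q z \<partial>lborel)"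
    by (rule integral_Re) (rule integrable_mult_right[OF q])
  also have "(\<integral>z. cnj a * q z \<partial>lborel) = cnj a * (\<integral>z. q z \<partial>lborel)"
    by (rule integral_mult_right_zero)
  also have "(\<integral>z. q z \<partial>lborel) = 0"
    using 0 unfolding q_def set_lebesgue_integral_def .
  finally have I0: "(\<integral>z. Re (cnj a * q z) \<partial>lborel) = 0" by simp
  have "(\<integral>z. indicat_real (ball w d) z * (s * c) \<partial>lborel) \<le> (\<integral>z. Re (cnj a * q z) \<partial>lborel)"
  proof (rule integral_mono)
    show "integrable lborel (\<lambda>z. indicat_real (ball w d) z * (s * c))"
      by (intro integrable_mult_left) (auto intro!: integrable_real_indicator emeasure_lborel_ball_finite)
    show "integrable lborel (\<lambda>z. Re (cnj a * q z))"
      by (rule integrable_Re) (rule integrable_mult_right[OF q])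
    fix z
    have low: "c \<le> Re (cnj a * \<Phi> z)" if z: "z \<in> V"
    proof -
      have "\<bar>Re (cnj a * (\<Phi> z - a))\<bar> \<le> cmod (cnj a * (\<Phi> z - a))" by (rule abs_Re_le_cmod)
      also have "\<dots> \<le> cmod a * (cmod a / 2)"
        unfolding norm_mult complex_mod_cnj using near[OF z] by (intro mult_left_mono) auto
      also have "cmod a * (cmod a / 2) = c" by (simp add: c_def power2_eq_square)
      finally have "- c \<le> Re (cnj a * (\<Phi> z - a))" by linarith
      moreover have "Re (cnj a * \<Phi> z) = Re (cnj a * (\<Phi> z - a)) + Re (cnj a * a)"
        by (simp add: algebra_simps)
      moreover have "Re (cnj a * a) = 2 * c"
        by (simp add: c_def cmod_power2) (simp add: power2_eq_square)
      ultimately show ?thesis by linarith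
    qed
    show "indicat_real (ball w d) z * (s * c) \<le> Re (cnj a * q z)"
    proof (cases "z \<in> V")
      case True
      have eq: "Re (cnj a * q z) = \<phi> z * Re (cnj a * \<Phi> z)"
        using True by (simp add: q_def algebra_simps)
      show ?thesis
      proof (cases "z \<in> ball w d")
        case zd: True
        have "s * c \<le> \<phi> z * Re (cnj a * \<Phi> z)"
          using s c low[OF True] s(2)[OF zd] by (intro mult_mono) auto
        thus ?thesis unfolding eq using zd by simp
      next
        case False
        have "0 \<le> \<phi> z * Re (cnj a * \<Phi> z)" using nonneg[OF True] low[OF True] c by simp
        thus ?thesis unfolding eq using False by simp
      qed
    next
      case False
      hence "z \<notin> ball w d" using d by blast
      thus ?thesis using False by (simp add: q_def)
    qed
  qed
  also note I0
  finally have "measure lborel (ball w d) * (s * c) \<le> 0" by simp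
  moreover have "0 < measure lborel (ball w d) * (s * c)"
    using content_ball_pos[OF d(1), of w] s c by simp
  ultimately show False by simp
qed

context thin_blaschke_local_inverses
begin

text \<open>
  If the difference \<open>\<Phi>\<close> of the two sides did not vanish at \<open>w\<close>, then its integral against a
  bump function of \<open>B z\<close> concentrated near \<open>w\<close> would not vanish. Summing over the sheets turns
  this integral into the integral over the whole disc of \<open>f\<close> against a function of \<open>B\<close>, which is
  0.
\<close>

lemma gram_eq_of_moments:
  assumes h: "h1 \<in> bergman" "g1 \<in> bergman" "h2 \<in> bergman" "g2 \<in> bergman"
    and moments: "\<And>m n. (LINT z:ball 0 1|lborel. B z ^ m * cnj (B z) ^ n * (h1 z * cnj (g1 z) - h2 z * cnj (g2 z))) = 0"
    and w: "w \<in> G"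
  shows "l2_inner (pi_map \<rho> w h1) (pi_map \<rho> w g1) = l2_inner (pi_map \<rho> w h2) (pi_map \<rho> w g2)"
proof (rule ccontr)
  assume neq: "\<not> ?thesis"
  define f where "f = (\<lambda>z. h1 z * cnj (g1 z) - h2 z * cnj (g2 z))"
  define \<Phi> where "\<Phi> = (\<lambda>z. l2_inner (pi_map \<rho> z h1) (pi_map \<rho> z g1) - l2_inner (pi_map \<rho> z h2) (pi_map \<rho> z g2))"
  define summand where "summand = (\<lambda>k z. of_real ((cmod (deriv (\<rho> k) z))\<^sup>2) * f (\<rho> k z))"
  have fi: "set_integrable lborel (ball 0 1) f"
    unfolding f_def by (intro set_integral_diff(1) bergman_integrable_mult_cnj h)
  have hol: "k holomorphic_on ball 0 1" if "k \<in> bergman" for k using that by (simp add: bergman_def)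
  have fc: "continuous_on (ball 0 1) f"
    unfolding f_def by (intro continuous_intros holomorphic_on_imp_continuous_on hol h)
  have cB: "continuous_on (ball 0 1) B" by (rule holomorphic_on_imp_continuous_on[OF B_holomorphic])
  have summand_eq: "summand k z = pi_map \<rho> z h1 k * cnj (pi_map \<rho> z g1 k) - pi_map \<rho> z h2 k * cnj (pi_map \<rho> z g2 k)" for k z
    unfolding summand_def f_def pi_map_def complex_norm_square by (simp add: algebra_simps)
  have summand_sums: "(\<lambda>k. summand k z) sums \<Phi> z" if "z \<in> G" for z
    unfolding summand_eq \<Phi>_def by (intro sums_diff l2_inner_sums pi_map_in_l2 that h)
  have \<Phi>c: "continuous_on G \<Phi>"
    unfolding \<Phi>_def by (intro continuous_intros inner_pi_map_continuous h)
  have "\<exists>r>0. ball w r \<subseteq> G \<and> inj_on B (ball w r) \<and> (\<exists>M. summable M \<and> (\<forall>z\<in>ball w r. \<forall>k. cmod (summand k z) \<le> M k))"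
  proof -
    obtain R where R: "0 < R" "ball w R \<subseteq> G" "inj_on B (ball w R)" using good_disc[OF w] .
    define r where "r = R / 2"
    have K: "compact (cball w r)" "cball w r \<subseteq> G" using R by (auto simp: r_def)
    obtain M1 M2 M3 M4 where M: "summable M1" "summable M2" "summable M3" "summable M4"
      "\<And>z k. z \<in> cball w r \<Longrightarrow> (cmod (pi_map \<rho> z h1 k))\<^sup>2 \<le> M1 k"
      "\<And>z k. z \<in> cball w r \<Longrightarrow> (cmod (pi_map \<rho> z g1 k))\<^sup>2 \<le> M2 k"
      "\<And>z k. z \<in> cball w r \<Longrightarrow> (cmod (pi_map \<rho> z h2 k))\<^sup>2 \<le> M3 k"
      "\<And>z k. z \<in> cball w r \<Longrightarrow> (cmod (pi_map \<rho> z g2 k))\<^sup>2 \<le> M4 k"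
      using pi_map_compact_dominated[OF K h(1)] pi_map_compact_dominated[OF K h(2)]
        pi_map_compact_dominated[OF K h(3)] pi_map_compact_dominated[OF K h(4)] by metis
    have prod_le: "cmod (x * cnj y) \<le> X + Y" if "(cmod x)\<^sup>2 \<le> X" "(cmod y)\<^sup>2 \<le> Y" for x y X Y
      using norm_mult_cnj_le[of x y] that by linarith
    have "cmod (summand k z) \<le> (M1 k + M2 k) + (M3 k + M4 k)" if "z \<in> ball w r" for z k
    proof -
      have z: "z \<in> cball w r" using that by auto
      show ?thesis
        unfolding summand_eq
        by (rule order.trans[OF norm_triangle_ineq4 add_mono[OF prod_le[OF M(5)[OF z] M(6)[OF z]] prod_le[OF M(7)[OF z] M(8)[OF z]]]])
    qed
    moreover have "summable (\<lambda>k. (M1 k + M2 k) + (M3 k + M4 k))"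
      by (rule summable_add[OF summable_add[OF M(1,2)] summable_add[OF M(3,4)]])
    moreover have "ball w r \<subseteq> ball w R" using R by (auto simp: r_def)
    ultimately show ?thesis using R by (intro exI[of _ r]) (auto simp: r_def intro: inj_on_subset)
  qed
  then obtain r M where r: "0 < r" "ball w r \<subseteq> G" "inj_on B (ball w r)"
    and M: "summable M" "\<And>z k. z \<in> ball w r \<Longrightarrow> cmod (summand k z) \<le> M k" by blast
  have \<Phi>w: "\<Phi> w \<noteq> 0" using neq by (simp add: \<Phi>_def)
  have "isCont \<Phi> w" using \<Phi>c open_G w by (simp add: continuous_on_eq_continuous_at)
  then obtain t0 where t0: "0 < t0" "\<And>z. dist z w < t0 \<Longrightarrow> dist (\<Phi> z) (\<Phi> w) < cmod (\<Phi> w) / 2"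
    using \<Phi>w unfolding continuous_at_eps_delta dist_norm by (metis half_gt_zero zero_less_norm_iff)
  define t where "t = min t0 r"
  define V where "V = ball w t"
  have t: "0 < t" "t \<le> t0" "t \<le> r" using t0 r by (auto simp: t_def)
  have V: "open V" "V \<subseteq> G" "inj_on B V" "w \<in> V" "V \<subseteq> ball w r"
    using t r by (auto simp: V_def intro: inj_on_subset)
  have VD: "V \<subseteq> ball 0 1" using V(2) G_subset by blast
  have "open (B ` V)"
    using open_mapping_thm3[OF holomorphic_on_subset[OF B_holomorphic VD] V(1,3)] by blast
  then obtain s where s: "0 < s" "ball (B w) s \<subseteq> B ` V" using V(4) open_contains_ball by blast
  \<comment> \<open>A bump function supported in \<open>B ` V\<close>.\<close>
  define \<phi> where "\<phi> = (\<lambda>u. max 0 (s - dist u (B w)))"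
  have \<phi>: "continuous_on UNIV \<phi>" "\<And>u. 0 \<le> \<phi> u" "\<And>u. \<phi> u \<le> s"
    unfolding \<phi>_def using s by (auto intro!: continuous_intros)
  have \<phi>0: "\<phi> u = 0" if "u \<notin> B ` V" for u
  proof -
    have "\<not> dist u (B w) < s" using that s(2) by (auto simp: dist_commute)
    thus ?thesis by (simp add: \<phi>_def)
  qed
  define f' where "f' = (\<lambda>z. of_real (\<phi> (B z)) * f z)"
  have c\<phi>B: "continuous_on (ball 0 1) (\<lambda>z. complex_of_real (\<phi> (B z)))"
    by (intro continuous_intros continuous_on_compose2[OF \<phi>(1) cB]) auto
  have f'i: "set_integrable lborel (ball 0 1) f'"
    unfolding f'_def by (rule set_integrable_bounded_mult[OF open_ball fi fc c\<phi>B, of s]) (use \<phi> in auto)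
  have f'c: "continuous_on (ball 0 1) f'"
    unfolding f'_def by (intro continuous_intros c\<phi>B fc)
  \<comment> \<open>\<open>\<phi> (B z)\<close> vanishes off the sheets over \<open>V\<close>, so the integral over the sheets is one over the whole disc and vanishes with the moments.\<close>
  have "(LINT z:{z \<in> ball 0 1. B z \<in> B ` V}|lborel. f' z) = (LINT z:ball 0 1|lborel. f' z)"
    unfolding set_lebesgue_integral_def
    by (rule Bochner_Integration.integral_cong[OF refl]) (use \<phi>0 in \<open>auto simp: indicator_def f'_def\<close>)
  also have "\<dots> = 0"
    unfolding f'_def
    by (rule vanishing_moments_imp_zero[OF fi fc cB _ _ \<phi>(1)])
       (use norm_B_less_1 moments in \<open>auto simp: f_def intro: less_imp_le\<close>)
  finally have total: "(LINT z:{z \<in> ball 0 1. B z \<in> B ` V}|lborel. f' z) = 0" .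
  have on_sheet: "of_real ((cmod (deriv (\<rho> k) z))\<^sup>2) * f' (\<rho> k z) = of_real (\<phi> (B z)) * summand k z" if "z \<in> V" for k z
    using that V(2) B_rho[of z k] by (auto simp: f'_def summand_def mult_ac)
  define F where "F = (\<lambda>k z. indicat_real V z *\<^sub>R (of_real (\<phi> (B z)) * summand k z))"
  have F_eq: "F k = (\<lambda>z. indicat_real V z *\<^sub>R (of_real ((cmod (deriv (\<rho> k) z))\<^sup>2) * f' (\<rho> k z)))" for k
  proof
    fix z
    show "F k z = indicat_real V z *\<^sub>R (of_real ((cmod (deriv (\<rho> k) z))\<^sup>2) * f' (\<rho> k z))"
    proof (cases "z \<in> V")
      case True
      show ?thesis by (simp only: F_def on_sheet[OF True])
    qed (simp add: F_def)
  qed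
  note sh = integral_over_sheets[OF V(1,2,3) f'i f'c]
  have Fi: "integrable lborel (F k)" for k
    using sh(1)[of k] unfolding F_eq set_integrable_def .
  have Fs: "(\<lambda>k. integral\<^sup>L lborel (F k)) sums 0"
    using sh(2)[unfolded total] unfolding F_eq set_lebesgue_integral_def .
  have Fle: "norm (F k z) \<le> indicat_real V z * (s * M k)" for k z
  proof (cases "z \<in> V")
    case True
    have "\<phi> (B z) * cmod (summand k z) \<le> s * M k"
      using \<phi>(2,3) M(2)[of z k] True V(5) s by (intro mult_mono) auto
    thus ?thesis using True \<phi>(2) by (simp add: F_def norm_mult)
  qed (simp add: F_def)
  have iV: "integrable lborel (\<lambda>z::complex. indicat_real V z * c)" for c
    unfolding V_def
    by (intro integrable_mult_left) (auto intro!: integrable_real_indicator emeasure_lborel_ball_finite)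
  have sM: "summable (\<lambda>k. s * M k)" by (rule summable_mult[OF M(1)])
  have summ: "AE z in lborel. summable (\<lambda>k. norm (F k z))"
  proof (rule AE_I2)
    fix z
    show "summable (\<lambda>k. norm (F k z))"
      by (rule summable_comparison_test'[OF summable_mult[OF sM]]) (use Fle[of _ z] in auto)
  qed
  have isumm: "summable (\<lambda>k. \<integral>z. norm (F k z) \<partial>lborel)"
  proof (rule summable_comparison_test'[OF summable_mult[OF sM]])
    fix k
    have "(\<integral>z. norm (F k z) \<partial>lborel) \<le> (\<integral>z. indicat_real V z * (s * M k) \<partial>lborel)"
      by (rule integral_mono[OF integrable_norm[OF Fi] iV Fle])
    thus "norm (\<integral>z. norm (F k z) \<partial>lborel) \<le> measure lborel V * (s * M k)"
      by simp
  qed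
  \<comment> \<open>On \<open>V\<close> the weight \<open>\<phi> (B z)\<close> is the same on all sheets, so it factors out of the sum over \<open>k\<close>.\<close>
  have sumF: "(\<Sum>k. F k z) = indicat_real V z *\<^sub>R (of_real (\<phi> (B z)) * \<Phi> z)" for z
  proof (cases "z \<in> V")
    case True
    hence "(\<lambda>k. of_real (\<phi> (B z)) * summand k z) sums (of_real (\<phi> (B z)) * \<Phi> z)"
      using V(2) by (intro sums_mult summand_sums) auto
    thus ?thesis using True by (simp add: F_def sums_iff)
  qed (simp add: F_def)
  have "(\<integral>z. (\<Sum>k. F k z) \<partial>lborel) = 0"
    by (rule sums_unique2[OF sums_integral[OF Fi summ isumm] Fs])
  hence zero: "(LINT z:V|lborel. of_real (\<phi> (B z)) * \<Phi> z) = 0"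
    by (simp add: sumF set_lebesgue_integral_def)
  have \<Phi>int: "set_integrable lborel V (\<lambda>z. of_real (\<phi> (B z)) * \<Phi> z)"
    using integrable_suminf[OF Fi summ isumm] by (simp add: sumF set_integrable_def)
  have "isCont B w" using cB w G_subset by (auto simp: continuous_on_eq_continuous_at)
  then obtain d0 where d0: "0 < d0" "\<And>z. dist z w < d0 \<Longrightarrow> dist (B z) (B w) < s / 2"
    using s unfolding continuous_at_eps_delta dist_norm by (metis half_gt_zero)
  have "(LINT z:V|lborel. of_real (\<phi> (B z)) * \<Phi> z) \<noteq> 0"
  proof (rule weighted_integral_nonzero[OF \<Phi>int _ _ \<Phi>w, of "min d0 t" w "s / 2"])
    show "cmod (\<Phi> z - \<Phi> w) \<le> cmod (\<Phi> w) / 2" if "z \<in> V" for z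
    proof -
      have "dist z w < t0" using that t by (simp add: V_def dist_commute)
      thus ?thesis using t0(2)[of z] by (simp add: dist_norm)
    qed
    show "s / 2 \<le> \<phi> (B z)" if "z \<in> ball w (min d0 t)" for z
    proof -
      have "dist (B z) (B w) < s / 2" using d0(2)[of z] that by (simp add: dist_commute)
      thus ?thesis unfolding \<phi>_def le_max_iff_disj by linarith
    qed
  qed (use \<phi> d0 t s in \<open>auto simp: V_def\<close>)
  thus False using zero by blast
qed

end

section \<open>The representation theorem\<close>

context thin_blaschke_local_inverses
begin

text \<open>
  The case \<open>w = v\<close> is \<open>gram_eq_of_moments\<close>, and polarization gives the rest.
\<close>

lemma inner_pi_map_eq_of_commuting_unitary:
  assumes S: "unitary_operator bergman bergman_inner S"
    and comm: "\<And>h. h \<in> bergman \<Longrightarrow> S (mult_op B h) = mult_op B (S h)"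
    and h: "h \<in> bergman" "g \<in> bergman" and w: "w \<in> G" and v: "v \<in> G"
  shows "l2_inner (pi_map \<rho> w h) (pi_map \<rho> v g) = l2_inner (pi_map \<rho> w (S h)) (pi_map \<rho> v (S g))"
proof -
  have Sb: "S f \<in> bergman" if "f \<in> bergman" for f
    using S that by (auto simp: unitary_operator_def)
  define K where "K = (\<lambda>w v. l2_inner (pi_map \<rho> w h) (pi_map \<rho> v g) - l2_inner (pi_map \<rho> w (S h)) (pi_map \<rho> v (S g)))"
  have "K w v = 0"
  proof (rule sesquiholomorphic_zero_on_diagonal[OF open_G connected_G _ _ w v])
    fix A f q
    assume A: "open A" "f holomorphic_on A" "q holomorphic_on A" "f ` A \<subseteq> G" "(\<lambda>x. cnj (q x)) ` A \<subseteq> G"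
    show "(\<lambda>x. K (f x) (cnj (q x))) holomorphic_on A"
      unfolding K_def
      by (rule holomorphic_on_diff[OF inner_pi_map_holomorphic[OF h A(1,2,4,3,5)] inner_pi_map_holomorphic[OF Sb[OF h(1)] Sb[OF h(2)] A(1,2,4,3,5)]])
  next
    fix w assume w: "w \<in> G"
    show "K w w = 0"
      unfolding K_def
      using gram_eq_of_moments[OF h Sb[OF h(1)] Sb[OF h(2)] commuting_unitary_moments[OF S comm B_holomorphic _ h] w] norm_B_less_1
      by (auto intro: less_imp_le)
  qed
  thus ?thesis by (simp add: K_def)
qed

text \<open>
  A multiple of \<open>(B(z) - B(w)) / (z - \<rho> k w)\<close>, with the singularity removed: it vanishes at all
  points of the fibre except \<open>\<rho> k w\<close>, where the derivative of \<open>B\<close> is not 0.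
\<close>

lemma pi_map_eq_l2_unit:
  assumes w: "w \<in> G"
  shows "\<exists>h\<in>bergman. pi_map \<rho> w h = l2_unit k"
proof -
  define p where "p = \<rho> k w"
  have p: "p \<in> ball 0 1" "B p = B w" "deriv B p \<noteq> 0"
    using rho_in_disc[OF w, of k] B_rho[OF w, of k] noncritical[OF w, of p] by (auto simp: p_def)
  \<comment> \<open>The difference quotient of \<open>B\<close> at \<open>p\<close>, bounded near \<open>p\<close> by compactness and elsewhere by \<open>2 / d\<close>.\<close>
  define q where "q = (\<lambda>z. if z = p then deriv B p else (B z - B p) / (z - p))"
  have q: "q holomorphic_on ball 0 1"
    unfolding q_def by (rule pole_lemma[OF B_holomorphic]) (use p in \<open>simp add: interior_open\<close>)
  obtain d where d: "0 < d" "cball p d \<subseteq> ball 0 1" using open_contains_cball[of "ball (0::complex) 1"] open_ball p(1) by blast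
  have "compact (q ` cball p d)"
    by (rule compact_continuous_image[OF holomorphic_on_imp_continuous_on[OF holomorphic_on_subset[OF q d(2)]] compact_cball])
  hence "bounded (q ` cball p d)" by (rule compact_imp_bounded)
  then obtain C where C: "\<And>z. z \<in> cball p d \<Longrightarrow> cmod (q z) \<le> C" unfolding bounded_iff by blast
  have bdd: "cmod (q z) \<le> max C (2 / d)" if z: "z \<in> ball 0 1" for z
  proof (cases "z \<in> cball p d")
    case True
    thus ?thesis using C by (simp add: le_max_iff_disj)
  next
    case False
    hence far: "d \<le> cmod (z - p)" by (simp add: dist_norm norm_minus_commute)
    have "cmod (B z - B p) \<le> 2"
      using norm_triangle_ineq4[of "B z" "B p"] norm_B_less_1[OF z] norm_B_less_1[OF p(1)] by linarith
    hence "cmod (B z - B p) / cmod (z - p) \<le> 2 / d" using far d by (intro frac_le) auto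
    moreover have "z \<noteq> p" using False d by auto
    ultimately show ?thesis by (simp add: q_def norm_divide le_max_iff_disj)
  qed
  define c where "c = 1 / (deriv B p * deriv (\<rho> k) w)"
  define h where "h = (\<lambda>z. if z \<in> ball 0 1 then c * q z else 0)"
  have "h \<in> bergman"
    unfolding h_def
  proof (rule bounded_holomorphic_in_bergman)
    show "(\<lambda>z. c * q z) holomorphic_on ball 0 1" by (intro holomorphic_intros q)
    show "cmod (c * q z) \<le> cmod c * max C (2 / d)" if "z \<in> ball 0 1" for z
      unfolding norm_mult using bdd[OF that] by (rule mult_left_mono) simp
  qed
  moreover have "pi_map \<rho> w h = l2_unit k"
  proof
    fix j
    show "pi_map \<rho> w h j = l2_unit k j"
    proof (cases "j = k")
      case True
      thus ?thesis
        using rho_in_disc[OF w, of k] p deriv_rho_nonzero[OF w, of k]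
        by (simp add: pi_map_def h_def l2_unit_def q_def p_def[symmetric] c_def)
    next
      case False
      hence "\<rho> j w \<noteq> p" using rho_distinct[OF w, of j k] by (auto simp: p_def)
      hence "q (\<rho> j w) = 0" using B_rho[OF w, of j] p by (simp add: q_def)
      thus ?thesis using False by (simp add: pi_map_def h_def l2_unit_def)
    qed
  qed
  ultimately show ?thesis by blast
qed

end

theorem theorem3p3:
  fixes B :: "complex \<Rightarrow> complex"
    and L :: "complex set"
    and \<rho> :: "nat \<Rightarrow> complex \<Rightarrow> complex"
    and S :: "(complex \<Rightarrow> complex) \<Rightarrow> (complex \<Rightarrow> complex)"
  assumes thin: "thin_blaschke_product B"
    and L_disc: "L \<subseteq> unit_disc"
    and L_closed: "closedin (top_of_set unit_disc) L"
    and L_curve: "countable_union_of_C1_arcs L"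
    and L_crit: "{z \<in> unit_disc. B z \<in> critical_values B} \<subseteq> L"
    and L_conn: "connected (unit_disc - L)"
    and L_simply: "simply_connected (unit_disc - L)"
    and rho: "enumerates_local_inverses B (unit_disc - L) \<rho>"
    and S_unitary: "unitary_operator bergman bergman_inner S"
    and S_comm: "\<And>h. h \<in> bergman \<Longrightarrow> S (mult_op B h) = mult_op B (S h)"
  shows
    "(\<forall>w\<in>unit_disc - L. \<forall>h\<in>bergman. pi_map \<rho> w h \<in> l2) \<and>
     (\<exists>!W. bounded_operator l2 l2_inner W \<and>
           (\<forall>h\<in>bergman. \<forall>w\<in>unit_disc - L. W (pi_map \<rho> w h) = pi_map \<rho> w (S h))) \<and>
     (\<forall>W. bounded_operator l2 l2_inner W \<and>
           (\<forall>h\<in>bergman. \<forall>w\<in>unit_disc - L. W (pi_map \<rho> w h) = pi_map \<rho> w (S h)) \<longrightarrow>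
          unitary_operator l2 l2_inner W) \<and>
     (\<exists>!c. c \<in> l2 \<and>
           (\<forall>h\<in>bergman. \<forall>z\<in>unit_disc - L.
              (\<lambda>k. c k * h (\<rho> k z) * deriv (\<rho> k) z) sums S h z)) \<and>
     (\<forall>c. c \<in> l2 \<and>
           (\<forall>h\<in>bergman. \<forall>z\<in>unit_disc - L.
              (\<lambda>k. c k * h (\<rho> k z) * deriv (\<rho> k) z) sums S h z) \<longrightarrow>
          (\<forall>h\<in>bergman. \<forall>K. compact K \<and> K \<subseteq> unit_disc - L \<longrightarrow>
              uniform_limit K (\<lambda>n z. \<Sum>k<n. c k * h (\<rho> k z) * deriv (\<rho> k) z) (S h) sequentially))"
proof -
  interpret thin_blaschke_local_inverses B L \<rho>
    using thin L_closed L_crit L_conn L_simply rho by unfold_locales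
  obtain w0 where w0: "w0 \<in> G" using G_nonempty by blast
  \<comment> \<open>\<open>e k\<close> and its preimage \<open>e' k\<close> under \<open>S\<close> provide the unit vectors in the families \<open>p\<close> and \<open>q\<close>.\<close>
  obtain e where e: "\<And>k. e k \<in> bergman" "\<And>k. pi_map \<rho> w0 (e k) = l2_unit k"
    using pi_map_eq_l2_unit[OF w0] by metis
  have Sb: "S h \<in> bergman" if "h \<in> bergman" for h
    using S_unitary that by (auto simp: unitary_operator_def)
  have "\<exists>h\<in>bergman. S h = e k" for k
    using S_unitary e(1)[of k] unfolding unitary_operator_def by (metis imageE)
  then obtain e' where e': "\<And>k. e' k \<in> bergman" "\<And>k. S (e' k) = e k" by metis
  define p where "p = (\<lambda>(w, h). pi_map \<rho> w h)"
  define q where "q = (\<lambda>(w, h). pi_map \<rho> w (S h))"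
  define W where "W = (\<lambda>a\<in>l2. \<lambda>k. l2_inner a (p (w0, e' k)))"
  define intertwines where "intertwines = (\<lambda>U. \<forall>h\<in>bergman. \<forall>w\<in>unit_disc - L. U (pi_map \<rho> w h) = pi_map \<rho> w (S h))"
  define represents where "represents = (\<lambda>c. \<forall>h\<in>bergman. \<forall>z\<in>unit_disc - L. (\<lambda>k. c k * h (\<rho> k z) * deriv (\<rho> k) z) sums S h z)"
  have in_l2: "pi_map \<rho> w h \<in> l2" if "w \<in> G" "h \<in> bergman" for w h
    using pi_map_in_l2 that .
  have gram: "l2_inner (p i) (p j) = l2_inner (q i) (q j)" if "i \<in> G \<times> bergman" "j \<in> G \<times> bergman" for i j
    using that inner_pi_map_eq_of_commuting_unitary[OF S_unitary S_comm] by (auto simp: p_def q_def)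
  have p_l2: "p i \<in> l2" and q_l2: "q i \<in> l2" if "i \<in> G \<times> bergman" for i
    using that in_l2 Sb by (auto simp: p_def q_def)
  have idx: "(w0, e k) \<in> G \<times> bergman" "p (w0, e k) = l2_unit k"
    "(w0, e' k) \<in> G \<times> bergman" "q (w0, e' k) = l2_unit k" for k
    using w0 e e' by (simp_all add: p_def q_def)
  note gram_unitary = equal_gram_unitary[where I = "G \<times> bergman" and p = p and q = q
      and s = "\<lambda>k. (w0, e k)" and t = "\<lambda>k. (w0, e' k)"]
  have W_unitary: "unitary_operator l2 l2_inner W"
    unfolding W_def by (rule gram_unitary(1)) (simp_all only: p_l2 q_l2 gram idx)
  have W_p: "W (p i) = q i" if "i \<in> G \<times> bergman" for i
    unfolding W_def by (rule gram_unitary(2)[OF _ _ _ _ _ _ _ that]) (simp_all only: p_l2 q_l2 gram idx)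
  have W_unique: "U = W" if "bounded_operator l2 l2_inner U" "\<And>i. i \<in> G \<times> bergman \<Longrightarrow> U (p i) = q i" for U
    unfolding W_def by (rule gram_unitary(3)[OF _ _ _ _ _ _ _ that]) (simp_all only: p_l2 q_l2 gram idx)
  have W_bounded: "bounded_operator l2 l2_inner W" using W_unitary by (simp add: unitary_operator_def)
  have W_int: "intertwines W"
    unfolding intertwines_def
  proof (intro ballI)
    fix h w assume "h \<in> bergman" "w \<in> unit_disc - L"
    thus "W (pi_map \<rho> w h) = pi_map \<rho> w (S h)" using W_p[of "(w, h)"] by (simp add: p_def q_def G_def)
  qed
  have uniqueW: "U = W" if "bounded_operator l2 l2_inner U" "intertwines U" for U
  proof (rule W_unique[OF that(1)])
    fix i assume "i \<in> G \<times> bergman"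
    thus "U (p i) = q i" using that(2) by (cases i) (simp add: intertwines_def p_def q_def G_def)
  qed
  \<comment> \<open>The row of index 0 of the matrix of \<open>W\<close>.\<close>
  define c where "c = (\<lambda>k. cnj (pi_map \<rho> w0 (e' 0) k))"
  have c: "c \<in> l2"
    using in_l2[OF w0 e'(1)[of 0]] by (simp add: c_def l2_def)
  have c_rep: "represents c"
    unfolding represents_def
  proof (intro ballI)
    fix h z assume h: "h \<in> bergman" and z: "z \<in> unit_disc - L"
    have zG: "z \<in> G" using z by (simp add: G_def)
    have "S h z = pi_map \<rho> z (S h) 0" using zG by (simp add: pi_map_def rho_0 deriv_rho_0)
    also have "\<dots> = W (pi_map \<rho> z h) 0" using W_int h z by (simp add: intertwines_def)
    also have "\<dots> = l2_inner (pi_map \<rho> z h) (pi_map \<rho> w0 (e' 0))"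
      using in_l2[OF zG h] by (simp add: W_def p_def)
    finally have "(\<lambda>k. pi_map \<rho> z h k * cnj (pi_map \<rho> w0 (e' 0) k)) sums S h z"
      using l2_inner_sums[OF in_l2[OF zG h] in_l2[OF w0 e'(1)[of 0]]] by simp
    thus "(\<lambda>k. c k * h (\<rho> k z) * deriv (\<rho> k) z) sums S h z"
      by (simp add: c_def pi_map_def mult_ac)
  qed
  \<comment> \<open>Evaluating the series for \<open>e k\<close> at \<open>w0\<close> isolates one coefficient.\<close>
  have rep_coeff: "c' k = S (e k) w0" if "represents c'" for c' k
  proof -
    have "(\<lambda>j. c' j * pi_map \<rho> w0 (e k) j) sums S (e k) w0"
      using that e(1)[of k] w0 by (simp add: represents_def pi_map_def G_def mult.assoc)
    moreover have "(\<lambda>j. c' j * pi_map \<rho> w0 (e k) j) sums (\<Sum>j\<in>{k}. c' j * pi_map \<rho> w0 (e k) j)"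
      by (rule sums_finite) (auto simp: e(2) l2_unit_def)
    ultimately show ?thesis by (auto simp: e(2) l2_unit_def dest: sums_unique2)
  qed
  have uniquec: "c' = c" if "represents c'" for c'
    using rep_coeff[OF that] rep_coeff[OF c_rep] by auto
  have unif: "uniform_limit K (\<lambda>n z. \<Sum>k<n. c' k * h (\<rho> k z) * deriv (\<rho> k) z) (S h) sequentially"
    if c': "c' \<in> l2" "represents c'" and h: "h \<in> bergman" and K: "compact K" "K \<subseteq> unit_disc - L" for c' h K
  proof -
    have KG: "K \<subseteq> G" using K by (simp add: G_def)
    obtain M where M: "summable M" "\<And>z k. z \<in> K \<Longrightarrow> (cmod (pi_map \<rho> z h k))\<^sup>2 \<le> M k"
      using pi_map_compact_dominated[OF K(1) KG h] by blast
    have lim: "uniform_limit K (\<lambda>n z. \<Sum>k<n. pi_map \<rho> z h k * cnj (cnj (c' k))) (\<lambda>z. l2_inner (pi_map \<rho> z h) (\<lambda>k. cnj (c' k))) sequentially"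
      by (rule l2_inner_uniform_limit[OF M(1) _ l2D[OF c'(1)]]) (use M(2) in auto)
    show ?thesis
    proof (rule uniform_limit_cong'[THEN iffD1, OF _ _ lim])
      fix z assume z: "z \<in> K"
      have "(\<lambda>k. c' k * h (\<rho> k z) * deriv (\<rho> k) z) sums S h z"
        using c'(2) h z K by (auto simp: represents_def)
      hence "(\<lambda>k. pi_map \<rho> z h k * cnj (cnj (c' k))) sums S h z" by (simp add: pi_map_def mult_ac)
      thus "l2_inner (pi_map \<rho> z h) (\<lambda>k. cnj (c' k)) = S h z" by (simp add: l2_inner_def sums_iff)
    qed (simp add: pi_map_def mult_ac)
  qed
  show ?thesis
  proof (intro conjI, goal_cases)
    case 1
    show ?case using in_l2 by (simp add: G_def)
  next
    case 2
    show ?case using W_bounded W_int uniqueW unfolding intertwines_def by blast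
  next
    case 3
    show ?case using W_unitary uniqueW unfolding intertwines_def by blast
  next
    case 4
    show ?case using c c_rep uniquec unfolding represents_def by blast
  next
    case 5
    show ?case using unif unfolding represents_def by blast
  qed
qed

end
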